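(* Let $G$ be a soluble group of finite rank and let $k$ be a field. If $G$ has a faithful irreducible representation over $k$, then $\mathrm{Soc}(G)$ is a locally cyclic $\mathbb{Z}G$-module, where $G$ acts on $\mathrm{Soc}(G)$ by conjugation, and $\mathrm{char}\,k \notin \pi(\mathrm{Soc}(G))$.
   Context: A group $G$ has finite (Prüfer) rank if there is an integer $r$ such that every finitely generated subgroup of $G$ can be generated by $r$ elements. The socle $\mathrm{Soc}(G)$ is the subgroup of $G$ generated by all minimal normal subgroups of $G$ (and $\mathrm{Soc}(G)=1$ if $G$ has no minimal normal subgroups); for soluble $G$ it is abelian, and is regarded as a $\mathbb{Z}G$-module via conjugation. A module is locally cyclic if each of its finitely generated submodules is cyclic (generated by one element). For a group $X$, $\pi(X)$ denotes the set of primes $p$ such that $X$ has an element of order $p$. An irreducible representation of $G$ over $k$ is one afforded by a simple $kG$-module (of arbitrary, possibly infinite, $k$-dimension); it is faithful if its kernel is trivial. *)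

theory Defs
  imports "HOL-Algebra.Algebra"
begin

section \<open>Groups of finite rank, socle, torsion primes\<close>

definition finite_rank :: "('a, 'b) monoid_scheme \<Rightarrow> bool"
  where "finite_rank G \<longleftrightarrow>
    (\<exists>r::nat. \<forall>S. finite S \<and> S \<subseteq> carrier G \<longrightarrow>
       (\<exists>T. finite T \<and> card T \<le> r \<and> T \<subseteq> carrier G \<and> generate G T = generate G S))"

definition minimal_normal :: "('a, 'b) monoid_scheme \<Rightarrow> 'a set \<Rightarrow> bool"
  where "minimal_normal G N \<longleftrightarrow>
    N \<lhd> G \<and> N \<noteq> {\<one>\<^bsub>G\<^esub>} \<and> (\<forall>H. H \<lhd> G \<and> H \<subseteq> N \<longrightarrow> H = {\<one>\<^bsub>G\<^esub>} \<or> H = N)"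

definition socle :: "('a, 'b) monoid_scheme \<Rightarrow> 'a set"
  where "socle G = generate G (\<Union>{N. minimal_normal G N})"

definition torsion_primes :: "('a, 'b) monoid_scheme \<Rightarrow> nat set"
  where "torsion_primes G = {p. Factorial_Ring.prime p \<and> (\<exists>x\<in>carrier G. group.ord G x = p)}"

text \<open>The additive order of the unit; \<open>group.ord\<close> is 0 for elements of infinite order.\<close>

definition ring_char :: "('a, 'b) ring_scheme \<Rightarrow> nat"
  where "ring_char R = group.ord (add_monoid R) \<one>\<^bsub>R\<^esub>"


section \<open>Left modules over a not necessarily commutative ring\<close>

text \<open>The library locale \<open>module\<close> requires a commutative ring of scalars, whereas group rings
  are noncommutative in general. The library locale \<open>submodule\<close> does not mention
  commutativity and is used as it is.\<close>

locale left_module = R?: ring R + M?: abelian_group M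
  for R :: "('r, 's) ring_scheme" (structure) and M :: "('r, 'v, 'm) module_scheme" (structure) +
  assumes smult_closed [simp, intro]:
      "\<lbrakk> a \<in> carrier R; x \<in> carrier M \<rbrakk> \<Longrightarrow> a \<odot>\<^bsub>M\<^esub> x \<in> carrier M"
    and smult_l_distr:
      "\<lbrakk> a \<in> carrier R; b \<in> carrier R; x \<in> carrier M \<rbrakk> \<Longrightarrow>
      (a \<oplus> b) \<odot>\<^bsub>M\<^esub> x = a \<odot>\<^bsub>M\<^esub> x \<oplus>\<^bsub>M\<^esub> b \<odot>\<^bsub>M\<^esub> x"
    and smult_r_distr:
      "\<lbrakk> a \<in> carrier R; x \<in> carrier M; y \<in> carrier M \<rbrakk> \<Longrightarrow>
      a \<odot>\<^bsub>M\<^esub> (x \<oplus>\<^bsub>M\<^esub> y) = a \<odot>\<^bsub>M\<^esub> x \<oplus>\<^bsub>M\<^esub> a \<odot>\<^bsub>M\<^esub> y"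
    and smult_assoc1:
      "\<lbrakk> a \<in> carrier R; b \<in> carrier R; x \<in> carrier M \<rbrakk> \<Longrightarrow>
      (a \<otimes> b) \<odot>\<^bsub>M\<^esub> x = a \<odot>\<^bsub>M\<^esub> (b \<odot>\<^bsub>M\<^esub> x)"
    and smult_one [simp]:
      "x \<in> carrier M \<Longrightarrow> \<one> \<odot>\<^bsub>M\<^esub> x = x"

definition simple_module :: "('r, 's) ring_scheme \<Rightarrow> ('r, 'v, 'm) module_scheme \<Rightarrow> bool"
  where "simple_module R M \<longleftrightarrow>
    left_module R M \<and> carrier M \<noteq> {\<zero>\<^bsub>M\<^esub>} \<and>
    (\<forall>N. submodule N R M \<longrightarrow> N = {\<zero>\<^bsub>M\<^esub>} \<or> N = carrier M)"

definition submodule_generated ::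
    "('r, 's) ring_scheme \<Rightarrow> ('r, 'v, 'm) module_scheme \<Rightarrow> 'v set \<Rightarrow> 'v set"
  where "submodule_generated R M S = \<Inter>{N. submodule N R M \<and> S \<subseteq> N}"

definition locally_cyclic_module ::
    "('r, 's) ring_scheme \<Rightarrow> ('r, 'v, 'm) module_scheme \<Rightarrow> bool"
  where "locally_cyclic_module R M \<longleftrightarrow>
    left_module R M \<and>
    (\<forall>S. finite S \<and> S \<subseteq> carrier M \<longrightarrow>
       (\<exists>x\<in>carrier M. submodule_generated R M {x} = submodule_generated R M S))"


section \<open>Group rings\<close>

text \<open>Elements of the group ring are finitely supported functions on the group, extended by 0
  outside its carrier; multiplication is convolution.\<close>

definition supp :: "('r, 's) ring_scheme \<Rightarrow> ('g, 'h) monoid_scheme \<Rightarrow> ('g \<Rightarrow> 'r) \<Rightarrow> 'g set"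
  where "supp R G a = {g \<in> carrier G. a g \<noteq> \<zero>\<^bsub>R\<^esub>}"

definition group_ring_single ::
    "('r, 's) ring_scheme \<Rightarrow> ('g, 'h) monoid_scheme \<Rightarrow> 'g \<Rightarrow> 'g \<Rightarrow> 'r"
  where "group_ring_single R G h = (\<lambda>g. if g = h then \<one>\<^bsub>R\<^esub> else \<zero>\<^bsub>R\<^esub>)"

definition group_ring ::
    "('r, 's) ring_scheme \<Rightarrow> ('g, 'h) monoid_scheme \<Rightarrow> ('g \<Rightarrow> 'r) ring"
  where "group_ring R G =
    \<lparr> carrier = {a. (\<forall>g\<in>carrier G. a g \<in> carrier R) \<and> (\<forall>g. g \<notin> carrier G \<longrightarrow> a g = \<zero>\<^bsub>R\<^esub>) \<and>
                    finite (supp R G a)},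
      monoid.mult = (\<lambda>a b g. if g \<in> carrier G
                then \<Oplus>\<^bsub>R\<^esub>h\<in>supp R G a. a h \<otimes>\<^bsub>R\<^esub> b (inv\<^bsub>G\<^esub> h \<otimes>\<^bsub>G\<^esub> g)
                else \<zero>\<^bsub>R\<^esub>),
      one = group_ring_single R G \<one>\<^bsub>G\<^esub>,
      ring.zero = (\<lambda>g. \<zero>\<^bsub>R\<^esub>),
      add = (\<lambda>a b g. a g \<oplus>\<^bsub>R\<^esub> b g) \<rparr>"


lemma (in comm_monoid) finprod_swap:
  assumes "finite A" "finite B" "\<And>i j. i \<in> A \<Longrightarrow> j \<in> B \<Longrightarrow> f i j \<in> carrier G"
  shows "(\<Otimes>i\<in>A. \<Otimes>j\<in>B. f i j) = (\<Otimes>j\<in>B. \<Otimes>i\<in>A. f i j)"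
  using assms(1,3)
proof (induction A)
  case empty
  then show ?case by simp
next
  case (insert a A)
  have fa: "f a \<in> B \<rightarrow> carrier G" and
    fs: "\<And>i. i \<in> A \<Longrightarrow> f i \<in> B \<rightarrow> carrier G"
    "(\<lambda>j. \<Otimes>i\<in>A. f i j) \<in> B \<rightarrow> carrier G"
    using insert by (auto intro!: finprod_closed)
  have "(\<Otimes>i\<in>insert a A. \<Otimes>j\<in>B. f i j) = (\<Otimes>j\<in>B. f a j) \<otimes> (\<Otimes>i\<in>A. \<Otimes>j\<in>B. f i j)"
    using insert fa fs by (subst finprod_insert) (auto intro!: finprod_closed)
  also have "\<dots> = (\<Otimes>j\<in>B. f a j) \<otimes> (\<Otimes>j\<in>B. \<Otimes>i\<in>A. f i j)"
    using insert by auto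
  also have "\<dots> = (\<Otimes>j\<in>B. f a j \<otimes> (\<Otimes>i\<in>A. f i j))"
    by (rule finprod_multf[symmetric, OF fa fs(2)])
  also have "\<dots> = (\<Otimes>j\<in>B. \<Otimes>i\<in>insert a A. f i j)"
    using insert by (intro finprod_cong') (auto intro!: finprod_closed simp: Pi_def)
  finally show ?case .
qed

context abelian_monoid begin

lemma finsum_neutral_superset:
  assumes "finite B" "A \<subseteq> B" "\<And>i. i \<in> B - A \<Longrightarrow> f i = \<zero>" "f \<in> B \<rightarrow> carrier G"
  shows "finsum G f A = finsum G f B"
  by (rule add.finprod_mono_neutral_cong_left) (use assms in auto)

end

lemma group_ring_simps:
  "a \<oplus>\<^bsub>group_ring R G\<^esub> b = (\<lambda>g. a g \<oplus>\<^bsub>R\<^esub> b g)"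
  "\<zero>\<^bsub>group_ring R G\<^esub> = (\<lambda>g. \<zero>\<^bsub>R\<^esub>)"
  "\<one>\<^bsub>group_ring R G\<^esub> = group_ring_single R G \<one>\<^bsub>G\<^esub>"
  by (simp_all add: group_ring_def)

lemma group_ring_carrierD:
  assumes "a \<in> carrier (group_ring R G)"
  shows "g \<in> carrier G \<Longrightarrow> a g \<in> carrier R" "g \<notin> carrier G \<Longrightarrow> a g = \<zero>\<^bsub>R\<^esub>"
    "finite (supp R G a)"
  using assms by (auto simp: group_ring_def)

lemma group_ring_carrierI:
  assumes "\<And>g. g \<in> carrier G \<Longrightarrow> a g \<in> carrier R" "\<And>g. g \<notin> carrier G \<Longrightarrow> a g = \<zero>\<^bsub>R\<^esub>"
    "finite S" "\<And>g. g \<in> carrier G \<Longrightarrow> a g \<noteq> \<zero>\<^bsub>R\<^esub> \<Longrightarrow> g \<in> S"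
  shows "a \<in> carrier (group_ring R G)"
proof -
  have "supp R G a \<subseteq> S" using assms(4) by (auto simp: supp_def)
  with assms show ?thesis by (auto simp: group_ring_def intro: finite_subset)
qed

lemma group_ring_mult_eq:
  assumes "ring R" "group G" "a \<in> carrier (group_ring R G)" "b \<in> carrier (group_ring R G)"
    "finite S" "supp R G a \<subseteq> S" "S \<subseteq> carrier G"
  shows "(a \<otimes>\<^bsub>group_ring R G\<^esub> b) g =
    (if g \<in> carrier G then \<Oplus>\<^bsub>R\<^esub>h\<in>S. a h \<otimes>\<^bsub>R\<^esub> b (inv\<^bsub>G\<^esub> h \<otimes>\<^bsub>G\<^esub> g) else \<zero>\<^bsub>R\<^esub>)"
proof -
  interpret R: ring R by fact
  interpret G: group G by fact
  note [simp] = group_ring_carrierD(1)[OF assms(3)] group_ring_carrierD(1)[OF assms(4)]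
  show ?thesis
    using assms(5-7)
    by (auto simp: group_ring_def supp_def subset_iff Pi_def
          intro!: R.finsum_neutral_superset)
qed

theorem group_ring_is_ring:
  assumes "ring R" "group G"
  shows "ring (group_ring R G)"
proof -
  interpret R: ring R by fact
  interpret G: group G by fact
  let ?A = "group_ring R G"
  note D = group_ring_carrierD
  note meq = group_ring_mult_eq[OF assms]
  have supp_sub: "supp R G a \<subseteq> carrier G" for a by (auto simp: supp_def)
  have S0: "h \<in> carrier G \<Longrightarrow> h \<notin> supp R G a \<Longrightarrow> a h = \<zero>\<^bsub>R\<^esub>" for a h by (auto simp: supp_def)
  have mult_closed: "a \<otimes>\<^bsub>?A\<^esub> b \<in> carrier ?A" if a: "a \<in> carrier ?A" and b: "b \<in> carrier ?A" for a b
  proof (rule group_ring_carrierI)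
    show "finite ((\<lambda>(h,v). h \<otimes>\<^bsub>G\<^esub> v) ` (supp R G a \<times> supp R G b))" using D(3) a b by blast
    fix g assume g: "g \<in> carrier G"
    show "(a \<otimes>\<^bsub>?A\<^esub> b) g \<in> carrier R"
      using g supp_sub[of a] D(1)[OF a] D(1)[OF b]
      by (subst meq[OF a b D(3)[OF a]]) (auto intro!: R.finsum_closed)
    assume nz: "(a \<otimes>\<^bsub>?A\<^esub> b) g \<noteq> \<zero>\<^bsub>R\<^esub>"
    have "\<exists>h\<in>supp R G a. inv\<^bsub>G\<^esub> h \<otimes>\<^bsub>G\<^esub> g \<in> supp R G b"
    proof (rule ccontr)
      assume n: "\<not> ?thesis"
      have "(\<Oplus>\<^bsub>R\<^esub>h\<in>supp R G a. a h \<otimes>\<^bsub>R\<^esub> b (inv\<^bsub>G\<^esub> h \<otimes>\<^bsub>G\<^esub> g)) = (\<Oplus>\<^bsub>R\<^esub>h\<in>supp R G a. \<zero>\<^bsub>R\<^esub>)"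
        using n g supp_sub[of a] S0[of _ b] D(1)[OF a]
        by (intro R.finsum_cong') (auto simp: subset_iff)
      with nz show False using g supp_sub[of a] by (subst (asm) meq[OF a b D(3)[OF a]]) (auto simp: R.finsum_zero)
    qed
    then obtain h where h: "h \<in> supp R G a" "inv\<^bsub>G\<^esub> h \<otimes>\<^bsub>G\<^esub> g \<in> supp R G b" by blast
    have "g = h \<otimes>\<^bsub>G\<^esub> (inv\<^bsub>G\<^esub> h \<otimes>\<^bsub>G\<^esub> g)"
      using h(1) g supp_sub[of a] by (simp add: subset_iff G.m_assoc[symmetric])
    with h show "g \<in> (\<lambda>(h,v). h \<otimes>\<^bsub>G\<^esub> v) ` (supp R G a \<times> supp R G b)" by force
  next
    fix g assume "g \<notin> carrier G"
    then show "(a \<otimes>\<^bsub>?A\<^esub> b) g = \<zero>\<^bsub>R\<^esub>" by (simp add: group_ring_def)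
  qed
  have one_closed: "\<one>\<^bsub>?A\<^esub> \<in> carrier ?A"
    by (rule group_ring_carrierI[where S = "{\<one>\<^bsub>G\<^esub>}"])
       (auto simp: group_ring_simps group_ring_single_def split: if_splits)
  have add_closed: "a \<oplus>\<^bsub>?A\<^esub> b \<in> carrier ?A" if a: "a \<in> carrier ?A" and b: "b \<in> carrier ?A" for a b
    by (rule group_ring_carrierI[where S = "supp R G a \<union> supp R G b"])
       (use D[OF a] D[OF b] in \<open>auto simp: group_ring_simps supp_def\<close>)
  have eqI: "a = b" if "a \<in> carrier ?A" "b \<in> carrier ?A" "\<And>g. g \<in> carrier G \<Longrightarrow> a g = b g" for a b
    using that(3) D(2)[OF that(1)] D(2)[OF that(2)] by (metis HOL.ext)
  have cl: "a g \<in> carrier R" if "a \<in> carrier ?A" for a g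
    using D(1,2)[OF that] by (cases "g \<in> carrier G") auto
  have ag: "abelian_group ?A"
  proof (rule abelian_groupI)
    show "\<zero>\<^bsub>?A\<^esub> \<in> carrier ?A" by (rule group_ring_carrierI[where S="{}"]) (auto simp: group_ring_simps)
    show "\<exists>y\<in>carrier ?A. y \<oplus>\<^bsub>?A\<^esub> x = \<zero>\<^bsub>?A\<^esub>" if x: "x \<in> carrier ?A" for x
    proof
      show "(\<lambda>g. \<ominus>\<^bsub>R\<^esub> x g) \<oplus>\<^bsub>?A\<^esub> x = \<zero>\<^bsub>?A\<^esub>"
        using cl[OF x] by (auto simp: group_ring_simps R.l_neg)
      show "(\<lambda>g. \<ominus>\<^bsub>R\<^esub> x g) \<in> carrier ?A"
        by (rule group_ring_carrierI[where S = "supp R G x"])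
           (use D[OF x] in \<open>auto simp: supp_def\<close>)
    qed
  qed (auto simp: add_closed, auto simp: group_ring_simps cl R.a_assoc R.a_comm R.a_lcomm)
  have assoc: "(a \<otimes>\<^bsub>?A\<^esub> b) \<otimes>\<^bsub>?A\<^esub> c = a \<otimes>\<^bsub>?A\<^esub> (b \<otimes>\<^bsub>?A\<^esub> c)"
    if a: "a \<in> carrier ?A" and b: "b \<in> carrier ?A" and c: "c \<in> carrier ?A" for a b c
  proof (rule eqI)
    fix g assume g: "g \<in> carrier G"
    let ?S = "supp R G a" and ?T = "supp R G b"
    define U where "U = (\<lambda>(h,v). h \<otimes>\<^bsub>G\<^esub> v) ` (?S \<times> ?T) \<union> supp R G (a \<otimes>\<^bsub>?A\<^esub> b)"
    have U: "finite U" "U \<subseteq> carrier G" "supp R G (a \<otimes>\<^bsub>?A\<^esub> b) \<subseteq> U"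
      using D(3)[OF a] D(3)[OF b] D(3)[OF mult_closed[OF a b]] supp_sub[of a] supp_sub[of b]
      by (auto simp: U_def supp_def)
    have SG: "h \<in> ?S \<Longrightarrow> h \<in> carrier G" "h \<in> ?T \<Longrightarrow> h \<in> carrier G" "h \<in> U \<Longrightarrow> h \<in> carrier G" for h
      using supp_sub U by auto
    have "((a \<otimes>\<^bsub>?A\<^esub> b) \<otimes>\<^bsub>?A\<^esub> c) g =
        (\<Oplus>\<^bsub>R\<^esub>u\<in>U. (\<Oplus>\<^bsub>R\<^esub>h\<in>?S. a h \<otimes>\<^bsub>R\<^esub> b (inv\<^bsub>G\<^esub> h \<otimes>\<^bsub>G\<^esub> u)) \<otimes>\<^bsub>R\<^esub> c (inv\<^bsub>G\<^esub> u \<otimes>\<^bsub>G\<^esub> g))"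
      apply (subst meq[OF mult_closed[OF a b] c U(1,3,2)])
      using g U(2) supp_sub[of a] D(3)[OF a]
      by (auto simp: meq[OF a b D(3)[OF a]] cl[OF a] cl[OF b] cl[OF c] subset_iff
            intro!: R.finsum_cong' R.m_closed R.finsum_closed)
    also have "\<dots> = (\<Oplus>\<^bsub>R\<^esub>u\<in>U. \<Oplus>\<^bsub>R\<^esub>h\<in>?S. a h \<otimes>\<^bsub>R\<^esub> b (inv\<^bsub>G\<^esub> h \<otimes>\<^bsub>G\<^esub> u) \<otimes>\<^bsub>R\<^esub> c (inv\<^bsub>G\<^esub> u \<otimes>\<^bsub>G\<^esub> g))"
      by (intro R.finsum_cong' R.finsum_ldistr)
         (auto simp: cl[OF a] cl[OF b] cl[OF c] D(3)[OF a] intro!: R.finsum_closed)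
    also have "\<dots> = (\<Oplus>\<^bsub>R\<^esub>h\<in>?S. \<Oplus>\<^bsub>R\<^esub>u\<in>U. a h \<otimes>\<^bsub>R\<^esub> b (inv\<^bsub>G\<^esub> h \<otimes>\<^bsub>G\<^esub> u) \<otimes>\<^bsub>R\<^esub> c (inv\<^bsub>G\<^esub> u \<otimes>\<^bsub>G\<^esub> g))"
      by (rule R.add.finprod_swap) (auto simp: cl[OF a] cl[OF b] cl[OF c] D(3)[OF a] U(1))
    also have "\<dots> = (\<Oplus>\<^bsub>R\<^esub>h\<in>?S. a h \<otimes>\<^bsub>R\<^esub> (b \<otimes>\<^bsub>?A\<^esub> c) (inv\<^bsub>G\<^esub> h \<otimes>\<^bsub>G\<^esub> g))"
    proof (rule R.finsum_cong'[OF refl])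
      show "(\<lambda>h. a h \<otimes>\<^bsub>R\<^esub> (b \<otimes>\<^bsub>?A\<^esub> c) (inv\<^bsub>G\<^esub> h \<otimes>\<^bsub>G\<^esub> g)) \<in> ?S \<rightarrow> carrier R"
        using cl[OF a] cl[OF mult_closed[OF b c]] by auto
      fix h assume h: "h \<in> ?S"
      note hG = SG(1)[OF h]
      have inj: "inj_on (\<lambda>v. h \<otimes>\<^bsub>G\<^esub> v) ?T" using SG hG by (auto intro!: inj_onI)
      have "(\<Oplus>\<^bsub>R\<^esub>u\<in>U. a h \<otimes>\<^bsub>R\<^esub> b (inv\<^bsub>G\<^esub> h \<otimes>\<^bsub>G\<^esub> u) \<otimes>\<^bsub>R\<^esub> c (inv\<^bsub>G\<^esub> u \<otimes>\<^bsub>G\<^esub> g)) =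
          (\<Oplus>\<^bsub>R\<^esub>u\<in>(\<lambda>v. h \<otimes>\<^bsub>G\<^esub> v) ` ?T. a h \<otimes>\<^bsub>R\<^esub> b (inv\<^bsub>G\<^esub> h \<otimes>\<^bsub>G\<^esub> u) \<otimes>\<^bsub>R\<^esub> c (inv\<^bsub>G\<^esub> u \<otimes>\<^bsub>G\<^esub> g))"
      proof (rule R.finsum_neutral_superset[symmetric, OF U(1)])
        show "(\<lambda>v. h \<otimes>\<^bsub>G\<^esub> v) ` ?T \<subseteq> U" using h by (force simp: U_def)
        fix u assume u: "u \<in> U - (\<lambda>v. h \<otimes>\<^bsub>G\<^esub> v) ` ?T"
        then have uG: "u \<in> carrier G" using SG by blast
        have "inv\<^bsub>G\<^esub> h \<otimes>\<^bsub>G\<^esub> u \<notin> ?T"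
        proof
          assume "inv\<^bsub>G\<^esub> h \<otimes>\<^bsub>G\<^esub> u \<in> ?T"
          moreover have "u = h \<otimes>\<^bsub>G\<^esub> (inv\<^bsub>G\<^esub> h \<otimes>\<^bsub>G\<^esub> u)"
            using hG uG by (simp add: G.m_assoc[symmetric])
          ultimately show False using u by blast
        qed
        then show "a h \<otimes>\<^bsub>R\<^esub> b (inv\<^bsub>G\<^esub> h \<otimes>\<^bsub>G\<^esub> u) \<otimes>\<^bsub>R\<^esub> c (inv\<^bsub>G\<^esub> u \<otimes>\<^bsub>G\<^esub> g) = \<zero>\<^bsub>R\<^esub>"
          using S0[of _ b] hG uG by (simp add: cl[OF a] cl[OF c])
      qed (auto simp: cl[OF a] cl[OF b] cl[OF c])
      also have "\<dots> = (\<Oplus>\<^bsub>R\<^esub>v\<in>?T. a h \<otimes>\<^bsub>R\<^esub> b (inv\<^bsub>G\<^esub> h \<otimes>\<^bsub>G\<^esub> (h \<otimes>\<^bsub>G\<^esub> v)) \<otimes>\<^bsub>R\<^esub> c (inv\<^bsub>G\<^esub> (h \<otimes>\<^bsub>G\<^esub> v) \<otimes>\<^bsub>G\<^esub> g))"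
        by (rule R.finsum_reindex) (auto simp: inj cl[OF a] cl[OF b] cl[OF c])
      also have "\<dots> = (\<Oplus>\<^bsub>R\<^esub>v\<in>?T. a h \<otimes>\<^bsub>R\<^esub> (b v \<otimes>\<^bsub>R\<^esub> c (inv\<^bsub>G\<^esub> v \<otimes>\<^bsub>G\<^esub> (inv\<^bsub>G\<^esub> h \<otimes>\<^bsub>G\<^esub> g))))"
        using SG(2) hG g
        by (intro R.finsum_cong')
           (auto simp: cl[OF a] cl[OF b] cl[OF c] R.m_assoc G.m_assoc[symmetric] G.inv_mult_group)
      also have "\<dots> = a h \<otimes>\<^bsub>R\<^esub> (\<Oplus>\<^bsub>R\<^esub>v\<in>?T. b v \<otimes>\<^bsub>R\<^esub> c (inv\<^bsub>G\<^esub> v \<otimes>\<^bsub>G\<^esub> (inv\<^bsub>G\<^esub> h \<otimes>\<^bsub>G\<^esub> g)))"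
        by (rule R.finsum_rdistr[symmetric]) (auto simp: cl[OF a] cl[OF b] cl[OF c] D(3)[OF b])
      also have "\<dots> = a h \<otimes>\<^bsub>R\<^esub> (b \<otimes>\<^bsub>?A\<^esub> c) (inv\<^bsub>G\<^esub> h \<otimes>\<^bsub>G\<^esub> g)"
        using hG g supp_sub[of b] by (simp add: meq[OF b c D(3)[OF b]])
      finally show "(\<Oplus>\<^bsub>R\<^esub>u\<in>U. a h \<otimes>\<^bsub>R\<^esub> b (inv\<^bsub>G\<^esub> h \<otimes>\<^bsub>G\<^esub> u) \<otimes>\<^bsub>R\<^esub> c (inv\<^bsub>G\<^esub> u \<otimes>\<^bsub>G\<^esub> g)) =
          a h \<otimes>\<^bsub>R\<^esub> (b \<otimes>\<^bsub>?A\<^esub> c) (inv\<^bsub>G\<^esub> h \<otimes>\<^bsub>G\<^esub> g)" .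
    qed
    also have "\<dots> = (a \<otimes>\<^bsub>?A\<^esub> (b \<otimes>\<^bsub>?A\<^esub> c)) g"
      using g supp_sub[of a] by (simp add: meq[OF a mult_closed[OF b c] D(3)[OF a]])
    finally show "((a \<otimes>\<^bsub>?A\<^esub> b) \<otimes>\<^bsub>?A\<^esub> c) g = (a \<otimes>\<^bsub>?A\<^esub> (b \<otimes>\<^bsub>?A\<^esub> c)) g" .
  qed (use a b c mult_closed in auto)
  have one_supp: "supp R G \<one>\<^bsub>?A\<^esub> \<subseteq> {\<one>\<^bsub>G\<^esub>}"
    by (auto simp: supp_def group_ring_simps group_ring_single_def split: if_splits)
  have l_one: "\<one>\<^bsub>?A\<^esub> \<otimes>\<^bsub>?A\<^esub> a = a" if a: "a \<in> carrier ?A" for a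
  proof (rule eqI[OF mult_closed[OF one_closed a] a])
    fix g assume g: "g \<in> carrier G"
    show "(\<one>\<^bsub>?A\<^esub> \<otimes>\<^bsub>?A\<^esub> a) g = a g"
      using g by (subst meq[OF one_closed a _ one_supp])
        (auto simp: cl[OF a] group_ring_simps group_ring_single_def)
  qed
  have r_one: "a \<otimes>\<^bsub>?A\<^esub> \<one>\<^bsub>?A\<^esub> = a" if a: "a \<in> carrier ?A" for a
  proof (rule eqI[OF mult_closed[OF a one_closed] a])
    fix g assume g: "g \<in> carrier G"
    have "(a \<otimes>\<^bsub>?A\<^esub> \<one>\<^bsub>?A\<^esub>) g = (\<Oplus>\<^bsub>R\<^esub>h\<in>insert g (supp R G a). a h \<otimes>\<^bsub>R\<^esub> \<one>\<^bsub>?A\<^esub> (inv\<^bsub>G\<^esub> h \<otimes>\<^bsub>G\<^esub> g))"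
      using g supp_sub[of a] D(3)[OF a] by (subst meq[OF a one_closed, of "insert g (supp R G a)"]) auto
    also have "\<dots> = (\<Oplus>\<^bsub>R\<^esub>h\<in>insert g (supp R G a). if g = h then a h else \<zero>\<^bsub>R\<^esub>)"
      using g supp_sub[of a] cl[OF a]
      by (intro R.finsum_cong')
         (auto simp: group_ring_simps group_ring_single_def subset_iff G.inv_solve_left' G.inv_equality
            dest: G.inv_equality)
    also have "\<dots> = a g"
      using D(3)[OF a] cl[OF a] by (intro R.finsum_singleton) auto
    finally show "(a \<otimes>\<^bsub>?A\<^esub> \<one>\<^bsub>?A\<^esub>) g = a g" .
  qed
  show ?thesis
  proof (rule ringI[OF ag])
    show "monoid ?A"
      by (rule monoidI) (auto simp: mult_closed one_closed assoc l_one r_one)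
    fix a b c assume a: "a \<in> carrier ?A" and b: "b \<in> carrier ?A" and c: "c \<in> carrier ?A"
    show "(a \<oplus>\<^bsub>?A\<^esub> b) \<otimes>\<^bsub>?A\<^esub> c = a \<otimes>\<^bsub>?A\<^esub> c \<oplus>\<^bsub>?A\<^esub> b \<otimes>\<^bsub>?A\<^esub> c"
    proof (rule ext)
      fix g
      let ?S = "supp R G a \<union> supp R G b"
      have S: "finite ?S" "?S \<subseteq> carrier G" using D(3)[OF a] D(3)[OF b] supp_sub by auto
      have ab: "supp R G (a \<oplus>\<^bsub>?A\<^esub> b) \<subseteq> ?S" by (auto simp: supp_def group_ring_simps)
      show "((a \<oplus>\<^bsub>?A\<^esub> b) \<otimes>\<^bsub>?A\<^esub> c) g = (a \<otimes>\<^bsub>?A\<^esub> c \<oplus>\<^bsub>?A\<^esub> b \<otimes>\<^bsub>?A\<^esub> c) g"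
        by (subst meq[OF add_closed[OF a b] c S(1) ab S(2)])
           (simp add: meq[OF a c S(1) _ S(2)]
              meq[OF b c S(1) _ S(2)] group_ring_simps(1) cl[OF a] cl[OF b] cl[OF c] R.l_distr
              R.finsum_addf)
    qed
    show "c \<otimes>\<^bsub>?A\<^esub> (a \<oplus>\<^bsub>?A\<^esub> b) = c \<otimes>\<^bsub>?A\<^esub> a \<oplus>\<^bsub>?A\<^esub> c \<otimes>\<^bsub>?A\<^esub> b"
    proof (rule ext)
      fix g
      show "(c \<otimes>\<^bsub>?A\<^esub> (a \<oplus>\<^bsub>?A\<^esub> b)) g = (c \<otimes>\<^bsub>?A\<^esub> a \<oplus>\<^bsub>?A\<^esub> c \<otimes>\<^bsub>?A\<^esub> b) g"
        by (subst meq[OF c add_closed[OF a b] D(3)[OF c] order.refl supp_sub])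
           (simp add: meq[OF c a D(3)[OF c] order.refl supp_sub] meq[OF c b D(3)[OF c] order.refl supp_sub]
              group_ring_simps(1) cl[OF a] cl[OF b] cl[OF c] R.r_distr R.finsum_addf)
    qed
  qed
qed


section \<open>Representations\<close>

definition afforded_rep ::
    "('r, 's) ring_scheme \<Rightarrow> ('g, 'h) monoid_scheme \<Rightarrow> ('g \<Rightarrow> 'r, 'v, 'm) module_scheme \<Rightarrow>
      'g \<Rightarrow> 'v \<Rightarrow> 'v"
  where "afforded_rep K G V g = (\<lambda>v\<in>carrier V. group_ring_single K G g \<odot>\<^bsub>V\<^esub> v)"

definition faithful_irreducible_rep ::
    "('r, 's) ring_scheme \<Rightarrow> ('g, 'h) monoid_scheme \<Rightarrow> ('g \<Rightarrow> 'r, 'v, 'm) module_scheme \<Rightarrow> bool"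
  where "faithful_irreducible_rep K G V \<longleftrightarrow>
    simple_module (group_ring K G) V \<and>
    kernel G (BijGroup (carrier V)) (afforded_rep K G V) = {\<one>\<^bsub>G\<^esub>}"


section \<open>Conjugation modules\<close>

text \<open>For an abelian normal subgroup \<open>A\<close>: the group ring element \<open>\<Sum> n\<^sub>g g\<close> sends \<open>x\<close> to
  the product of the \<open>(g x g\<^sup>-\<^sup>1)\<^sup>n\<close> with \<open>n = n\<^sub>g\<close>. The module addition is the multiplication of
  \<open>G\<close>; the fields \<open>mult\<close> and \<open>one\<close> of the module record play no role.\<close>

definition conj_module ::
    "('g, 'h) monoid_scheme \<Rightarrow> 'g set \<Rightarrow> ('g \<Rightarrow> int, 'g) module"
  where "conj_module G A =
    \<lparr> carrier = A,
      monoid.mult = (\<lambda>x y. \<one>\<^bsub>G\<^esub>),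
      one = \<one>\<^bsub>G\<^esub>,
      ring.zero = \<one>\<^bsub>G\<^esub>,
      add = monoid.mult G,
      smult = (\<lambda>a x. finprod (G\<lparr>carrier := A\<rparr>)
                 (\<lambda>g. (g \<otimes>\<^bsub>G\<^esub> x \<otimes>\<^bsub>G\<^esub> inv\<^bsub>G\<^esub> g) [^]\<^bsub>G\<^esub> a g) (supp \<Z> G a)) \<rparr>"

lemma (in comm_group) finprod_int_pow:
  fixes n :: int
  assumes "finite S" "f \<in> S \<rightarrow> carrier G"
  shows "(\<Otimes>i\<in>S. f i) [^] n = (\<Otimes>i\<in>S. f i [^] n)"
  using assms by (induction S) (auto simp: int_pow_distrib Pi_def)

lemma (in comm_group) int_pow_sum:
  fixes f :: "'i \<Rightarrow> int"
  assumes "finite S" "x \<in> carrier G"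
  shows "x [^] (\<Sum>i\<in>S. f i) = (\<Otimes>i\<in>S. x [^] f i)"
  using assms by (induction S) (auto simp: int_pow_mult Pi_def)

lemma finprod_hom_eq:
  assumes "h \<in> hom H K" "comm_group H" "comm_group K" "finite S" "f \<in> S \<rightarrow> carrier H"
  shows "h (finprod H f S) = finprod K (\<lambda>i. h (f i)) S"
proof -
  interpret H: comm_group H by fact
  interpret K: comm_group K by fact
  interpret h: group_hom H K h by unfold_locales (fact assms(1))
  show ?thesis
    using assms(4,5) by (induction S) (auto simp: Pi_def)
qed

theorem conj_module_left_module:
  assumes "A \<lhd> G" "comm_group (G\<lparr>carrier := A\<rparr>)"
  shows "left_module (group_ring \<Z> G) (conj_module G A)"
proof -
  interpret N: normal A G by fact
  define H where "H = G\<lparr>carrier := A\<rparr>"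
  interpret H: comm_group H using assms(2) by (simp add: H_def)
  have Hs [simp]: "carrier H = A" "x \<otimes>\<^bsub>H\<^esub> y = x \<otimes>\<^bsub>G\<^esub> y" "\<one>\<^bsub>H\<^esub> = \<one>\<^bsub>G\<^esub>" for x y
    by (simp_all add: H_def)
  have gr: "group G" by (fact N.group_axioms)
  have Zr: "ring \<Z>" by (rule cring.axioms(1)[OF int_is_cring])
  interpret ZG: ring "group_ring \<Z> G" by (rule group_ring_is_ring[OF Zr gr])
  let ?Z = "group_ring \<Z> G" and ?M = "conj_module G A"
  define c where "c g x = g \<otimes>\<^bsub>G\<^esub> x \<otimes>\<^bsub>G\<^esub> inv\<^bsub>G\<^esub> g" for g x
  have AG: "x \<in> A \<Longrightarrow> x \<in> carrier G" for x by (rule N.mem_carrier)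
  have cA [simp]: "c g x \<in> A" if "g \<in> carrier G" "x \<in> A" for g x
    using N.inv_op_closed2[OF that] by (simp add: c_def)
  have c_mult: "c g (x \<otimes>\<^bsub>G\<^esub> y) = c g x \<otimes>\<^bsub>G\<^esub> c g y" if "g \<in> carrier G" "x \<in> A" "y \<in> A" for g x y
  proof -
    have "c g x \<otimes>\<^bsub>G\<^esub> c g y = g \<otimes>\<^bsub>G\<^esub> x \<otimes>\<^bsub>G\<^esub> (inv\<^bsub>G\<^esub> g \<otimes>\<^bsub>G\<^esub> g) \<otimes>\<^bsub>G\<^esub> y \<otimes>\<^bsub>G\<^esub> inv\<^bsub>G\<^esub> g"
      using that AG unfolding c_def by (simp only: N.m_assoc N.m_closed N.inv_closed)
    then show ?thesis using that AG by (simp add: c_def N.m_assoc)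
  qed
  have c_hom: "c g \<in> hom H H" if "g \<in> carrier G" for g
    using that by (auto simp: hom_def c_mult)
  have c_c: "c g (c h x) = c (g \<otimes>\<^bsub>G\<^esub> h) x" if "g \<in> carrier G" "h \<in> carrier G" "x \<in> A" for g h x
    using that AG by (simp add: c_def N.m_assoc N.inv_mult_group)
  have pw: "x [^]\<^bsub>G\<^esub> n = x [^]\<^bsub>H\<^esub> n" if "x \<in> A" for x and n :: int
    unfolding H_def by (rule N.int_pow_consistent[OF N.subgroup_axioms that])
  have pA [simp]: "x [^]\<^bsub>H\<^esub> n \<in> A" if "x \<in> A" for x and n :: int
    using H.int_pow_closed[of x n] that by simp
  have suppG: "supp \<Z> G a \<subseteq> carrier G" for a by (auto simp: supp_def)
  have sm: "a \<odot>\<^bsub>?M\<^esub> x = finprod H (\<lambda>g. c g x [^]\<^bsub>H\<^esub> a g) S"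
    if "x \<in> A" "finite S" "supp \<Z> G a \<subseteq> S" "S \<subseteq> carrier G" for a x S
  proof -
    have "a \<odot>\<^bsub>?M\<^esub> x = finprod H (\<lambda>g. c g x [^]\<^bsub>G\<^esub> a g) (supp \<Z> G a)"
      by (simp add: conj_module_def H_def c_def)
    also have "\<dots> = finprod H (\<lambda>g. c g x [^]\<^bsub>H\<^esub> a g) S"
      by (rule H.finprod_mono_neutral_cong_left) (use that suppG[of a] in \<open>auto simp: supp_def pw\<close>)
    finally show ?thesis .
  qed
  note D = group_ring_carrierD
  have sm_closed: "a \<odot>\<^bsub>?M\<^esub> x \<in> A" if "a \<in> carrier ?Z" "x \<in> A" for a x
    using H.finprod_closed[of "\<lambda>g. c g x [^]\<^bsub>H\<^esub> a g" "supp \<Z> G a"] that suppG[of a]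
    by (subst sm[OF that(2) D(3)[OF that(1)] order.refl suppG]) (auto simp: Pi_def subset_iff)
  have Ms [simp]: "carrier ?M = A" "x \<oplus>\<^bsub>?M\<^esub> y = x \<otimes>\<^bsub>G\<^esub> y" "\<zero>\<^bsub>?M\<^esub> = \<one>\<^bsub>G\<^esub>" for x y
    by (simp_all add: conj_module_def)
  have ag: "abelian_group ?M"
  proof (rule abelian_groupI)
    show "x \<oplus>\<^bsub>?M\<^esub> y = y \<oplus>\<^bsub>?M\<^esub> x" if "x \<in> carrier ?M" "y \<in> carrier ?M" for x y
      using H.m_comm[of x y] that by simp
    show "\<exists>y\<in>carrier ?M. y \<oplus>\<^bsub>?M\<^esub> x = \<zero>\<^bsub>?M\<^esub>" if "x \<in> carrier ?M" for x
      using that AG by (auto intro!: bexI[of _ "inv\<^bsub>G\<^esub> x"])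
  qed (auto simp: N.m_assoc AG)
  show ?thesis
  proof (intro left_module.intro left_module_axioms.intro ag ZG.ring_axioms, goal_cases)
    case (1 a x)
    then show ?case by (simp add: sm_closed)
  next
    case (2 a b x)
    let ?S = "supp \<Z> G a \<union> supp \<Z> G b"
    have S: "finite ?S" "?S \<subseteq> carrier G" using 2 D(3) suppG by blast+
    have ab: "supp \<Z> G (a \<oplus>\<^bsub>?Z\<^esub> b) \<subseteq> ?S" by (auto simp: supp_def group_ring_simps)
    have x: "x \<in> A" using 2 by simp
    have "finprod H (\<lambda>g. c g x [^]\<^bsub>H\<^esub> (a \<oplus>\<^bsub>?Z\<^esub> b) g) ?S =
        finprod H (\<lambda>g. c g x [^]\<^bsub>H\<^esub> a g \<otimes>\<^bsub>H\<^esub> c g x [^]\<^bsub>H\<^esub> b g) ?S"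
      using S x by (intro H.finprod_cong') (auto simp: group_ring_simps H.int_pow_mult[simplified])
    also have "\<dots> = finprod H (\<lambda>g. c g x [^]\<^bsub>H\<^esub> a g) ?S \<otimes>\<^bsub>H\<^esub> finprod H (\<lambda>g. c g x [^]\<^bsub>H\<^esub> b g) ?S"
      using S x by (intro H.finprod_multf) auto
    finally show ?case
      using S by (simp add: sm[OF x S(1) ab S(2)] sm[OF x S(1) _ S(2)])
  next
    case (3 a x y)
    have S: "finite (supp \<Z> G a)" "supp \<Z> G a \<subseteq> carrier G" using 3 D(3) suppG by blast+
    have xy: "x \<in> A" "y \<in> A" using 3 by simp_all
    have "finprod H (\<lambda>g. c g (x \<otimes>\<^bsub>G\<^esub> y) [^]\<^bsub>H\<^esub> a g) (supp \<Z> G a) =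
        finprod H (\<lambda>g. c g x [^]\<^bsub>H\<^esub> a g \<otimes>\<^bsub>H\<^esub> c g y [^]\<^bsub>H\<^esub> a g) (supp \<Z> G a)"
      using S xy by (intro H.finprod_cong') (auto simp: c_mult subset_iff H.int_pow_distrib[simplified])
    also have "\<dots> = finprod H (\<lambda>g. c g x [^]\<^bsub>H\<^esub> a g) (supp \<Z> G a) \<otimes>\<^bsub>H\<^esub>
        finprod H (\<lambda>g. c g y [^]\<^bsub>H\<^esub> a g) (supp \<Z> G a)"
      using S xy by (intro H.finprod_multf) auto
    finally show ?case
      using xy by (simp add: sm[OF _ S(1) order.refl S(2)])
  next
    case (4 a b x)
    let ?S = "supp \<Z> G a" and ?T = "supp \<Z> G b"
    have a: "a \<in> carrier ?Z" and b: "b \<in> carrier ?Z" and x: "x \<in> A" using 4 by simp_all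
    have fin: "finite ?S" "finite ?T" using D(3) a b by blast+
    define U where "U = (\<lambda>(h,v). h \<otimes>\<^bsub>G\<^esub> v) ` (?S \<times> ?T) \<union> supp \<Z> G (a \<otimes>\<^bsub>?Z\<^esub> b)"
    have SG: "h \<in> ?S \<Longrightarrow> h \<in> carrier G" "h \<in> ?T \<Longrightarrow> h \<in> carrier G" for h
      using suppG by auto
    have U: "finite U" "U \<subseteq> carrier G" "supp \<Z> G (a \<otimes>\<^bsub>?Z\<^esub> b) \<subseteq> U"
      using fin D(3)[OF ZG.m_closed[OF a b]] SG suppG by (auto simp: U_def)
    have UG: "u \<in> U \<Longrightarrow> u \<in> carrier G" for u using U by blast
    have "(a \<otimes>\<^bsub>?Z\<^esub> b) \<odot>\<^bsub>?M\<^esub> x = finprod H (\<lambda>u. c u x [^]\<^bsub>H\<^esub> (a \<otimes>\<^bsub>?Z\<^esub> b) u) U"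
      by (rule sm[OF x U(1,3,2)])
    also have "\<dots> = finprod H (\<lambda>u. finprod H (\<lambda>h. c u x [^]\<^bsub>H\<^esub> (a h * b (inv\<^bsub>G\<^esub> h \<otimes>\<^bsub>G\<^esub> u))) ?S) U"
    proof (rule H.finprod_cong'[OF refl])
      fix u assume u: "u \<in> U"
      have "(a \<otimes>\<^bsub>?Z\<^esub> b) u = (\<Sum>h\<in>?S. a h * b (inv\<^bsub>G\<^esub> h \<otimes>\<^bsub>G\<^esub> u))"
        using UG[OF u] by (simp add: group_ring_mult_eq[OF Zr gr a b fin(1) order.refl suppG] int_finsum_eq)
      then show "c u x [^]\<^bsub>H\<^esub> (a \<otimes>\<^bsub>?Z\<^esub> b) u = finprod H (\<lambda>h. c u x [^]\<^bsub>H\<^esub> (a h * b (inv\<^bsub>G\<^esub> h \<otimes>\<^bsub>G\<^esub> u))) ?S"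
        using UG[OF u] x fin by (simp add: H.int_pow_sum)
    qed (use UG x in \<open>auto intro!: H.finprod_closed[simplified]\<close>)
    also have "\<dots> = finprod H (\<lambda>h. finprod H (\<lambda>u. c u x [^]\<^bsub>H\<^esub> (a h * b (inv\<^bsub>G\<^esub> h \<otimes>\<^bsub>G\<^esub> u))) U) ?S"
      by (rule H.finprod_swap) (use U fin UG x in auto)
    also have "\<dots> = finprod H (\<lambda>h. c h (b \<odot>\<^bsub>?M\<^esub> x) [^]\<^bsub>H\<^esub> a h) ?S"
    proof (rule H.finprod_cong'[OF refl])
      fix h assume h: "h \<in> ?S"
      note hG = SG(1)[OF h]
      have inj: "inj_on (\<lambda>v. h \<otimes>\<^bsub>G\<^esub> v) ?T" using SG hG by (auto intro!: inj_onI)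
      have "finprod H (\<lambda>u. c u x [^]\<^bsub>H\<^esub> (a h * b (inv\<^bsub>G\<^esub> h \<otimes>\<^bsub>G\<^esub> u))) U =
          finprod H (\<lambda>u. c u x [^]\<^bsub>H\<^esub> (a h * b (inv\<^bsub>G\<^esub> h \<otimes>\<^bsub>G\<^esub> u))) ((\<lambda>v. h \<otimes>\<^bsub>G\<^esub> v) ` ?T)"
      proof (rule H.finprod_mono_neutral_cong_left[symmetric, OF U(1)])
        show "(\<lambda>v. h \<otimes>\<^bsub>G\<^esub> v) ` ?T \<subseteq> U" using h by (force simp: U_def)
        fix u assume u: "u \<in> U - (\<lambda>v. h \<otimes>\<^bsub>G\<^esub> v) ` ?T"
        then have uG: "u \<in> carrier G" using UG by blast
        have "inv\<^bsub>G\<^esub> h \<otimes>\<^bsub>G\<^esub> u \<notin> ?T"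
        proof
          assume "inv\<^bsub>G\<^esub> h \<otimes>\<^bsub>G\<^esub> u \<in> ?T"
          moreover have "u = h \<otimes>\<^bsub>G\<^esub> (inv\<^bsub>G\<^esub> h \<otimes>\<^bsub>G\<^esub> u)"
            using hG uG by (simp add: N.m_assoc[symmetric])
          ultimately show False using u by blast
        qed
        then have "b (inv\<^bsub>G\<^esub> h \<otimes>\<^bsub>G\<^esub> u) = 0" using hG uG by (simp add: supp_def)
        then show "c u x [^]\<^bsub>H\<^esub> (a h * b (inv\<^bsub>G\<^esub> h \<otimes>\<^bsub>G\<^esub> u)) = \<one>\<^bsub>H\<^esub>" by simp
      qed (use UG x in auto)
      also have "\<dots> = finprod H (\<lambda>v. c (h \<otimes>\<^bsub>G\<^esub> v) x [^]\<^bsub>H\<^esub> (a h * b (inv\<^bsub>G\<^esub> h \<otimes>\<^bsub>G\<^esub> (h \<otimes>\<^bsub>G\<^esub> v)))) ?T"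
        by (rule H.finprod_reindex[OF _ inj]) (use hG SG x in auto)
      also have "\<dots> = finprod H (\<lambda>v. (c h (c v x [^]\<^bsub>H\<^esub> b v)) [^]\<^bsub>H\<^esub> a h) ?T"
      proof (rule H.finprod_cong'[OF refl])
        fix v assume v: "v \<in> ?T"
        have "inv\<^bsub>G\<^esub> h \<otimes>\<^bsub>G\<^esub> (h \<otimes>\<^bsub>G\<^esub> v) = v"
          using hG SG(2)[OF v] by (simp add: N.m_assoc[symmetric])
        moreover have "c h (c v x [^]\<^bsub>H\<^esub> b v) = c (h \<otimes>\<^bsub>G\<^esub> v) x [^]\<^bsub>H\<^esub> b v"
          using hom_int_pow[OF c_hom[OF hG], of "c v x" "b v"] SG(2)[OF v] hG x H.group_axioms
          by (simp add: c_c)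
        ultimately show "c (h \<otimes>\<^bsub>G\<^esub> v) x [^]\<^bsub>H\<^esub> (a h * b (inv\<^bsub>G\<^esub> h \<otimes>\<^bsub>G\<^esub> (h \<otimes>\<^bsub>G\<^esub> v))) =
            (c h (c v x [^]\<^bsub>H\<^esub> b v)) [^]\<^bsub>H\<^esub> a h"
          using hG SG(2)[OF v] x by (simp add: H.int_pow_pow mult.commute)
      qed (use hG SG x in auto)
      also have "\<dots> = finprod H (\<lambda>v. c h (c v x [^]\<^bsub>H\<^esub> b v)) ?T [^]\<^bsub>H\<^esub> a h"
        by (rule H.finprod_int_pow[symmetric]) (use hG SG x fin in auto)
      also have "finprod H (\<lambda>v. c h (c v x [^]\<^bsub>H\<^esub> b v)) ?T = c h (finprod H (\<lambda>v. c v x [^]\<^bsub>H\<^esub> b v) ?T)"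
        by (rule finprod_hom_eq[symmetric, OF c_hom[OF hG] H.comm_group_axioms H.comm_group_axioms])
           (use SG x fin in auto)
      also have "finprod H (\<lambda>v. c v x [^]\<^bsub>H\<^esub> b v) ?T = b \<odot>\<^bsub>?M\<^esub> x"
        by (rule sm[OF x fin(2) order.refl suppG, symmetric])
      finally show "finprod H (\<lambda>u. c u x [^]\<^bsub>H\<^esub> (a h * b (inv\<^bsub>G\<^esub> h \<otimes>\<^bsub>G\<^esub> u))) U =
          c h (b \<odot>\<^bsub>?M\<^esub> x) [^]\<^bsub>H\<^esub> a h" .
    qed (use SG sm_closed[OF b x] in auto)
    also have "\<dots> = a \<odot>\<^bsub>?M\<^esub> (b \<odot>\<^bsub>?M\<^esub> x)"
      by (rule sm[OF sm_closed[OF b x] fin(1) order.refl suppG, symmetric])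
    finally show ?case .
  next
    case (5 x)
    have "\<one>\<^bsub>?Z\<^esub> \<odot>\<^bsub>?M\<^esub> x = finprod H (\<lambda>g. c g x [^]\<^bsub>H\<^esub> \<one>\<^bsub>?Z\<^esub> g) {\<one>\<^bsub>G\<^esub>}"
      by (rule sm) (use 5 in \<open>auto simp: supp_def group_ring_simps group_ring_single_def split: if_splits\<close>)
    also have "\<dots> = x"
      using 5 AG by (simp add: group_ring_simps group_ring_single_def c_def H.int_pow_1[simplified])
    finally show ?case .
  qed
qed

end

theory Submission
  imports Defs "HOL-Library.Function_Algebras"
    "HOL-Computational_Algebra.Fundamental_Theorem_Algebra"
begin

text \<open>The proof has an infinite part and a finite part.

  Infinite part: every minimal normal subgroup \<open>M\<close> of a soluble group \<open>G\<close> of finite rank is a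
  finite elementary abelian \<open>p\<close>-group (\<open>minimal_normal_finite\<close>). Since \<open>M\<close> is abelian and
  characteristically simple, the alternative is that \<open>M\<close> is torsion-free and divisible. In that case
  \<open>Hom(M, \<complex>)\<close> is a nonzero finite-dimensional complex representation of \<open>G\<close>. By
  \<open>solvable_virtual_eigenvector\<close>, a form of the Lie-Kolchin-Mal'cev theorem, a subgroup \<open>H\<close> of finite index
  has an eigenvector \<open>f\<close> there, with a character \<open>\<chi>\<close>. So \<open>f\<close> maps \<open>M\<close> onto a
  finitely generated module over the ring generated by the numbers \<open>\<chi> h\<close>. These numbers are
  algebraic, because \<open>M\<close> has finite rank, and they form a group that is torsion modulo a finitely
  generated subgroup, because \<open>H\<close> has finite rank. Hence for almost all primes \<open>q\<close> they are
  integral over the localization of \<open>\<int>\<close> at \<open>q\<close>, and Nakayama's lemma forbids the module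
  to be \<open>q\<close>-divisible (\<open>finitely_generated_not_divisible\<close>), although it is an image of \<open>M\<close>.

  Finite part: a finite set of elements of the socle generates a finite semisimple submodule \<open>F\<close>, an
  abelian normal subgroup of \<open>G\<close>. Let \<open>L\<close> be a maximal one among the subgroups of \<open>F\<close>
  that fix a nonzero vector of the simple module \<open>V\<close>. The vectors fixed by a normal subgroup form a
  submodule, so \<open>L\<close> contains no normal subgroup of \<open>G\<close> except the trivial one, as \<open>V\<close> is
  faithful. In characteristic \<open>p\<close> an element of order \<open>p\<close> is unipotent, so \<open>L\<close> contains
  all of them; therefore \<open>F\<close> has none (\<open>ring_char_not_exponent\<close>). For all other \<open>p\<close>, an
  averaging argument shows that the elements of order \<open>p\<close> form a cyclic group modulo \<open>L\<close>, so
  that they carry a character whose kernel lies in \<open>L\<close> (\<open>character_detecting_L\<close>). Such characters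
  force \<open>F\<close> to be cyclic (\<open>cyclic_if_core_free_cocyclic\<close>). For this, let \<open>C\<close> be a cyclic
  submodule of largest size and \<open>M\<close> a simple submodule of a complement. Maximality of \<open>C\<close> gives
  at least \<open>|M|\<close> homomorphisms from \<open>C\<close> to \<open>M\<close>, hence, by semisimplicity, from \<open>M\<close>
  to \<open>C\<close>. Their composites with the character are distinct and exhaust the \<open>|M|\<close> characters of
  \<open>M\<close>. So the character agrees on \<open>M\<close> with its composite with some \<open>\<psi> : M \<rightarrow> C\<close>, and
  the submodule of all \<open>m \<cdot> \<psi>(m)\<^sup>-\<^sup>1\<close> lies in \<open>L\<close>, a contradiction.\<close>

section \<open>Simultaneous eigenvectors and finite dimension\<close>

text \<open>The argument of Dedekind's lemma: if \<open>v\<close> is a combination of other vectors, applying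
  \<open>T a\<close> and subtracting \<open>\<chi> v a\<close> times the combination leaves a relation among these, so all
  coefficients vanish. It is applied to vectors under a group, to operators under conjugation, to
  eigenvectors of a single operator, and to characters under translation.\<close>

lemma (in vector_space) independent_simultaneous_eigenvectors:
  assumes nz: "0 \<notin> S"
    and lin: "\<And>a. a \<in> I \<Longrightarrow> Vector_Spaces.linear scale scale (T a)"
    and eig: "\<And>v a. v \<in> S \<Longrightarrow> a \<in> I \<Longrightarrow> T a v = scale (\<chi> v a) v"
    and sep: "\<And>v w. v \<in> S \<Longrightarrow> w \<in> S \<Longrightarrow> v \<noteq> w \<Longrightarrow> \<exists>a\<in>I. \<chi> v a \<noteq> \<chi> w a"
  shows "\<not> dependent S"
proof -
  have fin: "\<not> dependent F" if "finite F" "F \<subseteq> S" for F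
    using that
  proof (induction F)
    case empty
    show ?case by (rule independent_empty)
  next
    case (insert v F)
    have ind: "\<not> dependent F" using insert by auto
    have vF: "v \<in> S" "F \<subseteq> S" using insert by auto
    show ?case
    proof (rule independent_insertI[OF _ ind])
      show "v \<notin> span F"
      proof
        assume "v \<in> span F"
        then obtain u where v: "v = (\<Sum>w\<in>F. scale (u w) w)"
          by (auto simp: span_finite[OF insert(1)])
        have u0: "u w = 0" if w: "w \<in> F" for w
        proof -
          obtain a where a: "a \<in> I" "\<chi> v a \<noteq> \<chi> w a"
            using sep[of v w] vF w insert(2) by blast
          interpret T: Vector_Spaces.linear scale scale "T a" by (rule lin[OF a(1)])
          have "T a v = (\<Sum>x\<in>F. scale (u x * \<chi> x a) x)"
            unfolding v T.sum T.scale using eig[OF _ a(1)] vF(2)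
            by (intro sum.cong) auto
          moreover have "T a v = (\<Sum>x\<in>F. scale (\<chi> v a * u x) x)"
            unfolding eig[OF vF(1) a(1)] by (subst v) (simp add: scale_sum_right)
          ultimately have "(\<Sum>x\<in>F. scale (u x * \<chi> x a - \<chi> v a * u x) x) = 0"
            by (simp add: scale_left_diff_distrib sum_subtractf)
          from independentD[OF ind insert(1) order.refl this w]
          show "u w = 0" using a(2) by (simp add: mult.commute)
        qed
        then have "v = 0" unfolding v by simp
        with nz vF show False by blast
      qed
    qed
  qed
  show ?thesis
  proof
    assume "dependent S"
    then obtain t u where t: "finite t" "t \<subseteq> S" "(\<Sum>v\<in>t. scale (u v) v) = 0" "\<exists>v\<in>t. u v \<noteq> 0"
      unfolding dependent_explicit by auto
    from independentD[OF fin[OF t(1,2)] t(1) order.refl t(3)] t(4) show False by blast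
  qed
qed

text \<open>The subspaces considered below lie in function spaces of infinite dimension, so finite dimension is a
  property of a set of vectors and not of the ambient space.\<close>

definition fin_dim :: "('a::field \<Rightarrow> 'b::ab_group_add \<Rightarrow> 'b) \<Rightarrow> 'b set \<Rightarrow> bool"
  where "fin_dim scale W \<longleftrightarrow> (\<exists>B. finite B \<and> W \<subseteq> module.span scale B)"

lemma (in vector_space) fin_dim_subset: "fin_dim scale W \<Longrightarrow> V \<subseteq> W \<Longrightarrow> fin_dim scale V"
  unfolding fin_dim_def by blast

lemma (in vector_space) fin_dim_independent_finite:
  assumes "fin_dim scale W" "\<not> dependent S" "S \<subseteq> W"
  shows "finite S"
  using assms independent_span_bound unfolding fin_dim_def by (metis order_trans)

lemma (in vector_space) fin_dim_basis:
  assumes "fin_dim scale W" "subspace W"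
  obtains B where "finite B" "\<not> dependent B" "span B = W" "card B = dim W"
proof -
  obtain B where B: "B \<subseteq> W" "\<not> dependent B" "W \<subseteq> span B" "card B = dim W"
    using basis_exists[of W] by blast
  have "span B = W" using B span_minimal[OF B(1) assms(2)] by auto
  with B fin_dim_independent_finite[OF assms(1) B(2,1)] show ?thesis using that by blast
qed

lemma (in vector_space) fin_dim_dim_less:
  assumes "fin_dim scale W" "subspace W" "subspace V" "V \<subset> W"
  shows "dim V < dim W"
proof -
  have fV: "fin_dim scale V" using fin_dim_subset assms by blast
  obtain B where B: "finite B" "\<not> dependent B" "span B = W" "card B = dim W"
    using fin_dim_basis[OF assms(1,2)] .
  obtain C where C: "finite C" "\<not> dependent C" "span C = V" "card C = dim V"
    using fin_dim_basis[OF fV assms(3)] .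
  obtain w where w: "w \<in> W" "w \<notin> V" using assms(4) by blast
  have "\<not> dependent (insert w C)" using C w by (intro independent_insertI) auto
  moreover have "insert w C \<subseteq> span B"
    using w C B assms(4) span_superset[of C] by auto
  ultimately have "card (insert w C) \<le> card B"
    using independent_span_bound[OF B(1)] by blast
  moreover have "w \<notin> C" using w C span_superset[of C] by auto
  ultimately show ?thesis using B C by simp
qed

lemma (in vector_space) span_image_lessThan:
  assumes "x \<in> span (v ` {..<n::nat})"
  obtains c where "x = (\<Sum>i<n. scale (c i) (v i))"
proof -
  have "\<exists>c. x = (\<Sum>i<n. scale (c i) (v i))"
    using assms
  proof (induction rule: span_induct_alt)
    case base
    show ?case by (rule exI[of _ "\<lambda>_. 0"]) simp
  next
    case (step a y z)
    then obtain j c where j: "j < n" "y = v j" and c: "z = (\<Sum>i<n. scale (c i) (v i))" by auto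
    have "scale a y + z = (\<Sum>i<n. scale (if i = j then a else 0) (v i)) + (\<Sum>i<n. scale (c i) (v i))"
      using j c by (simp add: if_distrib[of "\<lambda>a. scale a _"] sum.delta cong: if_cong)
    also have "\<dots> = (\<Sum>i<n. scale ((if i = j then a else 0) + c i) (v i))"
      by (simp add: scale_left_distrib sum.distrib)
    finally show ?case by (rule exI[of _ "\<lambda>i. (if i = j then a else 0) + c i"])
  qed
  then show ?thesis using that by blast
qed

text \<open>The relation is monic in \<open>v n\<close>. For the powers of an operator on a vector, or of a number, it is
  a monic polynomial equation.\<close>

lemma (in vector_space) fin_dim_sequence_dependent:
  assumes "fin_dim scale W" "\<And>i::nat. v i \<in> W"
  obtains n c where "v n = (\<Sum>i<n. scale (c i) (v i))"
proof -
  have "\<exists>n. v n \<in> span (v ` {..<n})"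
  proof (rule ccontr)
    assume n: "\<not> ?thesis"
    have "\<not> dependent (v ` {..<n}) \<and> card (v ` {..<n}) = n" for n
    proof (induction n)
      case 0
      show ?case by (simp add: independent_empty)
    next
      case (Suc n)
      have "v n \<notin> v ` {..<n}" using n span_base[of "v n" "v ` {..<n}"] by auto
      moreover have "\<not> dependent (insert (v n) (v ` {..<n}))"
        by (rule independent_insertI) (use Suc n in auto)
      ultimately show ?case using Suc by (simp add: lessThan_Suc)
    qed
    moreover obtain B where B: "finite B" "W \<subseteq> span B" using assms(1) unfolding fin_dim_def by blast
    ultimately have "Suc (card B) \<le> card B"
      using independent_span_bound[OF B(1), of "v ` {..<Suc (card B)}"] assms(2) by fastforce
    then show False by simp
  qed
  then obtain n where "v n \<in> span (v ` {..<n})" ..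
  from span_image_lessThan[OF this] that show ?thesis .
qed

text \<open>One index for each value of \<open>f\<close> gives distinct, independent vectors, and the dimension bounds their
  number. In the applications \<open>i\<close> runs through a group and \<open>f i\<close> is what is to take finitely
  many values only, such as a conjugate of a character or a class modulo scalars.\<close>

lemma (in vector_space) finitely_many_eigencharacters:
  assumes fd: "fin_dim scale L"
    and v: "\<And>i. i \<in> A \<Longrightarrow> v i \<in> L" "\<And>i. i \<in> A \<Longrightarrow> v i \<noteq> 0"
    and lin: "\<And>a. a \<in> I \<Longrightarrow> Vector_Spaces.linear scale scale (T a)"
    and eig: "\<And>i a. i \<in> A \<Longrightarrow> a \<in> I \<Longrightarrow> T a (v i) = scale (\<chi> i a) (v i)"
    and sep: "\<And>i j. i \<in> A \<Longrightarrow> j \<in> A \<Longrightarrow> (\<And>a. a \<in> I \<Longrightarrow> \<chi> i a = \<chi> j a) \<Longrightarrow> f i = f j"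
  shows "finite (f ` A)"
proof -
  obtain A' where A': "A' \<subseteq> A" "inj_on f A'" "f ` A = f ` A'"
    using subset_image_inj[of "f ` A" f A] by auto
  have sep': "\<exists>a\<in>I. \<chi> i a \<noteq> \<chi> j a" if "i \<in> A'" "j \<in> A'" "i \<noteq> j" for i j
    using sep[of i j] A' that by (auto dest: inj_onD)
  have inj: "inj_on v A'"
  proof (rule inj_onI, rule ccontr)
    fix i j assume ij: "i \<in> A'" "j \<in> A'" "v i = v j" "i \<noteq> j"
    obtain a where a: "a \<in> I" "\<chi> i a \<noteq> \<chi> j a" using sep' ij by blast
    have "T a (v i) = scale (\<chi> i a) (v i)" "T a (v j) = scale (\<chi> j a) (v j)"
      using eig ij(1,2) A'(1) a(1) by auto
    then have "scale (\<chi> i a) (v i) = scale (\<chi> j a) (v i)" using ij(3) by metis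
    then show False using a v(2)[of i] ij A'(1) by auto
  qed
  have "\<not> dependent (v ` A')"
  proof (rule independent_simultaneous_eigenvectors[where I = I and T = T
        and \<chi> = "\<lambda>x. \<chi> (the_inv_into A' v x)"])
    show "0 \<notin> v ` A'" using v(2) A'(1) by force
    show "\<exists>a\<in>I. \<chi> (the_inv_into A' v x) a \<noteq> \<chi> (the_inv_into A' v y) a"
      if xy: "x \<in> v ` A'" "y \<in> v ` A'" "x \<noteq> y" for x y
    proof -
      obtain i j where ij: "i \<in> A'" "x = v i" "j \<in> A'" "y = v j" using xy by blast
      then have "i \<noteq> j" using xy(3) by blast
      with ij show ?thesis using sep'[OF ij(1,3)] by (simp add: the_inv_into_f_f[OF inj])
    qed
  qed (use lin eig A'(1) inj in \<open>auto simp: the_inv_into_f_f subset_iff\<close>)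
  then have "finite (v ` A')"
    by (rule fin_dim_independent_finite[OF fd]) (use v(1) A'(1) in auto)
  then show ?thesis using A'(3) finite_imageD[OF _ inj] by simp
qed

lemma (in vector_space_pair) fin_dim_injective_image:
  assumes lin: "Vector_Spaces.linear s1 s2 f" and L: "vs1.subspace L"
    and inj: "\<And>x. x \<in> L \<Longrightarrow> f x = 0 \<Longrightarrow> x = 0" and fd: "fin_dim s2 (f ` L)"
  shows "fin_dim s1 L"
proof -
  interpret f: Vector_Spaces.linear s1 s2 f by fact
  obtain S where S: "S \<subseteq> L" "\<not> vs1.dependent S" "L \<subseteq> vs1.span S" "card S = vs1.dim L"
    by (rule vs1.basis_exists[of L])
  have sp: "vs1.span S \<subseteq> L" by (rule vs1.span_minimal[OF S(1) L])
  have io: "inj_on f L"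
  proof (rule inj_onI)
    fix x y assume xy: "x \<in> L" "y \<in> L" "f x = f y"
    then show "x = y" using inj[of "x - y"] vs1.subspace_diff[OF L xy(1,2)] by (simp add: f.diff)
  qed
  have "\<not> vs2.dependent (f ` S)"
    by (rule f.independent_inj_on_image[OF S(2)]) (rule inj_on_subset[OF io sp])
  then have "finite (f ` S)"
    by (rule vs2.fin_dim_independent_finite[OF fd]) (use S in auto)
  then have "finite S" using finite_imageD inj_on_subset[OF io S(1)] by blast
  with S show ?thesis unfolding fin_dim_def by blast
qed

lemma sum_fun_apply: "(\<Sum>i\<in>A. f i) x = (\<Sum>i\<in>A. f i x)"
  by (induction A rule: infinite_finite_induct) auto

lemma (in vector_space) vector_space_functions: "vector_space (\<lambda>c f x. scale c (f x))"
  by unfold_locales (auto simp: fun_eq_iff scale_right_distrib scale_left_distrib)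

text \<open>The operators on \<open>W\<close> are extended by zero, so that their equality as functions means equality on
  \<open>W\<close>. They are determined by their restrictions to a finite basis.\<close>

lemma (in vector_space) operators_fin_dim:
  assumes fd: "fin_dim scale W" and sub: "subspace W"
  defines "L \<equiv> {f. (\<forall>x\<in>W. f x \<in> W) \<and> (\<forall>x\<in>W. \<forall>y\<in>W. f (x + y) = f x + f y) \<and>
      (\<forall>c. \<forall>x\<in>W. f (scale c x) = scale c (f x)) \<and> (\<forall>x. x \<notin> W \<longrightarrow> f x = 0)}"
  shows "fin_dim (\<lambda>c f x. scale c (f x)) L"
proof -
  interpret F: vector_space "\<lambda>c f x. scale c (f x)" by (rule vector_space_functions)
  interpret FF: vector_space_pair "\<lambda>c f x. scale c (f x)" "\<lambda>c f x. scale c (f x)" ..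
  obtain E where E: "finite E" "\<not> dependent E" "span E = W" "card E = dim W"
    using fin_dim_basis[OF fd sub] .
  have EW: "e \<in> E \<Longrightarrow> e \<in> W" for e using E(3) span_base by blast
  define r where "r f = (\<lambda>x. if x \<in> E then f x else 0)" for f :: "'b \<Rightarrow> 'b"
  define \<delta> where "\<delta> e v = (\<lambda>x. if x = e then v else 0)" for e v :: 'b
  let ?D = "(\<lambda>(e, u). \<delta> e u) ` (E \<times> E)"
  have r_lin: "Vector_Spaces.linear (\<lambda>c f x. scale c (f x)) (\<lambda>c f x. scale c (f x)) r"
    by unfold_locales (auto simp: r_def fun_eq_iff)
  have L_sub: "F.subspace L"
    unfolding L_def
    by (rule F.subspaceI)
       (auto simp: subspace_0[OF sub] subspace_add[OF sub] subspace_scale[OF sub] scale_right_distrib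
         scale_left_commute ac_simps)
  have \<delta>: "\<delta> e v \<in> F.span ?D" if "e \<in> E" "v \<in> W" for e v
  proof -
    have "v \<in> span E" using that E by simp
    then show ?thesis
    proof (induction rule: span_induct_alt)
      case base
      have "\<delta> e 0 = 0" by (auto simp: \<delta>_def fun_eq_iff)
      then show ?case using F.span_zero by metis
    next
      case (step c u v)
      have "\<delta> e (scale c u + v) = (\<lambda>x. scale c (\<delta> e u x)) + \<delta> e v" by (auto simp: \<delta>_def fun_eq_iff)
      moreover have "\<delta> e u \<in> F.span ?D" using step(1) that(1) by (intro F.span_base) auto
      ultimately show ?case using F.span_add[OF F.span_scale] step(2) by metis
    qed
  qed
  have "r f = (\<Sum>e\<in>E. \<delta> e (f e))" for f
    using E(1) by (auto simp: r_def \<delta>_def fun_eq_iff sum_fun_apply sum.delta)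
  then have "r f \<in> F.span ?D" if "f \<in> L" for f
    using that EW by (auto simp: L_def intro!: F.span_sum \<delta>)
  then have "fin_dim (\<lambda>c f x. scale c (f x)) (r ` L)"
    unfolding fin_dim_def using E(1) by (intro exI[of _ ?D]) auto
  then show ?thesis
  proof (rule FF.fin_dim_injective_image[OF r_lin L_sub, rotated])
    fix f assume f: "f \<in> L" "r f = 0"
    have "span E \<subseteq> {x \<in> W. f x = 0}"
    proof (rule span_minimal)
      show "E \<subseteq> {x \<in> W. f x = 0}" using fun_cong[OF f(2)[unfolded r_def]] EW
        by (auto split: if_splits) metis
      have "f (scale 0 0) = scale 0 (f 0)" using f(1) subspace_0[OF sub] unfolding L_def by blast
      then show "subspace {x \<in> W. f x = 0}"
        using f(1) sub unfolding L_def
        by (auto intro!: subspaceI simp: subspace_0 subspace_add subspace_scale)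
    qed
    then show "f = 0" using f(1) E(3) by (auto simp: L_def fun_eq_iff)
  qed
qed

section \<open>Eigenvectors of soluble linear groups\<close>

text \<open>Among the nonzero polynomials that annihilate \<open>w\<close> take one of least degree and divide it by a
  linear factor: the quotient sends \<open>w\<close> to an eigenvector.\<close>

lemma complex_eigenvector_exists:
  fixes scale :: "complex \<Rightarrow> 'b::ab_group_add \<Rightarrow> 'b"
  assumes vs: "vector_space scale" and fd: "fin_dim scale W" and sub: "module.subspace scale W"
    and lin: "Vector_Spaces.linear scale scale d" and inv: "\<And>x. x \<in> W \<Longrightarrow> d x \<in> W"
    and nz: "w \<in> W" "w \<noteq> 0"
  obtains c x where "x \<in> W" "x \<noteq> 0" "d x = scale c x"
proof -
  interpret vector_space scale by fact
  interpret d: Vector_Spaces.linear scale scale d by fact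
  define v where "v i = (d ^^ i) w" for i
  have vW: "v i \<in> W" for i by (induction i) (auto simp: v_def nz inv)
  have vS: "v (Suc i) = d (v i)" for i by (simp add: v_def)
  define E where "E p = (\<Sum>i\<le>degree p. scale (coeff p i) (v i))" for p
  have E: "E p = (\<Sum>i\<le>m. scale (coeff p i) (v i))" if "degree p \<le> m" for p m
    unfolding E_def by (rule sum.mono_neutral_left) (use that in \<open>auto simp: coeff_eq_0\<close>)
  have EW: "E p \<in> W" for p
    unfolding E_def by (rule subspace_sum[OF sub]) (auto intro!: subspace_scale[OF sub] vW)
  have E_mult: "E ([:-a, 1:] * q) = d (E q) - scale a (E q)" for a q
  proof -
    let ?m = "degree q"
    have "degree ([:-a, 1:] * q) \<le> Suc ?m"
      using degree_mult_le[of "[:-a, 1:]" q] by simp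
    then have "E ([:-a, 1:] * q) = (\<Sum>i\<le>Suc ?m. scale (coeff (pCons 0 q) i - a * coeff q i) (v i))"
      by (subst E) (auto intro!: sum.cong simp: mult_pCons_left)
    also have "\<dots> = (\<Sum>i\<le>Suc ?m. scale (coeff (pCons 0 q) i) (v i)) -
        scale a (\<Sum>i\<le>Suc ?m. scale (coeff q i) (v i))"
      by (simp only: scale_left_diff_distrib sum_subtractf scale_sum_right scale_scale)
    also have "(\<Sum>i\<le>Suc ?m. scale (coeff (pCons 0 q) i) (v i)) = d (E q)"
      unfolding sum.atMost_Suc_shift E_def d.sum d.scale vS by simp
    also have "(\<Sum>i\<le>Suc ?m. scale (coeff q i) (v i)) = E q" by (rule E[symmetric]) simp
    finally show ?thesis .
  qed
  obtain n c where nc: "v n = (\<Sum>i<n. scale (c i) (v i))"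
    using fin_dim_sequence_dependent[OF fd, of v] vW by metis
  define p0 where "p0 = monom 1 n - (\<Sum>i<n. monom (c i) i)"
  have cp0: "coeff p0 i = (if i = n then 1 else if i < n then - c i else 0)" for i
    by (auto simp: p0_def coeff_sum sum.delta)
  have "degree p0 \<le> n" by (rule degree_le) (auto simp: cp0)
  then have "E p0 = (\<Sum>i\<le>n. scale (coeff p0 i) (v i))" by (rule E)
  also have "\<dots> = v n - (\<Sum>i<n. scale (c i) (v i))"
    by (simp add: cp0 lessThan_Suc_atMost[symmetric] sum_negf)
  finally have "E p0 = 0" using nc by simp
  moreover have "p0 \<noteq> 0" using cp0[of n] by auto
  ultimately have ex: "\<exists>k p. p \<noteq> 0 \<and> E p = 0 \<and> degree p = k" by blast
  define k where "k = (LEAST k. \<exists>p. p \<noteq> 0 \<and> E p = 0 \<and> degree p = k)"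
  obtain p where p: "p \<noteq> 0" "E p = 0" "degree p = k"
    using LeastI_ex[OF ex] unfolding k_def by blast
  have min: "E q \<noteq> 0" if "q \<noteq> 0" "degree q < k" for q
    using not_less_Least[of "degree q" "\<lambda>k. \<exists>p. p \<noteq> 0 \<and> E p = 0 \<and> degree p = k"] that
    unfolding k_def by blast
  have "degree p \<noteq> 0"
  proof
    assume "degree p = 0"
    then obtain a where "p = [:a:]" by (rule degree_eq_zeroE)
    with p(1,2) nz(2) show False by (auto simp: E_def v_def)
  qed
  then have "\<not> constant (poly p)" by (simp add: constant_degree)
  then obtain a where "poly p a = 0" using fundamental_theorem_of_algebra[of p] by metis
  then obtain q where q: "p = [:-a, 1:] * q" by (auto simp: poly_eq_0_iff_dvd)
  have "q \<noteq> 0" using p q by auto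
  moreover from this have "degree q < k"
    using p(3) unfolding q by (subst (asm) degree_mult_eq) auto
  ultimately have "E q \<noteq> 0" by (rule min)
  moreover have "d (E q) = scale a (E q)" using p(2) E_mult[of a q] unfolding q by simp
  ultimately show ?thesis using that[of "E q" a] EW by blast
qed

text \<open>The covering by left cosets is made explicit, because the translates \<open>t \<in> T\<close> are what the
  later arguments use.\<close>

definition finite_index :: "('g, 'h) monoid_scheme \<Rightarrow> 'g set \<Rightarrow> bool"
  where "finite_index G H \<longleftrightarrow> subgroup H G \<and>
    (\<exists>T. finite T \<and> T \<subseteq> carrier G \<and> (\<forall>g\<in>carrier G. \<exists>t\<in>T. inv\<^bsub>G\<^esub> t \<otimes>\<^bsub>G\<^esub> g \<in> H))"

lemma (in group) finite_index_self: "finite_index G (carrier G)"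
  unfolding finite_index_def by (auto intro!: subgroup_self exI[of _ "{\<one>}"])

text \<open>For stabilizers: \<open>K\<close> has finitely many cosets in \<open>H\<close>, as a map with finitely many values
  separates them.\<close>

lemma (in group) finite_index_fibres:
  assumes H: "finite_index G H" and K: "subgroup K G" and fin: "finite (f ` H)"
    and fib: "\<And>g h. g \<in> H \<Longrightarrow> h \<in> H \<Longrightarrow> f g = f h \<Longrightarrow> inv g \<otimes> h \<in> K"
  shows "finite_index G K"
proof -
  from H obtain T where T: "finite T" "T \<subseteq> carrier G" "\<And>g. g \<in> carrier G \<Longrightarrow> \<exists>t\<in>T. inv t \<otimes> g \<in> H"
    and sH: "subgroup H G"
    unfolding finite_index_def by blast
  define s where "s y = (SOME h. h \<in> H \<and> f h = y)" for y
  have s: "s (f h) \<in> H" "f (s (f h)) = f h" if "h \<in> H" for h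
    using someI[of "\<lambda>x. x \<in> H \<and> f x = f h" h] that unfolding s_def by auto
  let ?T = "(\<lambda>(t, y). t \<otimes> s y) ` (T \<times> f ` H)"
  have HG: "h \<in> H \<Longrightarrow> h \<in> carrier G" for h using sH by (rule subgroup.mem_carrier)
  have "\<exists>t\<in>?T. inv t \<otimes> g \<in> K" if g: "g \<in> carrier G" for g
  proof -
    obtain t where t: "t \<in> T" "inv t \<otimes> g \<in> H" using T(3)[OF g] by blast
    let ?h = "inv t \<otimes> g"
    have tG: "t \<in> carrier G" using t T by blast
    have "inv (s (f ?h)) \<otimes> ?h \<in> K" using fib s[OF t(2)] t(2) by simp
    moreover have "inv (s (f ?h)) \<otimes> ?h = inv (t \<otimes> s (f ?h)) \<otimes> g"
      using tG g HG[OF s(1)[OF t(2)]] by (simp add: inv_mult_group m_assoc)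
    ultimately show ?thesis using t by (auto intro!: rev_bexI)
  qed
  moreover have "finite ?T" using T fin by blast
  moreover have "?T \<subseteq> carrier G" using T HG s by auto
  ultimately show ?thesis unfolding finite_index_def using K by blast
qed

text \<open>The group laws are required on \<open>U\<close> only: translations of functions, extended by zero off a normal
  subgroup, satisfy the law for the unit only on functions that vanish there.\<close>

locale linear_action = group G + vector_space scale
  for G :: "('g, 'h) monoid_scheme" (structure)
    and scale :: "complex \<Rightarrow> 'b::ab_group_add \<Rightarrow> 'b" (infixr \<open>*s\<close> 75) +
  fixes \<rho> :: "'g \<Rightarrow> 'b \<Rightarrow> 'b" and U :: "'b set"
  assumes lin: "g \<in> carrier G \<Longrightarrow> Vector_Spaces.linear scale scale (\<rho> g)"
    and U_subspace: "subspace U"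
    and U_fin_dim: "fin_dim scale U"
    and act_one: "x \<in> U \<Longrightarrow> \<rho> \<one> x = x"
    and act_mult: "\<lbrakk>g \<in> carrier G; h \<in> carrier G; x \<in> U\<rbrakk> \<Longrightarrow> \<rho> (g \<otimes> h) x = \<rho> g (\<rho> h x)"
    and act_closed: "\<lbrakk>g \<in> carrier G; x \<in> U\<rbrakk> \<Longrightarrow> \<rho> g x \<in> U"

definition (in linear_action) stable :: "'g set \<Rightarrow> 'b set \<Rightarrow> bool"
  where "stable H W \<longleftrightarrow> subspace W \<and> W \<subseteq> U \<and> W \<noteq> {0} \<and> (\<forall>h\<in>H. \<forall>x\<in>W. \<rho> h x \<in> W)"

text \<open>Smaller subgroups of finite index have more stable subspaces. At a pair with a stable subspace of least
  dimension this process ends, and whatever commutes with a subgroup of finite index acts there as a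
  scalar. This takes the place of connectedness in the theorem of Lie and Kolchin.\<close>

locale strongly_irreducible = linear_action G scale \<rho> U
  for G :: "('g, 'h) monoid_scheme" (structure)
    and scale :: "complex \<Rightarrow> 'b::ab_group_add \<Rightarrow> 'b" (infixr \<open>*s\<close> 75) and \<rho> U +
  fixes H W
  assumes H_fi: "finite_index G H" and W_stable: "stable H W"
    and irr: "\<lbrakk>finite_index G K; K \<subseteq> H; stable K Y; Y \<subseteq> W\<rbrakk> \<Longrightarrow> Y = W"

lemma (in linear_action) strongly_irreducible_exists:
  assumes "U \<noteq> {0}"
  obtains H W where "strongly_irreducible G scale \<rho> U H W"
proof -
  let ?P = "\<lambda>d. \<exists>H W. finite_index G H \<and> stable H W \<and> dim W = d"
  have "stable (carrier G) U"
    unfolding stable_def using assms U_subspace act_closed by blast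
  then have ex: "\<exists>d. ?P d" using finite_index_self by blast
  define d where "d = (LEAST d. ?P d)"
  obtain H W where HW: "finite_index G H" "stable H W" "dim W = d"
    using LeastI_ex[OF ex] unfolding d_def by blast
  have "strongly_irreducible G scale \<rho> U H W"
  proof (unfold_locales, rule HW(1), rule HW(2), rule ccontr)
    fix K Y assume K: "finite_index G K" "stable K Y" "Y \<subseteq> W" "Y \<noteq> W"
    have "dim Y < dim W"
      using K HW(2) fin_dim_subset[OF U_fin_dim] unfolding stable_def
      by (intro fin_dim_dim_less) auto
    moreover have "d \<le> dim Y" unfolding d_def
      by (rule Least_le, rule exI[of _ K], rule exI[of _ Y]) (use K in simp)
    ultimately show False using HW(3) by simp
  qed
  then show ?thesis by (rule that)
qed


text \<open>On a nonzero invariant subspace of least dimension each operator is scalar, because its eigenspaces are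
  invariant under the others.\<close>

lemma commuting_common_eigenvector:
  fixes scale :: "complex \<Rightarrow> 'b::ab_group_add \<Rightarrow> 'b"
  assumes vs: "vector_space scale" and fd: "fin_dim scale W" and sub: "module.subspace scale W"
    and nz: "W \<noteq> {0}"
    and lin: "\<And>d. d \<in> D \<Longrightarrow> Vector_Spaces.linear scale scale d"
    and inv: "\<And>d x. d \<in> D \<Longrightarrow> x \<in> W \<Longrightarrow> d x \<in> W"
    and comm: "\<And>d e x. d \<in> D \<Longrightarrow> e \<in> D \<Longrightarrow> x \<in> W \<Longrightarrow> d (e x) = e (d x)"
  obtains \<chi> w where "w \<in> W" "w \<noteq> 0" "\<And>d. d \<in> D \<Longrightarrow> d w = scale (\<chi> d) w"
proof -
  interpret vector_space scale by fact
  let ?P = "\<lambda>Y. subspace Y \<and> Y \<noteq> {0} \<and> Y \<subseteq> W \<and> (\<forall>d\<in>D. \<forall>x\<in>Y. d x \<in> Y)"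
  have "?P W" using sub nz inv by blast
  from ex_has_least_nat[of ?P, OF this, of dim]
  obtain Y where Y: "?P Y" and min: "\<forall>Z. ?P Z \<longrightarrow> dim Y \<le> dim Z" by (elim exE conjE[where P = "?P _"])
  have fdY: "fin_dim scale Y" using fin_dim_subset[OF fd] Y by blast
  obtain w where w: "w \<in> Y" "w \<noteq> 0" using Y subspace_0[of Y] by blast
  have "\<exists>c. d w = scale c w" if d: "d \<in> D" for d
  proof -
    interpret d: Vector_Spaces.linear scale scale d by (rule lin[OF d])
    obtain c x where x: "x \<in> Y" "x \<noteq> 0" "d x = scale c x"
      by (rule complex_eigenvector_exists[OF vs fdY _ lin[OF d] _ w]) (use Y d in auto)
    define Z where "Z = {x \<in> Y. d x = scale c x}"
    have "subspace Z"
      using Y unfolding Z_def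
      by (auto intro!: subspaceI simp: subspace_0 subspace_add subspace_scale d.add d.scale
          scale_right_distrib scale_left_commute)
    moreover have "e y \<in> Z" if "e \<in> D" "y \<in> Z" for e y
    proof -
      interpret e: Vector_Spaces.linear scale scale e by (rule lin[OF that(1)])
      have "y \<in> W" "y \<in> Y" "d y = scale c y" using that Y unfolding Z_def by auto
      then show ?thesis using Y that(1) comm[OF d that(1), of y] by (auto simp: Z_def e.scale)
    qed
    moreover have "Z \<subseteq> Y" "x \<in> Z" using x by (auto simp: Z_def)
    ultimately have "dim Y \<le> dim Z" "subspace Z" using x Y min[rule_format, of Z] by auto
    then have "\<not> Z \<subset> Y" using fin_dim_dim_less[OF fdY, of Z] Y by auto
    with \<open>Z \<subseteq> Y\<close> w have "w \<in> Z" by auto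
    then show ?thesis by (auto simp: Z_def)
  qed
  then obtain \<chi> where "\<And>d. d \<in> D \<Longrightarrow> d w = scale (\<chi> d) w" by metis
  with w Y that show ?thesis by blast
qed

context strongly_irreducible
begin

lemma H_subgroup: "subgroup H G"
  using H_fi unfolding finite_index_def by blast

lemma H_carrier: "h \<in> H \<Longrightarrow> h \<in> carrier G"
  by (rule subgroup.mem_carrier[OF H_subgroup])

lemma W_subspace: "subspace W" and W_U: "x \<in> W \<Longrightarrow> x \<in> U" and W_nz: "W \<noteq> {0}"
  and W_closed: "h \<in> H \<Longrightarrow> x \<in> W \<Longrightarrow> \<rho> h x \<in> W"
  using W_stable unfolding stable_def by auto

lemma W_fin_dim: "fin_dim scale W"
  using fin_dim_subset[OF U_fin_dim] W_U by blast

lemma \<rho>_inv [simp]: "h \<in> H \<Longrightarrow> x \<in> W \<Longrightarrow> \<rho> (inv h) (\<rho> h x) = x"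
  "h \<in> H \<Longrightarrow> x \<in> W \<Longrightarrow> \<rho> h (\<rho> (inv h) x) = x"
  using act_mult[of "inv h" h x] act_mult[of h "inv h" x] by (simp_all add: H_carrier W_U act_one)

lemma \<rho>_zero: "h \<in> H \<Longrightarrow> \<rho> h 0 = 0"
  and \<rho>_add: "h \<in> H \<Longrightarrow> \<rho> h (x + y) = \<rho> h x + \<rho> h y"
  and \<rho>_scale: "h \<in> H \<Longrightarrow> \<rho> h (c *s x) = c *s \<rho> h x"
proof -
  assume "h \<in> H"
  then interpret h: Vector_Spaces.linear scale scale "\<rho> h" by (intro lin H_carrier)
  show "\<rho> h 0 = 0" "\<rho> h (x + y) = \<rho> h x + \<rho> h y" "\<rho> h (c *s x) = c *s \<rho> h x"
    by (rule h.zero h.add h.scale)+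
qed

lemma \<rho>_nonzero: "h \<in> H \<Longrightarrow> x \<in> W \<Longrightarrow> x \<noteq> 0 \<Longrightarrow> \<rho> h x \<noteq> 0"
  using \<rho>_inv(1)[of h x] \<rho>_zero[of "inv h"] subgroup.m_inv_closed[OF H_subgroup] by metis

lemma irreducible_under_finite_index:
  assumes "finite_index G K" "K \<subseteq> H" "subspace Y" "Y \<subseteq> W" "y \<in> Y" "y \<noteq> 0"
    and "\<And>k x. k \<in> K \<Longrightarrow> x \<in> Y \<Longrightarrow> \<rho> k x \<in> Y"
  shows "Y = W"
  using assms W_U by (intro irr) (auto simp: stable_def)

definition scalar :: "'g \<Rightarrow> bool"
  where "scalar h \<longleftrightarrow> (\<exists>c. \<forall>x\<in>W. \<rho> h x = c *s x)"

text \<open>An eigenspace of \<open>y\<close> is stable under \<open>K\<close>, hence is all of \<open>W\<close>.\<close>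

lemma scalar_if_virtually_central:
  assumes K: "finite_index G K" "K \<subseteq> H" and y: "y \<in> H"
    and comm: "\<And>k x. k \<in> K \<Longrightarrow> x \<in> W \<Longrightarrow> \<rho> y (\<rho> k x) = \<rho> k (\<rho> y x)"
  shows "scalar y"
proof -
  interpret y: Vector_Spaces.linear scale scale "\<rho> y" by (rule lin[OF H_carrier[OF y]])
  obtain w where w: "w \<in> W" "w \<noteq> 0" using W_nz subspace_0[OF W_subspace] by blast
  obtain c x where x: "x \<in> W" "x \<noteq> 0" "\<rho> y x = c *s x"
    by (rule complex_eigenvector_exists[OF vector_space_axioms W_fin_dim W_subspace
          lin[OF H_carrier[OF y]] _ w]) (use W_closed[OF y] in auto)
  have "{x \<in> W. \<rho> y x = c *s x} = W"
  proof (rule irreducible_under_finite_index[OF K])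
    show "subspace {x \<in> W. \<rho> y x = c *s x}"
      using W_subspace
      by (auto intro!: subspaceI simp: subspace_0 subspace_add subspace_scale y.add y.scale
          scale_right_distrib scale_left_commute)
    fix k z assume k: "k \<in> K" "z \<in> {x \<in> W. \<rho> y x = c *s x}"
    then have "\<rho> y (\<rho> k z) = c *s \<rho> k z" using comm[of k z] K(2) by (auto simp: \<rho>_scale)
    with k K(2) show "\<rho> k z \<in> {x \<in> W. \<rho> y x = c *s x}" using W_closed by blast
  qed (use x in auto)
  then show ?thesis unfolding scalar_def by blast
qed

text \<open>The group \<open>H\<close> permutes the weight spaces of \<open>Y\<close>. There are finitely many of them, so a
  subgroup of finite index preserves one, and that one is \<open>W\<close>.\<close>

lemma scalar_if_commutative_normal:
  assumes YH: "Y \<subseteq> H" and norm: "\<And>h y. h \<in> H \<Longrightarrow> y \<in> Y \<Longrightarrow> h \<otimes> y \<otimes> inv h \<in> Y"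
    and comm: "\<And>y z x. y \<in> Y \<Longrightarrow> z \<in> Y \<Longrightarrow> x \<in> W \<Longrightarrow> \<rho> y (\<rho> z x) = \<rho> z (\<rho> y x)"
    and y: "y \<in> Y"
  shows "scalar y"
proof -
  have Hi: "inv h \<in> H" if "h \<in> H" for h using that by (rule subgroup.m_inv_closed[OF H_subgroup])
  have norm': "inv h \<otimes> y \<otimes> h \<in> Y" if "h \<in> H" "y \<in> Y" for h y
    using norm[OF Hi[OF that(1)] that(2)] that(1) by (simp add: H_carrier)
  obtain \<chi>0 w where w: "w \<in> W" "w \<noteq> 0" and \<chi>0: "\<And>d. d \<in> \<rho> ` Y \<Longrightarrow> d w = \<chi>0 d *s w"
    by (rule commuting_common_eigenvector[OF vector_space_axioms W_fin_dim W_subspace W_nz, of "\<rho> ` Y"])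
       (use YH comm W_closed in \<open>auto intro!: lin H_carrier\<close>)
  define \<chi> where "\<chi> y = \<chi>0 (\<rho> y)" for y
  have \<chi>: "\<rho> y w = \<chi> y *s w" if "y \<in> Y" for y using that \<chi>0 by (simp add: \<chi>_def)
  have conj: "\<rho> y (\<rho> h x) = \<rho> h (\<rho> (inv h \<otimes> y \<otimes> h) x)" if "y \<in> Y" "h \<in> H" "x \<in> W" for y h x
  proof -
    have c: "y \<in> carrier G" "h \<in> carrier G" using that YH H_carrier by auto
    have "\<rho> h (\<rho> (inv h \<otimes> y \<otimes> h) x) = \<rho> (h \<otimes> (inv h \<otimes> y \<otimes> h)) x"
      using c that by (simp add: act_mult W_U)
    also have "h \<otimes> (inv h \<otimes> y \<otimes> h) = y \<otimes> h" using c by (simp add: m_assoc[symmetric])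
    finally show ?thesis using c that by (simp add: act_mult W_U)
  qed
  \<comment> \<open>the character by which \<open>Y\<close> acts on the translate of \<open>w\<close> by \<open>h\<close>\<close>
  define f where "f h = restrict (\<lambda>y. \<chi> (inv h \<otimes> y \<otimes> h)) Y" for h
  have f: "\<rho> y (\<rho> h w) = f h y *s \<rho> h w" if "y \<in> Y" "h \<in> H" for y h
    using conj[OF that w(1)] \<chi>[OF norm'[OF that(2,1)]] that by (simp add: f_def \<rho>_scale)
  have "finite (f ` H)"
  proof (rule finitely_many_eigencharacters[OF W_fin_dim, where I = Y and T = \<rho> and \<chi> = f])
    show "\<rho> h w \<in> W" "\<rho> h w \<noteq> 0" if "h \<in> H" for h using that w W_closed \<rho>_nonzero by auto
    show "f g = f h" if "\<And>y. y \<in> Y \<Longrightarrow> f g y = f h y" for g h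
      using that by (intro ext) (auto simp: f_def restrict_def)
  qed (use f YH H_carrier lin in auto)
  define K where "K = {h \<in> H. \<forall>y\<in>Y. \<chi> (inv h \<otimes> y \<otimes> h) = \<chi> y}"
  have KH: "K \<subseteq> H" by (auto simp: K_def)
  have assoc: "inv (g \<otimes> h) \<otimes> y \<otimes> (g \<otimes> h) = inv h \<otimes> (inv g \<otimes> y \<otimes> g) \<otimes> h"
    if "g \<in> carrier G" "h \<in> carrier G" "y \<in> carrier G" for g h y
    using that by (simp add: inv_mult_group m_assoc)
  have YG: "y \<in> carrier G" if "y \<in> Y" for y using that YH H_carrier by blast
  have sK: "subgroup K G"
  proof
    show "K \<subseteq> carrier G" using KH H_carrier by blast
    show "\<one> \<in> K" using YG subgroup.one_closed[OF H_subgroup] by (auto simp: K_def)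
    fix g assume g: "g \<in> K"
    show "inv g \<in> K"
      unfolding K_def
    proof (intro CollectI conjI ballI)
      show "inv g \<in> H" using g KH Hi by blast
      fix y assume y: "y \<in> Y"
      have gH: "g \<in> H" and gG: "g \<in> carrier G" using g KH H_carrier by auto
      have "\<chi> (inv g \<otimes> (g \<otimes> y \<otimes> inv g) \<otimes> g) = \<chi> (g \<otimes> y \<otimes> inv g)"
        using g norm[OF gH y] unfolding K_def by blast
      moreover have "inv g \<otimes> (g \<otimes> y \<otimes> inv g) \<otimes> g = y"
        using assoc[of "inv g" g y] gG YG[OF y] by simp
      ultimately show "\<chi> (inv (inv g) \<otimes> y \<otimes> inv g) = \<chi> y" using gG by simp
    qed
    fix h assume h: "h \<in> K"
    show "g \<otimes> h \<in> K"
      unfolding K_def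
    proof (intro CollectI conjI ballI)
      have gh: "g \<in> H" "h \<in> H" using g h KH by auto
      show "g \<otimes> h \<in> H" using gh by (rule subgroup.m_closed[OF H_subgroup])
      fix y assume y: "y \<in> Y"
      show "\<chi> (inv (g \<otimes> h) \<otimes> y \<otimes> (g \<otimes> h)) = \<chi> y"
        using assoc[OF H_carrier H_carrier YG, OF gh y] g h y norm'[OF gh(1) y]
        unfolding K_def by auto
    qed
  qed
  have fiK: "finite_index G K"
  proof (rule finite_index_fibres[OF H_fi sK \<open>finite (f ` H)\<close>])
    fix g h assume gh: "g \<in> H" "h \<in> H" "f g = f h"
    show "inv g \<otimes> h \<in> K"
      unfolding K_def
    proof (intro CollectI conjI ballI)
      show "inv g \<otimes> h \<in> H" using gh Hi by (intro subgroup.m_closed[OF H_subgroup])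
      fix y assume y: "y \<in> Y"
      let ?y = "g \<otimes> y \<otimes> inv g"
      have y': "?y \<in> Y" using norm gh y by blast
      have G: "g \<in> carrier G" "h \<in> carrier G" "y \<in> carrier G" using gh H_carrier YG y by auto
      have "inv (inv g \<otimes> h) \<otimes> y \<otimes> (inv g \<otimes> h) = inv h \<otimes> ?y \<otimes> h"
        using assoc[of "inv g" h y] G by simp
      moreover have "\<chi> (inv h \<otimes> ?y \<otimes> h) = \<chi> (inv g \<otimes> ?y \<otimes> g)"
        using fun_cong[OF gh(3), of ?y] y' by (simp add: f_def)
      moreover have "inv g \<otimes> ?y \<otimes> g = y" using assoc[of "inv g" g y] G by simp
      ultimately show "\<chi> (inv (inv g \<otimes> h) \<otimes> y \<otimes> (inv g \<otimes> h)) = \<chi> y" by simp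
    qed
  qed
  have "{x \<in> W. \<forall>y\<in>Y. \<rho> y x = \<chi> y *s x} = W"
  proof (rule irreducible_under_finite_index[OF fiK KH])
    show "subspace {x \<in> W. \<forall>y\<in>Y. \<rho> y x = \<chi> y *s x}"
      using W_subspace YH
      by (auto intro!: subspaceI simp: subspace_0 subspace_add subspace_scale scale_right_distrib
          scale_left_commute \<rho>_zero \<rho>_add \<rho>_scale subset_iff)
    show "w \<in> {x \<in> W. \<forall>y\<in>Y. \<rho> y x = \<chi> y *s x}" using w \<chi> by simp
    fix k x assume k: "k \<in> K" and x: "x \<in> {x \<in> W. \<forall>y\<in>Y. \<rho> y x = \<chi> y *s x}"
    have kH: "k \<in> H" using k KH by blast
    have "\<rho> y (\<rho> k x) = \<chi> y *s \<rho> k x" if y: "y \<in> Y" for y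
    proof -
      have "\<rho> y (\<rho> k x) = \<rho> k (\<rho> (inv k \<otimes> y \<otimes> k) x)" using conj[OF y kH] x by blast
      also have "\<rho> (inv k \<otimes> y \<otimes> k) x = \<chi> (inv k \<otimes> y \<otimes> k) *s x" using x norm'[OF kH y] by blast
      also have "\<chi> (inv k \<otimes> y \<otimes> k) = \<chi> y" using k y unfolding K_def by blast
      finally show ?thesis using kH by (simp add: \<rho>_scale)
    qed
    then show "\<rho> k x \<in> {x \<in> W. \<forall>y\<in>Y. \<rho> y x = \<chi> y *s x}" using W_closed[OF kH] x by blast
  qed (use w in auto)
  then show ?thesis unfolding scalar_def using y by blast
qed

lemma \<rho>_mult: "g \<in> H \<Longrightarrow> h \<in> H \<Longrightarrow> x \<in> W \<Longrightarrow> \<rho> (g \<otimes> h) x = \<rho> g (\<rho> h x)"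
  by (simp add: act_mult H_carrier W_U)

lemma finitely_many_eigenvalues:
  assumes "y \<in> H"
  shows "finite {c. \<exists>x\<in>W. x \<noteq> 0 \<and> \<rho> y x = c *s x}" (is "finite ?E")
proof -
  define v where "v c = (SOME x. x \<in> W \<and> x \<noteq> 0 \<and> \<rho> y x = c *s x)" for c
  have v: "v c \<in> W \<and> v c \<noteq> 0 \<and> \<rho> y (v c) = c *s v c" if "c \<in> ?E" for c
    using that someI_ex[of "\<lambda>x. x \<in> W \<and> x \<noteq> 0 \<and> \<rho> y x = c *s x"] unfolding v_def by blast
  have "finite ((\<lambda>c. c) ` ?E)"
    by (rule finitely_many_eigencharacters[OF W_fin_dim, where I = "{()}" and T = "\<lambda>_. \<rho> y"
          and \<chi> = "\<lambda>c _. c" and v = v]) (use v assms in \<open>auto intro!: lin H_carrier\<close>)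
  then show ?thesis by simp
qed

text \<open>Conjugation by \<open>b\<close> multiplies the operator of each \<open>y \<in> B\<close> by a scalar \<open>\<mu> y b\<close>. If
  \<open>y\<close> and \<open>y'\<close> have the same scalars, then \<open>inv y \<otimes> y'\<close> commutes with \<open>B\<close> and is
  scalar by the previous lemma. So operators that are different modulo scalars are independent, and there
  are finitely many of them. The conjugates of \<open>y\<close> under \<open>H\<close> therefore lie on finitely many
  lines; as they have the same eigenvalues, each line contains finitely many. Thus \<open>y\<close> commutes with
  a subgroup of finite index.\<close>

lemma scalar_if_commutators_scalar:
  assumes B: "subgroup B G" and BH: "B \<subseteq> H"
    and norm: "\<And>h b. h \<in> H \<Longrightarrow> b \<in> B \<Longrightarrow> h \<otimes> b \<otimes> inv h \<in> B"
    and comm: "\<And>a b. a \<in> B \<Longrightarrow> b \<in> B \<Longrightarrow> scalar (a \<otimes> b \<otimes> inv a \<otimes> inv b)"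
    and y: "y \<in> B"
  shows "scalar y"
proof -
  have Hi: "inv h \<in> H" if "h \<in> H" for h using that by (rule subgroup.m_inv_closed[OF H_subgroup])
  have Hm: "g \<otimes> h \<in> H" if "g \<in> H" "h \<in> H" for g h using that by (rule subgroup.m_closed[OF H_subgroup])
  have Bi: "inv b \<in> B" if "b \<in> B" for b using that by (rule subgroup.m_inv_closed[OF B])
  have BH': "b \<in> H" if "b \<in> B" for b using that BH by blast
  note G = H_carrier
  note W = W_closed
  have norm': "inv h \<otimes> b \<otimes> h \<in> B" if "h \<in> H" "b \<in> B" for h b
    using norm[OF Hi[OF that(1)] that(2)] that(1) by (simp add: G)
  have conj: "\<rho> (g \<otimes> b \<otimes> inv g) x = \<rho> g (\<rho> b (\<rho> (inv g) x))" if "g \<in> H" "b \<in> H" "x \<in> W" for g b x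
    using that by (simp add: \<rho>_mult Hm Hi W)
  \<comment> \<open>operators commuting with all of \<open>B\<close> are scalar\<close>
  define Z where "Z = {z \<in> B. \<forall>b\<in>B. \<forall>x\<in>W. \<rho> z (\<rho> b x) = \<rho> b (\<rho> z x)}"
  have Z_scalar: "scalar z" if "z \<in> Z" for z
  proof (rule scalar_if_commutative_normal[OF _ _ _ that])
    show "Z \<subseteq> H" using BH by (auto simp: Z_def)
    show "\<rho> y (\<rho> z x) = \<rho> z (\<rho> y x)" if "y \<in> Z" "z \<in> Z" "x \<in> W" for y z x
      using that unfolding Z_def by blast
    fix h z assume h: "h \<in> H" and z: "z \<in> Z"
    then have zB: "z \<in> B" by (auto simp: Z_def)
    have "\<rho> (h \<otimes> z \<otimes> inv h) (\<rho> b x) = \<rho> b (\<rho> (h \<otimes> z \<otimes> inv h) x)" if b: "b \<in> B" and x: "x \<in> W" for b x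
    proof -
      let ?b = "inv h \<otimes> b \<otimes> h" and ?x = "\<rho> (inv h) x"
      have b': "?b \<in> B" using norm' h b by blast
      have bh: "\<rho> (inv h) (\<rho> b x) = \<rho> ?b ?x" and hb: "\<rho> b (\<rho> h u) = \<rho> h (\<rho> ?b u)" if "u \<in> W" for u
        using h b x that BH' by (simp_all add: \<rho>_mult Hm Hi W)
      have "\<rho> (h \<otimes> z \<otimes> inv h) (\<rho> b x) = \<rho> h (\<rho> z (\<rho> ?b ?x))"
        using conj[OF h BH'[OF zB]] bh[OF x] h b x BH' W by simp
      also have "\<rho> z (\<rho> ?b ?x) = \<rho> ?b (\<rho> z ?x)" using z b' h x Hi W unfolding Z_def by blast
      also have "\<rho> h (\<rho> ?b (\<rho> z ?x)) = \<rho> b (\<rho> h (\<rho> z ?x))"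
        using hb[of "\<rho> z ?x"] zB BH' h x Hi W by simp
      also have "\<rho> h (\<rho> z ?x) = \<rho> (h \<otimes> z \<otimes> inv h) x" using conj[OF h BH'[OF zB] x] by simp
      finally show ?thesis .
    qed
    then show "h \<otimes> z \<otimes> inv h \<in> Z" using norm[OF h zB] unfolding Z_def by blast
  qed
  have \<lambda>: "\<exists>c. \<forall>x\<in>W. \<rho> b (\<rho> y x) = c *s \<rho> y (\<rho> b x)" if "b \<in> B" "y \<in> B" for b y
  proof -
    obtain c where c: "\<forall>x\<in>W. \<rho> (b \<otimes> y \<otimes> inv b \<otimes> inv y) x = c *s x"
      using comm[OF \<open>b \<in> B\<close> \<open>y \<in> B\<close>] unfolding scalar_def by blast
    have "\<rho> b (\<rho> y x) = c *s \<rho> y (\<rho> b x)" if "x \<in> W" for x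
    proof -
      have "\<rho> y (\<rho> b x) \<in> W" using that \<open>b \<in> B\<close> \<open>y \<in> B\<close> BH' W by auto
      then have "c *s \<rho> y (\<rho> b x) = \<rho> (b \<otimes> y \<otimes> inv b \<otimes> inv y) (\<rho> y (\<rho> b x))" using c by simp
      also have "\<dots> = \<rho> b (\<rho> y x)"
        using that \<open>b \<in> B\<close> \<open>y \<in> B\<close> BH' by (simp add: \<rho>_mult Hm Hi W)
      finally show ?thesis by simp
    qed
    then show ?thesis by blast
  qed
  \<comment> \<open>modulo scalars, \<open>B\<close> acts through finitely many operators\<close>
  define cls where "cls b = {b' \<in> B. \<exists>c. \<forall>x\<in>W. \<rho> b' x = c *s \<rho> b x}" for b
  have cls_self: "b \<in> cls b" if "b \<in> B" for b
    using that unfolding cls_def by (auto intro!: exI[of _ 1])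
  let ?s = "\<lambda>c (f :: 'b \<Rightarrow> 'b) x. c *s f x"
  define op where "op b = (\<lambda>x. if x \<in> W then \<rho> b x else 0)" for b
  define T where "T b f = (\<lambda>x. if x \<in> W then \<rho> b (f (\<rho> (inv b) x)) else 0)" for b and f :: "'b \<Rightarrow> 'b"
  interpret F: vector_space ?s by (rule vector_space_functions)
  obtain w where w: "w \<in> W" "w \<noteq> 0" using W_nz subspace_0[OF W_subspace] by blast
  define \<mu> where "\<mu> y b = (SOME c. \<forall>x\<in>W. \<rho> b (\<rho> y x) = c *s \<rho> y (\<rho> b x))" for y b
  have \<mu>: "\<rho> b (\<rho> y x) = \<mu> y b *s \<rho> y (\<rho> b x)" if "b \<in> B" "y \<in> B" "x \<in> W" for b y x
    using someI_ex[OF \<lambda>[OF that(1,2)]] that(3) unfolding \<mu>_def by blast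
  have fin_cls: "finite (cls ` B)"
  proof (rule F.finitely_many_eigencharacters[OF operators_fin_dim[OF W_fin_dim W_subspace],
        where I = B and T = T and v = op and \<chi> = \<mu>], goal_cases)
    case (1 b)
    then show ?case
      using W_subspace BH' by (auto simp: op_def subspace_add subspace_scale \<rho>_add \<rho>_scale W)
  next
    case (2 b)
    then show ?case using \<rho>_nonzero[OF BH'[OF 2] w] w by (auto simp: op_def fun_eq_iff)
  next
    case (3 b)
    then show ?case using BH' by unfold_locales (auto simp: T_def fun_eq_iff \<rho>_add \<rho>_scale)
  next
    case (4 y b)
    have "\<rho> b (\<rho> y (\<rho> (inv b) x)) = \<mu> y b *s \<rho> y x" if "x \<in> W" for x
      using \<mu>[OF 4(2,1), of "\<rho> (inv b) x"] that 4(2) BH' Hi W by simp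
    then show ?case using W Hi[OF BH'[OF 4(2)]] by (auto simp: T_def op_def)
  next
    case (5 y y')
    have \<mu>0: "\<mu> y b \<noteq> 0" if "b \<in> B" for b
      using \<mu>[OF that 5(1) w(1)] \<rho>_nonzero[OF BH'[OF that] _ \<rho>_nonzero[OF BH'[OF 5(1)] w]]
        W[OF BH'[OF 5(1)] w(1)] by auto
    let ?z = "inv y \<otimes> y'"
    have yH: "y \<in> H" "y' \<in> H" using 5 BH' by auto
    have "\<rho> ?z (\<rho> b x) = \<rho> b (\<rho> ?z x)" if b: "b \<in> B" and x: "x \<in> W" for b x
    proof -
      have bH: "b \<in> H" using b BH' by blast
      have inv: "\<rho> (inv y) (\<rho> b u) = \<mu> y b *s \<rho> b (\<rho> (inv y) u)" if u: "u \<in> W" for u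
      proof -
        have "\<rho> b u = \<mu> y b *s \<rho> y (\<rho> b (\<rho> (inv y) u))"
          using \<mu>[OF b 5(1), of "\<rho> (inv y) u"] u yH Hi W by simp
        then have "\<rho> (inv y) (\<rho> b u) = \<rho> (inv y) (\<mu> y b *s \<rho> y (\<rho> b (\<rho> (inv y) u)))" by simp
        also have "\<dots> = \<mu> y b *s \<rho> b (\<rho> (inv y) u)" using u yH bH Hi W by (simp add: \<rho>_scale)
        finally show ?thesis .
      qed
      have "\<mu> y b *s \<rho> b (\<rho> ?z x) = \<rho> (inv y) (\<rho> b (\<rho> y' x))"
        using inv[of "\<rho> y' x"] x yH Hi W by (simp add: \<rho>_mult)
      also have "\<dots> = \<mu> y b *s \<rho> ?z (\<rho> b x)"
        using \<mu>[OF b 5(2) x] 5(3)[OF b] x yH Hi bH W by (simp add: \<rho>_mult \<rho>_scale)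
      finally show ?thesis using \<mu>0[OF b] by simp
    qed
    then have "?z \<in> Z" using 5 Bi subgroup.m_closed[OF B] unfolding Z_def by blast
    then obtain c where c: "\<And>x. x \<in> W \<Longrightarrow> \<rho> ?z x = c *s x" using Z_scalar unfolding scalar_def by blast
    have y': "\<rho> y' x = c *s \<rho> y x" if "x \<in> W" for x
    proof -
      have "\<rho> y' x = \<rho> y (\<rho> ?z x)" using that yH Hi W by (simp add: \<rho>_mult)
      then show ?thesis using c[OF that] yH by (simp add: \<rho>_scale)
    qed
    have "c \<noteq> 0" using y'[OF w(1)] \<rho>_nonzero[OF yH(2) w] by auto
    then have y'': "\<rho> y x = inverse c *s \<rho> y' x" if "x \<in> W" for x using y'[OF that] by simp
    show ?case
      unfolding cls_def using y' y'' by (intro Collect_cong conj_cong refl) (metis scale_scale)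
  qed
  \<comment> \<open>the operators of the \<open>H\<close>-conjugates of \<open>y\<close> share their finitely many eigenvalues\<close>
  define E where "E = {c. \<exists>x\<in>W. x \<noteq> 0 \<and> \<rho> y x = c *s x}"
  have finE: "finite E" unfolding E_def by (rule finitely_many_eigenvalues[OF BH'[OF y]])
  have yH: "y \<in> H" by (rule BH'[OF y])
  obtain \<alpha> u where u: "u \<in> W" "u \<noteq> 0" "\<rho> y u = \<alpha> *s u"
    by (rule complex_eigenvector_exists[OF vector_space_axioms W_fin_dim W_subspace
          lin[OF G[OF yH]] _ w]) (use W yH in auto)
  have \<alpha>0: "\<alpha> \<noteq> 0" using u \<rho>_nonzero[OF yH u(1,2)] by auto
  define f where "f g = op (g \<otimes> y \<otimes> inv g)" for g
  have fin_f: "finite (f ` {g \<in> H. cls (g \<otimes> y \<otimes> inv g) = \<kappa>})" for \<kappa>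
  proof (cases "{g \<in> H. cls (g \<otimes> y \<otimes> inv g) = \<kappa>} = {}")
    case False
    then obtain g0 where g0: "g0 \<in> H" "cls (g0 \<otimes> y \<otimes> inv g0) = \<kappa>" by blast
    have "f ` {g \<in> H. cls (g \<otimes> y \<otimes> inv g) = \<kappa>} \<subseteq> (\<lambda>\<beta>. ?s (\<beta> / \<alpha>) (f g0)) ` E"
    proof clarify
      fix g assume g: "g \<in> H" "\<kappa> = cls (g \<otimes> y \<otimes> inv g)"
      have "g \<otimes> y \<otimes> inv g \<in> cls (g0 \<otimes> y \<otimes> inv g0)"
        using cls_self[OF norm[OF g(1) y]] g(2) g0(2) by simp
      then obtain c where c: "\<And>x. x \<in> W \<Longrightarrow> \<rho> (g \<otimes> y \<otimes> inv g) x = c *s \<rho> (g0 \<otimes> y \<otimes> inv g0) x"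
        unfolding cls_def by blast
      let ?u = "\<rho> g0 u"
      have u': "?u \<in> W" "?u \<noteq> 0" using u g0 W \<rho>_nonzero by auto
      have "\<rho> (g \<otimes> y \<otimes> inv g) ?u = (c * \<alpha>) *s ?u"
        using c[OF u'(1)] conj[OF g0(1) yH u'(1)] u g0 by (simp add: \<rho>_scale)
      then have "\<rho> g (\<rho> y (\<rho> (inv g) ?u)) = (c * \<alpha>) *s ?u" using conj[OF g(1) yH u'(1)] by simp
      then have "\<rho> (inv g) (\<rho> g (\<rho> y (\<rho> (inv g) ?u))) = (c * \<alpha>) *s \<rho> (inv g) ?u"
        using Hi[OF g(1)] by (simp add: \<rho>_scale)
      then have "\<rho> y (\<rho> (inv g) ?u) = (c * \<alpha>) *s \<rho> (inv g) ?u"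
        using g(1) yH Hi W u' by simp
      then have "c * \<alpha> \<in> E"
        unfolding E_def using \<rho>_nonzero[OF Hi[OF g(1)] u'] W[OF Hi[OF g(1)] u'(1)] by blast
      moreover have "f g = ?s (c * \<alpha> / \<alpha>) (f g0)" using c \<alpha>0 by (auto simp: f_def op_def fun_eq_iff)
      ultimately show "f g \<in> (\<lambda>\<beta>. ?s (\<beta> / \<alpha>) (f g0)) ` E" by (rule rev_image_eqI)
    qed
    then show ?thesis using finE by (meson finite_imageI finite_subset)
  next
    case True
    show ?thesis unfolding True by simp
  qed
  have fH: "f ` H = (\<Union>\<kappa>\<in>cls ` B. f ` {g \<in> H. cls (g \<otimes> y \<otimes> inv g) = \<kappa>})"
    using norm[OF _ y] by auto
  have fin: "finite (f ` H)" unfolding fH by (intro finite_UN_I fin_cls fin_f)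
  define K where "K = {k \<in> H. \<forall>x\<in>W. \<rho> (k \<otimes> y \<otimes> inv k) x = \<rho> y x}"
  have KI: "k \<in> K" if "k \<in> H" "\<And>x. x \<in> W \<Longrightarrow> \<rho> k (\<rho> y (\<rho> (inv k) x)) = \<rho> y x" for k
    using that conj[OF _ yH] by (auto simp: K_def)
  have KD: "k \<in> H" "x \<in> W \<Longrightarrow> \<rho> k (\<rho> y (\<rho> (inv k) x)) = \<rho> y x" if "k \<in> K" for k x
    using that conj[OF _ yH] by (auto simp: K_def)
  have sK: "subgroup K G"
  proof
    show "K \<subseteq> carrier G" using KD(1) G by blast
    show "\<one> \<in> K"
      using subgroup.one_closed[OF H_subgroup] yH W by (intro KI) (auto simp: act_one W_U)
    fix g assume g: "g \<in> K"
    show "inv g \<in> K"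
    proof (rule KI)
      fix x assume x: "x \<in> W"
      have "\<rho> g (\<rho> y x) = \<rho> y (\<rho> g x)"
        using KD(2)[OF g, of "\<rho> g x"] KD(1)[OF g] x W by simp
      then have "\<rho> (inv g) (\<rho> y (\<rho> g x)) = \<rho> (inv g) (\<rho> g (\<rho> y x))" by simp
      then show "\<rho> (inv g) (\<rho> y (\<rho> (inv (inv g)) x)) = \<rho> y x"
        using KD(1)[OF g] x yH W G by simp
    qed (use KD(1)[OF g] Hi in blast)
    fix h assume h: "h \<in> K"
    show "g \<otimes> h \<in> K"
    proof (rule KI)
      fix x assume x: "x \<in> W"
      show "\<rho> (g \<otimes> h) (\<rho> y (\<rho> (inv (g \<otimes> h)) x)) = \<rho> y x"
        using KD[OF g] KD[OF h] x yH W Hi G by (simp add: inv_mult_group \<rho>_mult)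
    qed (use KD(1) g h Hm in blast)
  qed
  have fiK: "finite_index G K"
  proof (rule finite_index_fibres[OF H_fi sK fin])
    fix g h assume gh: "g \<in> H" "h \<in> H" "f g = f h"
    show "inv g \<otimes> h \<in> K"
    proof (rule KI)
      fix x assume x: "x \<in> W"
      have "\<rho> (g \<otimes> y \<otimes> inv g) (\<rho> g x) = \<rho> (h \<otimes> y \<otimes> inv h) (\<rho> g x)"
        using fun_cong[OF gh(3), of "\<rho> g x"] x gh W by (simp add: f_def op_def)
      then have "\<rho> g (\<rho> y x) = \<rho> h (\<rho> y (\<rho> (inv h) (\<rho> g x)))"
        using x gh W yH by (simp add: conj)
      then have "\<rho> (inv g) (\<rho> g (\<rho> y x)) = \<rho> (inv g) (\<rho> h (\<rho> y (\<rho> (inv h) (\<rho> g x))))" by simp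
      then show "\<rho> (inv g \<otimes> h) (\<rho> y (\<rho> (inv (inv g \<otimes> h)) x)) = \<rho> y x"
        using x gh W yH Hi G by (simp add: inv_mult_group \<rho>_mult)
    qed (use gh Hm Hi in blast)
  qed
  show ?thesis
  proof (rule scalar_if_virtually_central[OF fiK _ yH])
    show "K \<subseteq> H" using KD(1) by blast
    fix k x assume k: "k \<in> K" and x: "x \<in> W"
    show "\<rho> y (\<rho> k x) = \<rho> k (\<rho> y x)"
      using KD(2)[OF k, of "\<rho> k x"] KD(1)[OF k] x W by simp
  qed
qed

text \<open>Downward induction along the derived series of \<open>H\<close>: the commutators of one term lie in the next.\<close>

lemma scalar_if_solvable:
  assumes "solvable G" and "h \<in> H"
  shows "scalar h"
proof -
  obtain n where n: "(derived G ^^ n) H = {\<one>}"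
    using solvable_imp_trivial_derived_seq[OF solvable_subgroup[OF H_subgroup assms(1)]] by blast
  let ?D = "\<lambda>i. (derived G ^^ i) H"
  have sub: "subgroup (?D i) G" for i by (rule exp_of_derived_is_subgroup[OF H_subgroup])
  have DH: "?D i \<subseteq> H" for i
  proof (induction i)
    case (Suc i)
    then show ?case using derived_incl[OF _ H_subgroup, of "?D i"] by simp
  qed simp
  interpret H: group "G\<lparr>carrier := H\<rparr>" by (rule subgroup_imp_group[OF H_subgroup])
  have normal: "?D i \<lhd> G\<lparr>carrier := H\<rparr>" for i
  proof (induction i)
    case 0
    show ?case using H.normal_self by simp
  next
    case (Suc i)
    then show ?case
      using H.derived_is_normal[OF Suc] derived_consistent[OF DH[of i] H_subgroup] by simp
  qed
  have conj: "h \<otimes> b \<otimes> inv h \<in> ?D i" if "h \<in> H" "b \<in> ?D i" for h b i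
    using normal.inv_op_closed2[OF normal, of h b i] that m_inv_consistent[OF H_subgroup] by simp
  have "\<forall>b\<in>?D (n - k). scalar b" if "k \<le> n" for k
    using that
  proof (induction k)
    case 0
    show ?case using n act_one W_U by (auto simp: scalar_def intro!: exI[of _ 1])
  next
    case (Suc k)
    define i where "i = n - Suc k"
    have i: "n - k = Suc i" using Suc.prems by (simp add: i_def)
    have IH: "\<forall>b\<in>?D (Suc i). scalar b" using Suc i by simp
    have comm: "a \<otimes> b \<otimes> inv a \<otimes> inv b \<in> ?D (Suc i)" if "a \<in> ?D i" "b \<in> ?D i" for a b
      using that by (auto simp: derived_def intro!: generate.incl)
    show ?case
      unfolding i_def[symmetric]
      using scalar_if_commutators_scalar[OF sub DH conj, of i] IH comm by blast
  qed
  from this[of n] show ?thesis using assms(2) by simp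
qed

end

text \<open>Mal'cev's version of the Lie-Kolchin theorem for groups without topology: a common eigenvector exists
  after passing to a subgroup of finite index.\<close>

theorem (in linear_action) solvable_virtual_eigenvector:
  assumes "solvable G" "U \<noteq> {0}"
  obtains H w \<chi> where "finite_index G H" "w \<in> U" "w \<noteq> 0" "\<And>h. h \<in> H \<Longrightarrow> \<rho> h w = \<chi> h *s w"
proof -
  obtain H W where "strongly_irreducible G scale \<rho> U H W"
    by (rule strongly_irreducible_exists[OF assms(2)])
  then interpret strongly_irreducible G scale \<rho> U H W .
  obtain w where w: "w \<in> W" "w \<noteq> 0" using W_nz subspace_0[OF W_subspace] by blast
  have "\<forall>h\<in>H. \<exists>c. \<rho> h w = c *s w"
    using scalar_if_solvable[OF assms(1)] w(1) unfolding scalar_def by blast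
  then obtain \<chi> where "\<And>h. h \<in> H \<Longrightarrow> \<rho> h w = \<chi> h *s w" by metis
  then show ?thesis using that[OF H_fi W_U[OF w(1)] w(2)] by blast
qed

section \<open>Abelian groups of finite rank\<close>

lemma finite_rank_subgroup:
  assumes "group G" "finite_rank G" "subgroup H G"
  shows "finite_rank (G\<lparr>carrier := H\<rparr>)"
proof -
  interpret group G by fact
  obtain r where r': "\<forall>S. finite S \<and> S \<subseteq> carrier G \<longrightarrow>
      (\<exists>T. finite T \<and> card T \<le> r \<and> T \<subseteq> carrier G \<and> generate G T = generate G S)"
    using assms(2) unfolding finite_rank_def ..
  note r = r'[rule_format, OF conjI]
  show ?thesis
    unfolding finite_rank_def
  proof (intro exI[of _ r] allI impI)
    fix S assume S: "finite S \<and> S \<subseteq> carrier (G\<lparr>carrier := H\<rparr>)"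
    then have SH: "S \<subseteq> H" by simp
    then obtain T where T: "finite T" "card T \<le> r" "T \<subseteq> carrier G" "generate G T = generate G S"
      using r[of S] S subgroup.subset[OF assms(3)] by blast
    have "T \<subseteq> H"
      using generate_subgroup_incl[OF SH assms(3)] T(4) by (auto intro: generate.incl)
    with T SH show "\<exists>T. finite T \<and> card T \<le> r \<and> T \<subseteq> carrier (G\<lparr>carrier := H\<rparr>) \<and>
        generate (G\<lparr>carrier := H\<rparr>) T = generate (G\<lparr>carrier := H\<rparr>) S"
      by (auto simp: generate_consistent[OF _ assms(3)])
  qed
qed

lemma finite_rank_surj_hom:
  assumes "group_hom G A h" "h ` carrier G = carrier A" "finite_rank G"
  shows "finite_rank A"
proof -
  interpret group_hom G A h by fact
  obtain r where r': "\<forall>S. finite S \<and> S \<subseteq> carrier G \<longrightarrow>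
      (\<exists>T. finite T \<and> card T \<le> r \<and> T \<subseteq> carrier G \<and> generate G T = generate G S)"
    using assms(3) unfolding finite_rank_def ..
  note r = r'[rule_format, OF conjI]
  show ?thesis
    unfolding finite_rank_def
  proof (intro exI[of _ r] allI impI)
    fix S assume S: "finite S \<and> S \<subseteq> carrier A"
    then obtain S' where S': "S' \<subseteq> carrier G" "finite S'" "S = h ` S'"
      using finite_subset_image[of S h "carrier G"] assms(2) by auto
    then obtain T where T: "finite T" "card T \<le> r" "T \<subseteq> carrier G" "generate G T = generate G S'"
      using r by blast
    have "card (h ` T) \<le> r" using card_image_le[OF T(1)] T(2) by (rule order_trans)
    moreover have "generate A (h ` T) = generate A S"
      using generate_img[OF T(3)] generate_img[OF S'(1)] T(4) S'(3) by simp
    moreover have "h ` T \<subseteq> carrier A" using T(3) by auto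
    ultimately show "\<exists>T. finite T \<and> card T \<le> r \<and> T \<subseteq> carrier A \<and> generate A T = generate A S"
      using T(1) by blast
  qed
qed

context comm_group
begin

definition monomial :: "'a set \<Rightarrow> ('a \<Rightarrow> int) \<Rightarrow> 'a"
  where "monomial E k = (\<Otimes>e\<in>E. e [^] k e)"

lemma monomial_closed [simp]: "E \<subseteq> carrier G \<Longrightarrow> monomial E k \<in> carrier G"
  unfolding monomial_def by (rule finprod_closed) auto

lemma monomial_zero: "monomial E (\<lambda>_. 0) = \<one>"
  unfolding monomial_def by (simp add: finprod_one)

lemma monomial_single:
  assumes "finite E" "E \<subseteq> carrier G" "h \<in> E"
  shows "monomial E (\<lambda>e. if e = h then n else 0) = h [^] n"
proof -
  have "monomial E (\<lambda>e. if e = h then n else 0) = (\<Otimes>e\<in>E. if h = e then e [^] n else \<one>)"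
    unfolding monomial_def using assms by (intro finprod_cong') auto
  also have "\<dots> = h [^] n" using assms by (intro finprod_singleton) auto
  finally show ?thesis .
qed

lemma monomial_add:
  assumes "E \<subseteq> carrier G"
  shows "monomial E (\<lambda>e. k e + l e) = monomial E k \<otimes> monomial E l"
proof -
  have "monomial E (\<lambda>e. k e + l e) = (\<Otimes>e\<in>E. e [^] k e \<otimes> e [^] l e)"
    unfolding monomial_def using assms by (intro finprod_cong') (auto simp: int_pow_mult subset_iff)
  also have "\<dots> = monomial E k \<otimes> monomial E l"
    unfolding monomial_def using assms by (intro finprod_multf) auto
  finally show ?thesis .
qed

lemma monomial_neg:
  assumes "E \<subseteq> carrier G"
  shows "monomial E (\<lambda>e. - k e) = inv monomial E k"
  using monomial_add[OF assms, of "\<lambda>e. - k e" k] assms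
  by (intro inv_equality[symmetric]) (auto simp: monomial_zero)

lemma generate_monomial:
  assumes "finite E" "E \<subseteq> carrier G" "x \<in> generate G E"
  obtains k where "x = monomial E k"
proof -
  have "\<exists>k. x = monomial E k"
    using assms(3)
  proof (induction rule: generate.induct)
    case one
    show ?case using monomial_zero by metis
  next
    case (incl h)
    then show ?case using monomial_single[OF assms(1,2), of h 1] assms(2) by (metis int_pow_1 subsetD)
  next
    case (inv h)
    then show ?case using monomial_single[OF assms(1,2), of h "-1"] assms(2)
      by (metis int_pow_1 int_pow_neg subsetD)
  next
    case (eng g h)
    then show ?case using monomial_add[OF assms(2)] by metis
  qed
  then show ?thesis using that by blast
qed

lemma monomial_in_generate:
  assumes "finite E" "E \<subseteq> carrier G"
  shows "monomial E k \<in> generate G E"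
  unfolding monomial_def
proof -
  have "(\<Otimes>e\<in>F. e [^] k e) \<in> generate G E" if "finite F" "F \<subseteq> E" for F
    using that
  proof (induction F)
    case empty
    show ?case by (simp add: generate.one)
  next
    case (insert e F)
    have "e [^] k e \<in> generate G E"
      using insert subgroup_int_pow_closed[OF generate_is_subgroup[OF assms(2)]] by (auto intro: generate.incl)
    then show ?case using insert assms(2) by (subst finprod_insert) (auto intro: generate.eng)
  qed
  from this[OF assms(1) order.refl] show "(\<Otimes>e\<in>E. e [^] k e) \<in> generate G E" .
qed

definition free_on :: "'a set \<Rightarrow> bool"
  where "free_on E \<longleftrightarrow> finite E \<and> E \<subseteq> carrier G \<and> (\<forall>k. monomial E k = \<one> \<longrightarrow> (\<forall>e\<in>E. k e = 0))"

text \<open>The exponents of monomials map the generated group to a rational vector space. The unit vectors are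
  images of elements of \<open>E\<close> and lie in the span of the image of \<open>T\<close>.\<close>

lemma free_on_card_le:
  assumes E: "free_on E" and T: "finite T" "generate G T = generate G E"
  shows "card E \<le> card T"
proof -
  let ?s = "\<lambda>(c::rat) (f::'a \<Rightarrow> rat) x. c * f x"
  interpret V: vector_space ?s by unfold_locales (auto simp: fun_eq_iff algebra_simps)
  have fE: "finite E" and EG: "E \<subseteq> carrier G"
    and indep: "\<And>k e. monomial E k = \<one> \<Longrightarrow> e \<in> E \<Longrightarrow> k e = 0"
    using E unfolding free_on_def by blast+
  \<comment> \<open>the exponents of a monomial are determined on \<open>E\<close>, as \<open>E\<close> is free\<close>
  define \<kappa> where "\<kappa> x = (\<lambda>e. if e \<in> E then of_int ((SOME k. x = monomial E k) e) else 0 :: rat)" for x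
  have \<kappa>: "\<kappa> (monomial E k) = (\<lambda>e. if e \<in> E then of_int (k e) else 0)" for k
  proof -
    define l where "l = (SOME l. monomial E k = monomial E l)"
    have "monomial E k = monomial E l" unfolding l_def by (rule someI[of _ k], rule refl)
    then have "monomial E (\<lambda>e. k e + - l e) = \<one>"
      using EG monomial_add[OF EG, of k "\<lambda>e. - l e"] monomial_neg[OF EG, of l] by simp
    from indep[OF this] show ?thesis by (auto simp: \<kappa>_def l_def[symmetric] fun_eq_iff)
  qed
  have \<kappa>_mult: "\<kappa> (x \<otimes> y) = \<kappa> x + \<kappa> y" if "x \<in> generate G E" "y \<in> generate G E" for x y
  proof -
    obtain k where "x = monomial E k" by (rule generate_monomial[OF fE EG \<open>x \<in> _\<close>])
    moreover obtain l where "y = monomial E l" by (rule generate_monomial[OF fE EG \<open>y \<in> _\<close>])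
    ultimately show ?thesis by (simp add: monomial_add[OF EG, symmetric] \<kappa> fun_eq_iff)
  qed
  have \<kappa>_one: "\<kappa> \<one> = 0" using \<kappa>[of "\<lambda>_. 0"] by (simp add: monomial_zero fun_eq_iff)
  have TE: "T \<subseteq> generate G E" using T(2) by (auto intro: generate.incl)
  have inc: "generate G E \<subseteq> carrier G" by (rule generate_incl[OF EG])
  have span: "\<kappa> x \<in> V.span (\<kappa> ` T)" if "x \<in> generate G T" for x
    using that
  proof (induction rule: generate.induct)
    case one
    show ?case unfolding \<kappa>_one by (rule V.span_zero)
  next
    case (incl h)
    then show ?case by (intro V.span_base) auto
  next
    case (inv h)
    then have h: "h \<in> generate G E" "inv h \<in> generate G E"
      using TE generate_m_inv_closed[OF EG] by auto
    then have "\<kappa> (inv h) + \<kappa> h = 0"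
      using \<kappa>_mult[of "inv h" h] \<kappa>_one inc by (auto simp: subset_iff)
    then have neg: "\<kappa> (inv h) = - \<kappa> h" by (simp add: eq_neg_iff_add_eq_0)
    show ?case unfolding neg by (rule V.span_neg, rule V.span_base) (use inv in auto)
  next
    case (eng g h)
    then have eq: "\<kappa> (g \<otimes> h) = \<kappa> g + \<kappa> h" using \<kappa>_mult[of g h] T(2) by simp
    show ?case unfolding eq by (rule V.span_add) (use eng in auto)
  qed
  define \<delta> where "\<delta> e = (\<lambda>e'. if e' = e then 1 else 0 :: rat)" for e :: 'a
  have \<kappa>\<delta>: "\<kappa> e = \<delta> e" if "e \<in> E" for e
    using that \<kappa>[of "\<lambda>e'. if e' = e then 1 else 0"] monomial_single[OF fE EG that, of 1] EG
    by (auto simp: \<delta>_def fun_eq_iff int_pow_1 subset_iff)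
  have "\<not> V.dependent (\<delta> ` E)"
  proof
    assume "V.dependent (\<delta> ` E)"
    then obtain e where e: "e \<in> E" "\<delta> e \<in> V.span (\<delta> ` E - {\<delta> e})" unfolding V.dependent_def by blast
    have "V.span (\<delta> ` E - {\<delta> e}) \<subseteq> {f. f e = 0}"
      by (rule V.span_minimal) (auto intro!: V.subspaceI simp: \<delta>_def)
    with e(2) show False by (auto simp: \<delta>_def)
  qed
  moreover have "\<delta> ` E \<subseteq> V.span (\<kappa> ` T)"
    using span T(2) \<kappa>\<delta> by (auto intro: generate.incl simp flip: \<kappa>\<delta>)
  ultimately have "card (\<delta> ` E) \<le> card (\<kappa> ` T)"
    using V.independent_span_bound[OF finite_imageI[OF T(1)]] by blast
  moreover have "inj_on \<delta> E" by (rule inj_onI) (auto simp: \<delta>_def fun_eq_iff split: if_splits)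
  ultimately show ?thesis using card_image_le[OF T(1), of \<kappa>] by (simp add: card_image)
qed

text \<open>The rank bounds the size of free sets. In a largest one together with \<open>x\<close> there is a relation, and
  the exponent of \<open>x\<close> in it is not zero.\<close>

lemma free_generators_up_to_torsion:
  assumes "finite_rank G"
  obtains E where "free_on E" "\<And>x. x \<in> carrier G \<Longrightarrow> \<exists>m::nat. m > 0 \<and> x [^] m \<in> generate G E"
proof -
  obtain r where r': "\<forall>S. finite S \<and> S \<subseteq> carrier G \<longrightarrow>
      (\<exists>T. finite T \<and> card T \<le> r \<and> T \<subseteq> carrier G \<and> generate G T = generate G S)"
    using assms unfolding finite_rank_def ..
  note r = r'[rule_format, OF conjI]
  have bound: "card E \<le> r" if E: "free_on E" for E
  proof -
    obtain T where "finite T" "card T \<le> r" "generate G T = generate G E"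
      using r[of E] E unfolding free_on_def by blast
    then show ?thesis using free_on_card_le[OF E] by fastforce
  qed
  have "free_on {}" by (simp add: free_on_def)
  moreover have "\<forall>E. free_on E \<longrightarrow> card E < Suc r" using bound by (simp add: less_Suc_eq_le)
  ultimately obtain E where E: "free_on E" and max': "\<forall>F. free_on F \<longrightarrow> card F \<le> card E"
    using ex_has_greatest_nat[of free_on "{}" card "Suc r"] by metis
  note max = max'[rule_format]
  have fE: "finite E" and EG: "E \<subseteq> carrier G"
    and indep: "\<And>k e. monomial E k = \<one> \<Longrightarrow> e \<in> E \<Longrightarrow> k e = 0"
    using E unfolding free_on_def by blast+
  have "\<exists>m::nat. m > 0 \<and> x [^] m \<in> generate G E" if x: "x \<in> carrier G" for x
  proof (cases "x \<in> E")
    case True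
    then show ?thesis using x by (intro exI[of _ 1]) (auto intro: generate.incl)
  next
    case False
    then have "\<not> free_on (insert x E)" using max[of "insert x E"] fE by auto
    then obtain k where k: "monomial (insert x E) k = \<one>" "\<exists>e\<in>insert x E. k e \<noteq> 0"
      unfolding free_on_def using fE EG x by auto
    have "monomial (insert x E) k = x [^] k x \<otimes> monomial E k"
      unfolding monomial_def using fE EG x False by (subst finprod_insert) auto
    then have k': "x [^] k x \<otimes> monomial E k = \<one>" using k(1) by simp
    have kx: "k x \<noteq> 0"
    proof
      assume 0: "k x = 0"
      then have "monomial E k = \<one>" using k' EG by simp
      from indep[OF this] k(2) 0 show False by auto
    qed
    have gen: "x [^] k x \<in> generate G E"
    proof -
      have "x [^] k x = inv (monomial E k)" using k' EG x by (simp add: inv_equality)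
      then show ?thesis using generate_m_inv_closed[OF EG monomial_in_generate[OF fE EG]] by simp
    qed
    have "x [^] nat \<bar>k x\<bar> \<in> generate G E"
    proof (cases "k x > 0")
      case True
      then have n: "nat \<bar>k x\<bar> = nat (k x)" "\<not> k x < 0" by simp_all
      have eq: "x [^] k x = x [^] nat \<bar>k x\<bar>" unfolding n int_pow_def2 if_not_P[OF n(2)] ..
      show ?thesis using gen unfolding eq .
    next
      case False
      then have n: "nat \<bar>k x\<bar> = nat (- k x)" "k x < 0" using kx by simp_all
      have "x [^] k x = inv (x [^] nat \<bar>k x\<bar>)" unfolding n int_pow_def2 if_P[OF n(2)] ..
      then have eq: "x [^] nat \<bar>k x\<bar> = inv (x [^] k x)" using x by simp
      show ?thesis unfolding eq by (rule generate_m_inv_closed[OF EG gen])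
    qed
    then show ?thesis using kx by (intro exI[of _ "nat \<bar>k x\<bar>"]) auto
  qed
  then show ?thesis by (rule that[OF E])
qed

lemma monomial_nat_mult:
  assumes "E \<subseteq> carrier G"
  shows "monomial E (\<lambda>e. int n * k e) = monomial E k [^] n"
proof (induction n)
  case 0
  show ?case by (simp add: monomial_zero)
next
  case (Suc n)
  have "monomial E (\<lambda>e. int (Suc n) * k e) = monomial E (\<lambda>e. int n * k e + k e)"
    by (simp add: algebra_simps)
  then show ?case using Suc monomial_add[OF assms] by simp
qed

text \<open>The exponent of \<open>e0\<close> extends from the free subgroup to a rational coordinate on the whole
  group: divide the exponent in \<open>x [^] m\<close> by \<open>m\<close>.\<close>

lemma additive_function_exists:
  assumes E: "free_on E" and cof: "\<And>x. x \<in> carrier G \<Longrightarrow> \<exists>m::nat. m > 0 \<and> x [^] m \<in> generate G E"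
    and e0: "e0 \<in> E"
  shows "\<exists>f :: 'a \<Rightarrow> complex. (\<forall>x\<in>carrier G. \<forall>y\<in>carrier G. f (x \<otimes> y) = f x + f y) \<and> f e0 = 1"
proof -
  have fE: "finite E" and EG: "E \<subseteq> carrier G"
    and indep: "\<And>k e. monomial E k = \<one> \<Longrightarrow> e \<in> E \<Longrightarrow> k e = 0"
    using E unfolding free_on_def by blast+
  define R where "R x c \<longleftrightarrow> (\<exists>m k. m > 0 \<and> x [^] m = monomial E k \<and> c = of_int (k e0) / of_nat m)"
    for x and c :: complex
  have inj: "k e0 = l e0" if "monomial E k = monomial E l" for k l
  proof -
    have "monomial E (\<lambda>e. k e + - l e) = \<one>"
      using EG that monomial_add[OF EG, of k "\<lambda>e. - l e"] monomial_neg[OF EG, of l] by simp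
    from indep[OF this e0] show ?thesis by simp
  qed
  have ex: "\<exists>c. R x c" if x: "x \<in> carrier G" for x
  proof -
    obtain m :: nat where m: "m > 0" "x [^] m \<in> generate G E" using cof[OF x] by blast
    obtain k where "x [^] m = monomial E k" by (rule generate_monomial[OF fE EG m(2)])
    with m(1) show ?thesis unfolding R_def by blast
  qed
  have mult: "R (x \<otimes> y) (c + d)" if "R x c" "R y d" "x \<in> carrier G" "y \<in> carrier G" for x y c d
  proof -
    obtain m k where m: "m > 0" "x [^] m = monomial E k" "c = of_int (k e0) / of_nat m"
      using \<open>R x c\<close> unfolding R_def by blast
    obtain n l where n: "n > 0" "y [^] n = monomial E l" "d = of_int (l e0) / of_nat n"
      using \<open>R y d\<close> unfolding R_def by blast
    have "(x \<otimes> y) [^] (m * n) = (x [^] m) [^] n \<otimes> (y [^] n) [^] m"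
      using that by (simp add: nat_pow_distrib nat_pow_pow mult.commute)
    also have "\<dots> = monomial E (\<lambda>e. int n * k e + int m * l e)"
      unfolding m n by (simp add: monomial_add[OF EG] monomial_nat_mult[OF EG])
    moreover have "c + d = of_int (int n * k e0 + int m * l e0) / of_nat (m * n)"
      using m n by (simp add: field_simps)
    ultimately show ?thesis
      unfolding R_def using m(1) n(1)
      by (intro exI[of _ "m * n"] exI[of _ "\<lambda>e. int n * k e + int m * l e"]) simp
  qed
  have uniq: "c = d" if "R x c" "R x d" "x \<in> carrier G" for x c d
  proof -
    obtain m k where m: "m > 0" "x [^] m = monomial E k" "c = of_int (k e0) / of_nat m"
      using \<open>R x c\<close> unfolding R_def by blast
    obtain n l where n: "n > 0" "x [^] n = monomial E l" "d = of_int (l e0) / of_nat n"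
      using \<open>R x d\<close> unfolding R_def by blast
    have "(x [^] m) [^] n = (x [^] n) [^] m" using that by (simp add: nat_pow_pow mult.commute)
    then have "monomial E (\<lambda>e. int n * k e) = monomial E (\<lambda>e. int m * l e)"
      unfolding m n by (simp add: monomial_nat_mult[OF EG])
    then have "int n * k e0 = int m * l e0" by (rule inj)
    then have "of_int (int n * k e0) = (of_int (int m * l e0) :: complex)" by (rule arg_cong)
    moreover have "of_int (k e0) = c * of_nat m" "of_int (l e0) = d * of_nat n" using m n by auto
    ultimately have "of_nat (n * m) * c = of_nat (n * m) * d" by (simp add: ac_simps)
    then show ?thesis using m(1) n(1) by simp
  qed
  define f where "f x = (SOME c. R x c)" for x
  have Rf: "R x (f x)" if "x \<in> carrier G" for x using someI_ex[OF ex[OF that]] unfolding f_def .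
  have "f (x \<otimes> y) = f x + f y" if "x \<in> carrier G" "y \<in> carrier G" for x y
    using uniq[OF Rf mult[OF Rf Rf]] that by simp
  moreover have "R e0 1"
    unfolding R_def using e0 EG monomial_single[OF fE EG e0, of 1]
    by (intro exI[of _ 1] exI[of _ "\<lambda>e. if e = e0 then 1 else 0"]) (auto simp: int_pow_1 subset_iff)
  then have "f e0 = 1" using uniq[OF Rf] e0 EG by blast
  ultimately show ?thesis by blast
qed

end

section \<open>Lattices over a localization of the integers\<close>

text \<open>The localization of \<open>\<int>\<close> at the prime ideal of \<open>q\<close>, as a ring of complex numbers.\<close>

definition localized_ints :: "int \<Rightarrow> complex set"
  where "localized_ints q = {of_int a / of_int s | a s. \<not> q dvd s}"

lemma localized_intsI: "\<not> q dvd s \<Longrightarrow> of_int a / of_int s \<in> localized_ints q"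
  unfolding localized_ints_def by blast

lemma localized_intsE:
  assumes "x \<in> localized_ints q"
  obtains a s where "x = of_int a / of_int s" "\<not> q dvd s" "s \<noteq> 0"
  using assms unfolding localized_ints_def by auto

lemma of_int_localized_ints: "Factorial_Ring.prime q \<Longrightarrow> of_int a \<in> localized_ints q"
  using localized_intsI[of q 1 a] by (auto simp: not_prime_unit)

lemma localized_ints_add:
  assumes "Factorial_Ring.prime q" "x \<in> localized_ints q" "y \<in> localized_ints q"
  shows "x + y \<in> localized_ints q"
proof -
  obtain a s where a: "x = of_int a / of_int s" "\<not> q dvd s" "s \<noteq> 0" using assms(2) by (rule localized_intsE)
  obtain b t where b: "y = of_int b / of_int t" "\<not> q dvd t" "t \<noteq> 0" using assms(3) by (rule localized_intsE)
  have "x + y = of_int (a * t + b * s) / of_int (s * t)" using a b by (simp add: field_simps)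
  moreover have "\<not> q dvd s * t" using a b assms(1) by (simp add: prime_dvd_mult_iff)
  ultimately show ?thesis using localized_intsI by metis
qed

lemma localized_ints_mult:
  assumes "Factorial_Ring.prime q" "x \<in> localized_ints q" "y \<in> localized_ints q"
  shows "x * y \<in> localized_ints q"
proof -
  obtain a s where a: "x = of_int a / of_int s" "\<not> q dvd s" "s \<noteq> 0" using assms(2) by (rule localized_intsE)
  obtain b t where b: "y = of_int b / of_int t" "\<not> q dvd t" "t \<noteq> 0" using assms(3) by (rule localized_intsE)
  have "x * y = of_int (a * b) / of_int (s * t)" using a b by (simp add: field_simps)
  moreover have "\<not> q dvd s * t" using a b assms(1) by (simp add: prime_dvd_mult_iff)
  ultimately show ?thesis using localized_intsI by metis
qed

lemma localized_ints_one_minus_unit: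
  assumes "x \<in> localized_ints q"
  shows "1 - of_int q * x \<noteq> 0" "inverse (1 - of_int q * x) \<in> localized_ints q"
proof -
  obtain a s where a: "x = of_int a / of_int s" "\<not> q dvd s" "s \<noteq> 0" using assms by (rule localized_intsE)
  have d: "\<not> q dvd s - q * a" using a(2) by (simp add: dvd_diff_left_iff)
  then have nz: "s - q * a \<noteq> 0" by auto
  have eq: "1 - of_int q * x = of_int (s - q * a) / of_int s" using a by (simp add: field_simps)
  show "1 - of_int q * x \<noteq> 0" unfolding eq using nz a(3) by (simp del: of_int_diff)
  show "inverse (1 - of_int q * x) \<in> localized_ints q"
    unfolding eq inverse_divide by (rule localized_intsI[OF d])
qed

lemma of_rat_localized_ints:
  assumes "\<not> q dvd snd (quotient_of r)"
  shows "of_rat r \<in> localized_ints q"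
proof -
  have "r = of_int (fst (quotient_of r)) / of_int (snd (quotient_of r))"
    using quotient_of_div[of r] by (metis prod.collapse)
  then have "(of_rat r :: complex) = of_int (fst (quotient_of r)) / of_int (snd (quotient_of r))"
    by (metis of_rat_divide of_rat_of_int_eq)
  with localized_intsI[OF assms] show ?thesis by metis
qed

text \<open>The module generated by \<open>A\<close> over \<open>localized_ints q\<close>. Finite sums are built one term at a
  time, so that closure properties are inductions.\<close>

inductive_set qspan :: "int \<Rightarrow> complex set \<Rightarrow> complex set" for q A where
  zero: "0 \<in> qspan q A"
| step: "a \<in> localized_ints q \<Longrightarrow> w \<in> A \<Longrightarrow> z \<in> qspan q A \<Longrightarrow> a * w + z \<in> qspan q A"

lemma qspan_add:
  assumes "x \<in> qspan q A" "y \<in> qspan q A"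
  shows "x + y \<in> qspan q A"
  using assms(1)
proof induction
  case (step a w z)
  then show ?case using qspan.step[of a q w A "z + y"] by (simp add: add.assoc)
qed (simp add: assms)

lemma qspan_mult_image:
  assumes "Factorial_Ring.prime q" "z \<in> qspan q A" "\<And>w. w \<in> A \<Longrightarrow> t * w \<in> qspan q B"
  shows "t * z \<in> qspan q B"
  using assms(2)
proof induction
  case (step a w z)
  have "a * x \<in> qspan q B" if "x \<in> qspan q B" for x
    using that
  proof induction
    case (step b w z)
    then show ?case
      using qspan.step[OF localized_ints_mult[OF assms(1) \<open>a \<in> localized_ints q\<close> step(1)] step(2,4)]
      by (simp add: algebra_simps)
  qed (simp add: qspan.zero)
  from this[OF assms(3)[OF step(2)]] have "a * (t * w) + t * z \<in> qspan q B"
    using step(4) by (rule qspan_add)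
  then show ?case by (simp add: algebra_simps)
qed (simp add: qspan.zero)

lemma qspan_base:
  assumes "Factorial_Ring.prime q" "w \<in> A"
  shows "w \<in> qspan q A"
  using qspan.step[OF of_int_localized_ints[OF assms(1), of 1] assms(2) qspan.zero] by simp

lemma qspan_scale:
  assumes "Factorial_Ring.prime q" "a \<in> localized_ints q" "z \<in> qspan q A"
  shows "a * z \<in> qspan q A"
  using assms(3)
proof (rule qspan_mult_image[OF assms(1)])
  fix w assume "w \<in> A"
  from qspan.step[OF assms(2) this qspan.zero] show "a * w \<in> qspan q A" by simp
qed

lemma qspan_minimal:
  assumes "Factorial_Ring.prime q" "z \<in> qspan q A" "\<And>w. w \<in> A \<Longrightarrow> w \<in> qspan q B"
  shows "z \<in> qspan q B"
  using qspan_mult_image[OF assms(1,2), of 1 B] assms(3) by simp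

lemma qspan_finite_support:
  assumes "z \<in> qspan q A"
  obtains F where "finite F" "F \<subseteq> A" "z \<in> qspan q F"
proof -
  have "\<exists>F. finite F \<and> F \<subseteq> A \<and> z \<in> qspan q F"
    using assms
  proof induction
    case zero
    show ?case by (rule exI[of _ "{}"]) (simp add: qspan.zero)
  next
    case (step a w z)
    then obtain F where F: "finite F" "F \<subseteq> A" "z \<in> qspan q F" by blast
    have "z' \<in> qspan q (insert w F)" if "z' \<in> qspan q F" for z'
      using that by induction (auto intro: qspan.intros)
    then show ?case using F step by (intro exI[of _ "insert w F"]) (auto intro: qspan.step)
  qed
  then show ?thesis using that by blast
qed

text \<open>Nakayama's lemma for a torsion-free module that is divisible by \<open>q\<close>: write \<open>w / q\<close> in terms of
  the generators. Since \<open>1 - q a\<close> is a unit of the localization, \<open>w\<close> can be expressed through the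
  other generators and removed.\<close>

lemma qspan_nakayama:
  assumes q: "Factorial_Ring.prime q" and "finite W" "\<And>w. w \<in> W \<Longrightarrow> w / of_int q \<in> qspan q W"
  shows "W \<subseteq> {0}"
  using assms(2,3)
proof (induction W)
  case (insert w W)
  have q0: "(of_int q :: complex) \<noteq> 0" using q by auto
  have split: "\<exists>a\<in>localized_ints q. \<exists>z'\<in>qspan q W. z = a * w + z'" if "z \<in> qspan q (insert w W)" for z
    using that
  proof induction
    case zero
    show ?case
      using of_int_localized_ints[OF q, of 0] by (intro bexI[of _ 0]) (auto intro: qspan.zero)
  next
    case (step b v z)
    then obtain a z' where z: "a \<in> localized_ints q" "z' \<in> qspan q W" "z = a * w + z'" by blast
    show ?case
    proof (cases "v = w")
      case True
      then show ?thesis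
        using z localized_ints_add[OF q step(1) z(1)]
        by (intro bexI[of _ "b + a"] bexI[of _ z']) (auto simp: algebra_simps)
    next
      case False
      then show ?thesis
        using z step(1,2) qspan.step[OF step(1) _ z(2), of v]
        by (intro bexI[OF _ z(1)] bexI[of _ "b * v + z'"]) (auto simp: algebra_simps)
    qed
  qed
  obtain a z where a: "a \<in> localized_ints q" "z \<in> qspan q W" "w / of_int q = a * w + z"
    using split[OF insert(4)[of w]] by blast
  have "(1 - of_int q * a) * w = of_int q * z"
    using a(3) q0 by (simp add: field_simps)
  then have "w = inverse (1 - of_int q * a) * of_int q * z"
    using localized_ints_one_minus_unit(1)[OF a(1)] by (simp add: field_simps)
  then have wW: "w \<in> qspan q W"
    using qspan_scale[OF q localized_ints_mult[OF q localized_ints_one_minus_unit(2)[OF a(1)]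
          of_int_localized_ints[OF q]] a(2)] by simp
  have "W \<subseteq> {0}"
  proof (rule insert(3))
    fix v assume "v \<in> W"
    then have "v / of_int q \<in> qspan q (insert w W)" using insert(4) by blast
    then show "v / of_int q \<in> qspan q W"
      by (rule qspan_minimal[OF q]) (use wW qspan_base[OF q] in auto)
  qed
  moreover have "z = 0" if "z \<in> qspan q W" for z
    using that \<open>W \<subseteq> {0}\<close> by induction auto
  ultimately show ?case using wW by auto
qed simp

definition lattice_stabilizer :: "int \<Rightarrow> complex set \<Rightarrow> complex set"
  where "lattice_stabilizer q P = {t. \<forall>p\<in>P. t * p \<in> qspan q P}"

lemma lattice_stabilizer_one: "Factorial_Ring.prime q \<Longrightarrow> 1 \<in> lattice_stabilizer q P"
  by (auto simp: lattice_stabilizer_def qspan_base)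

lemma lattice_stabilizer_mult:
  assumes "Factorial_Ring.prime q" "s \<in> lattice_stabilizer q P" "t \<in> lattice_stabilizer q P"
  shows "s * t \<in> lattice_stabilizer q P"
  unfolding lattice_stabilizer_def
proof clarify
  fix p assume "p \<in> P"
  then have "t * p \<in> qspan q P" using assms by (auto simp: lattice_stabilizer_def)
  then have "s * (t * p) \<in> qspan q P"
    by (rule qspan_mult_image[OF assms(1)]) (use assms in \<open>auto simp: lattice_stabilizer_def\<close>)
  then show "s * t * p \<in> qspan q P" by (simp add: mult.assoc)
qed

text \<open>The products \<open>t ^ i * p\<close> with \<open>i < k\<close> form the larger set. The hypothesis covers two cases:
  \<open>t\<close> is integral, and a power of \<open>t\<close> stabilizes the lattice already.\<close>

lemma lattice_stabilizer_adjoin: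
  assumes q: "Factorial_Ring.prime q" and P: "finite P"
    and k: "k > 0" "\<And>p. p \<in> P \<Longrightarrow> t ^ k * p \<in> qspan q {t ^ i * p' | i p'. i < k \<and> p' \<in> P}"
  obtains P' where "finite P'" "P \<subseteq> P'" "t \<in> lattice_stabilizer q P'" "lattice_stabilizer q P \<subseteq> lattice_stabilizer q P'"
proof -
  define P' where "P' = {t ^ i * p' | i p'. i < k \<and> p' \<in> P}"
  have "P' = (\<lambda>(i, p). t ^ i * p) ` ({..<k} \<times> P)" by (auto simp: P'_def)
  then have fin: "finite P'" using P by simp
  have mem: "t ^ i * p \<in> P'" if "i < k" "p \<in> P" for i p using that by (auto simp: P'_def)
  have "P \<subseteq> P'" using mem[of 0] k by auto
  moreover have "t \<in> lattice_stabilizer q P'"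
    unfolding lattice_stabilizer_def
  proof clarify
    fix x assume "x \<in> P'"
    then obtain i p where x: "x = t ^ i * p" "i < k" "p \<in> P" by (auto simp: P'_def)
    show "t * x \<in> qspan q P'"
    proof (cases "Suc i < k")
      case True
      then show ?thesis using qspan_base[OF q mem[OF True x(3)]] x by (simp add: mult.assoc)
    next
      case False
      then have "Suc i = k" using x by simp
      then have "t * x = t ^ k * p" using x by (auto simp: mult.assoc)
      then show ?thesis using k(2)[OF x(3)] by (simp add: P'_def)
    qed
  qed
  moreover have "lattice_stabilizer q P \<subseteq> lattice_stabilizer q P'"
  proof
    fix s assume s: "s \<in> lattice_stabilizer q P"
    have "s * x \<in> qspan q P'" if x': "x \<in> P'" for x
    proof -
      obtain i p where x: "x = t ^ i * p" "i < k" "p \<in> P" using x' by (auto simp: P'_def)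
      have "s * p \<in> qspan q P" using s x by (auto simp: lattice_stabilizer_def)
      then have "t ^ i * (s * p) \<in> qspan q P'"
        by (rule qspan_mult_image[OF q]) (use x mem in \<open>auto intro: qspan_base[OF q]\<close>)
      then show ?thesis by (simp add: x mult.left_commute)
    qed
    then show "s \<in> lattice_stabilizer q P'" by (simp add: lattice_stabilizer_def)
  qed
  ultimately show ?thesis using that fin by blast
qed

text \<open>The number \<open>t\<close> is a root of a monic polynomial with coefficients in the localization.\<close>

definition integral_at :: "int \<Rightarrow> complex \<Rightarrow> bool"
  where "integral_at q t \<longleftrightarrow> (\<exists>k>0. t ^ k \<in> qspan q {t ^ i | i. i < k})"

lemma lattice_stabilizer_integral:
  assumes q: "Factorial_Ring.prime q" and "finite T" "\<And>t. t \<in> T \<Longrightarrow> integral_at q t"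
  obtains P where "finite P" "1 \<in> P" "T \<subseteq> lattice_stabilizer q P"
proof -
  have "\<exists>P. finite P \<and> 1 \<in> P \<and> T \<subseteq> lattice_stabilizer q P"
    using assms(2,3)
  proof (induction T)
    case empty
    show ?case by (rule exI[of _ "{1}"]) simp
  next
    case (insert t T)
    then obtain P where P: "finite P" "1 \<in> P" "T \<subseteq> lattice_stabilizer q P" by blast
    obtain k where k: "k > 0" "t ^ k \<in> qspan q {t ^ i | i. i < k}"
      using insert(4)[of t] unfolding integral_at_def by blast
    have "t ^ k * p \<in> qspan q {t ^ i * p' | i p'. i < k \<and> p' \<in> P}" if "p \<in> P" for p
    proof -
      have "p * t ^ k \<in> qspan q {t ^ i * p' | i p'. i < k \<and> p' \<in> P}"
        by (rule qspan_mult_image[OF q k(2)])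
           (use that in \<open>force intro!: qspan_base[OF q] simp: mult.commute\<close>)
      then show ?thesis by (simp add: mult.commute)
    qed
    from lattice_stabilizer_adjoin[OF q P(1) k(1) this]
    obtain P' where "finite P'" "P \<subseteq> P'" "t \<in> lattice_stabilizer q P'" "lattice_stabilizer q P \<subseteq> lattice_stabilizer q P'" .
    then show ?case using P by blast
  qed
  then show ?thesis using that by blast
qed

lemma lattice_stabilizer_roots:
  assumes q: "Factorial_Ring.prime q" and P: "finite P" and "finite T"
    and "\<And>t. t \<in> T \<Longrightarrow> \<exists>m>0. t ^ m \<in> lattice_stabilizer q P"
  obtains P' where "finite P'" "P \<subseteq> P'" "T \<subseteq> lattice_stabilizer q P'"
proof -
  have "\<exists>P'. finite P' \<and> P \<subseteq> P' \<and> lattice_stabilizer q P \<subseteq> lattice_stabilizer q P' \<and> T \<subseteq> lattice_stabilizer q P'"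
    using assms(3,4)
  proof (induction T)
    case empty
    show ?case using P by blast
  next
    case (insert t T)
    then obtain P' where P': "finite P'" "P \<subseteq> P'" "lattice_stabilizer q P \<subseteq> lattice_stabilizer q P'"
      "T \<subseteq> lattice_stabilizer q P'" by auto
    obtain m where m: "m > 0" "t ^ m \<in> lattice_stabilizer q P'" using insert(4)[of t] P'(3) by blast
    have "t ^ m * p \<in> qspan q {t ^ i * p' | i p'. i < m \<and> p' \<in> P'}" if "p \<in> P'" for p
    proof (rule qspan_minimal[OF q])
      show "t ^ m * p \<in> qspan q P'" using m(2) that by (auto simp: lattice_stabilizer_def)
      show "w \<in> qspan q {t ^ i * p' | i p'. i < m \<and> p' \<in> P'}" if "w \<in> P'" for w
        using that m(1) by (intro qspan_base[OF q]) force
    qed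
    from lattice_stabilizer_adjoin[OF q P'(1) m(1) this]
    obtain P'' where "finite P''" "P' \<subseteq> P''" "t \<in> lattice_stabilizer q P''" "lattice_stabilizer q P' \<subseteq> lattice_stabilizer q P''" .
    then show ?case using P' by blast
  qed
  then show ?thesis using that by blast
qed

text \<open>The assumption on \<open>Y\<close> says that each of its elements has a power in the monoid generated by the
  integral elements \<open>E\<close>. Finitely many elements of \<open>Y\<close> occur in the equations for the quotients
  \<open>l / q\<close>; together with \<open>E\<close> they stabilize a finitely generated lattice \<open>P'\<close>. Then the lattice
  generated by \<open>P'\<close> and \<open>L\<close> is divisible by \<open>q\<close>, and Nakayama's lemma applies.\<close>

theorem finitely_generated_not_divisible:
  assumes q: "Factorial_Ring.prime q" and L: "finite L" and E: "finite E" "\<And>e. e \<in> E \<Longrightarrow> integral_at q e"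
    and roots: "\<And>x S. x \<in> Y \<Longrightarrow> E \<subseteq> S \<Longrightarrow> 1 \<in> S \<Longrightarrow> (\<And>a b. a \<in> S \<Longrightarrow> b \<in> S \<Longrightarrow> a * b \<in> S) \<Longrightarrow>
      \<exists>m>0. x ^ m \<in> S"
    and div: "\<And>l. l \<in> L \<Longrightarrow> l / of_int q \<in> qspan q {x * l' | x l'. x \<in> Y \<and> l' \<in> L}"
  shows "L \<subseteq> {0}"
proof -
  let ?A = "\<lambda>Y. {x * l' | x l'. x \<in> Y \<and> l' \<in> L}"
  have "\<exists>F. finite F \<and> F \<subseteq> Y \<and> l / of_int q \<in> qspan q (?A F)" if l: "l \<in> L" for l
  proof -
    obtain B where B: "finite B" "B \<subseteq> ?A Y" "l / of_int q \<in> qspan q B"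
      using qspan_finite_support[OF div[OF l]] .
    have "\<forall>b\<in>B. \<exists>x. x \<in> Y \<and> (\<exists>l'\<in>L. b = x * l')" using B(2) by blast
    then obtain x where x: "\<And>b. b \<in> B \<Longrightarrow> x b \<in> Y \<and> (\<exists>l'\<in>L. b = x b * l')" by metis
    have "B \<subseteq> ?A (x ` B)" using x by blast
    then have "l / of_int q \<in> qspan q (?A (x ` B))"
      by (intro qspan_minimal[OF q B(3)]) (auto intro: qspan_base[OF q])
    then show ?thesis using B(1) x by (intro exI[of _ "x ` B"]) auto
  qed
  then have "\<forall>l\<in>L. \<exists>F. finite F \<and> F \<subseteq> Y \<and> l / of_int q \<in> qspan q (?A F)" ..
  from bchoice[OF this] obtain F where
    F': "\<forall>l\<in>L. finite (F l) \<and> F l \<subseteq> Y \<and> l / of_int q \<in> qspan q (?A (F l))" ..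
  note F = F'[rule_format]
  define T where "T = (\<Union>l\<in>L. F l)"
  have T: "finite T" "T \<subseteq> Y" using F L by (auto simp: T_def)
  have divT: "l / of_int q \<in> qspan q (?A T)" if "l \<in> L" for l
  proof (rule qspan_minimal[OF q])
    show "l / of_int q \<in> qspan q (?A (F l))" using F[OF that] by blast
    show "w \<in> qspan q (?A T)" if "w \<in> ?A (F l)" for w
      using that \<open>l \<in> L\<close> by (intro qspan_base[OF q]) (auto simp: T_def)
  qed
  obtain P where P: "finite P" "1 \<in> P" "E \<subseteq> lattice_stabilizer q P"
    using lattice_stabilizer_integral[OF q E] .
  have "\<exists>m>0. t ^ m \<in> lattice_stabilizer q P" if "t \<in> T" for t
    by (rule roots) (use that T P lattice_stabilizer_one[OF q] lattice_stabilizer_mult[OF q] in auto)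
  then obtain P' where P': "finite P'" "P \<subseteq> P'" "T \<subseteq> lattice_stabilizer q P'"
    using lattice_stabilizer_roots[OF q P(1) T(1)] by metis
  define W where "W = {p * l | p l. p \<in> P' \<and> l \<in> L}"
  have "W = (\<lambda>(p, l). p * l) ` (P' \<times> L)" by (auto simp: W_def)
  then have "finite W" using P'(1) L by simp
  then have "W \<subseteq> {0}"
  proof (rule qspan_nakayama[OF q])
    fix w assume "w \<in> W"
    then obtain p l where w: "w = p * l" "p \<in> P'" "l \<in> L" by (auto simp: W_def)
    have "p * (l / of_int q) \<in> qspan q W"
    proof (rule qspan_mult_image[OF q divT[OF w(3)]])
      fix v assume "v \<in> ?A T"
      then obtain x l' where v: "v = x * l'" "x \<in> T" "l' \<in> L" by blast
      have "x * p \<in> qspan q P'" using P'(3) v(2) w(2) by (auto simp: lattice_stabilizer_def)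
      then have "l' * (x * p) \<in> qspan q W"
        by (rule qspan_mult_image[OF q])
           (use v(3) in \<open>auto simp: W_def mult.commute intro!: qspan_base[OF q]\<close>)
      then show "p * v \<in> qspan q W" by (simp add: v ac_simps)
    qed
    then show "w / of_int q \<in> qspan q W" by (simp add: w)
  qed
  moreover have "L \<subseteq> W" using P P'(2) unfolding W_def
    by (smt (verit) mem_Collect_eq mult_1 subset_iff)
  ultimately show ?thesis by blast
qed

section \<open>Minimal normal subgroups are finite\<close>

lemma (in group) conj_hom:
  assumes "g \<in> carrier G"
  shows "(\<lambda>x. g \<otimes> x \<otimes> inv g) \<in> hom G G"
proof (rule homI)
  fix x y assume "x \<in> carrier G" "y \<in> carrier G"
  then have "g \<otimes> x \<otimes> inv g \<otimes> (g \<otimes> y \<otimes> inv g) = g \<otimes> x \<otimes> (inv g \<otimes> g) \<otimes> y \<otimes> inv g"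
    using assms by (simp only: m_assoc m_closed inv_closed)
  then show "g \<otimes> (x \<otimes> y) \<otimes> inv g = g \<otimes> x \<otimes> inv g \<otimes> (g \<otimes> y \<otimes> inv g)"
    using assms \<open>x \<in> _\<close> \<open>y \<in> _\<close> by (simp add: m_assoc)
qed (use assms in simp)

lemma (in group) conj_nat_pow:
  assumes "g \<in> carrier G" "x \<in> carrier G"
  shows "(g \<otimes> x \<otimes> inv g) [^] (n::nat) = g \<otimes> x [^] n \<otimes> inv g"
proof -
  interpret c: group_hom G G "\<lambda>x. g \<otimes> x \<otimes> inv g" by unfold_locales (rule conj_hom[OF assms(1)])
  show ?thesis using c.hom_nat_pow[OF assms(2), of n] by simp
qed

text \<open>The derived subgroup of \<open>M\<close> is normal in \<open>G\<close> and, by solubility, smaller than \<open>M\<close>.\<close>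

lemma (in group) solvable_minimal_normal_commutes:
  assumes sol: "solvable G" and M: "minimal_normal G M" and xy: "x \<in> M" "y \<in> M"
  shows "x \<otimes> y = y \<otimes> x"
proof -
  have n: "M \<lhd> G" and nt: "M \<noteq> {\<one>}" and min: "\<And>H. H \<lhd> G \<Longrightarrow> H \<subseteq> M \<Longrightarrow> H = {\<one>} \<or> H = M"
    using M unfolding minimal_normal_def by auto
  interpret N: normal M G by fact
  have "derived G M \<noteq> M"
  proof
    assume d: "derived G M = M"
    obtain k where "(derived G ^^ k) M = {\<one>}"
      using solvable_imp_trivial_derived_seq[OF solvable_subgroup[OF N.subgroup_axioms sol]] by blast
    moreover have "(derived G ^^ k) M = M" for k by (induction k) (auto simp: d)
    ultimately show False using nt by simp
  qed
  then have "derived G M = {\<one>}"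
    using min[OF derived_is_normal[OF n] derived_incl[OF order.refl N.subgroup_axioms]] by blast
  moreover have "x \<otimes> y \<otimes> inv x \<otimes> inv y \<in> derived G M"
    unfolding derived_def using xy by (intro generate.incl) blast
  ultimately have "x \<otimes> y \<otimes> inv x \<otimes> inv y = \<one>" by blast
  then have "x \<otimes> y \<otimes> inv x \<otimes> inv y \<otimes> y \<otimes> x = y \<otimes> x" using xy by simp
  then show ?thesis using xy by (simp add: m_assoc)
qed

lemma (in group) normal_comm_groupI:
  assumes "subgroup M G" "\<And>x y. x \<in> M \<Longrightarrow> y \<in> M \<Longrightarrow> x \<otimes> y = y \<otimes> x"
  shows "comm_group (G\<lparr>carrier := M\<rparr>)"
  using group.group_comm_groupI[OF subgroup_imp_group[OF assms(1)]] assms(2) by simp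

lemma (in group) powers_normal:
  assumes M: "M \<lhd> G" and comm: "\<And>x y. x \<in> M \<Longrightarrow> y \<in> M \<Longrightarrow> x \<otimes> y = y \<otimes> x"
  shows "{x \<in> M. x [^] (n::nat) = \<one>} \<lhd> G" (is "?T \<lhd> G")
    and "(\<lambda>x. x [^] n) ` M \<lhd> G" (is "?P \<lhd> G")
proof -
  interpret N: normal M G by fact
  have pd: "(x \<otimes> y) [^] n = x [^] n \<otimes> y [^] n" if "x \<in> M" "y \<in> M" for x y
    using pow_mult_distrib[OF comm[OF that]] that by simp
  have pinv: "inv x [^] n = inv (x [^] n)" if "x \<in> M" for x using that by (simp add: nat_pow_inv)
  have pM: "x [^] n \<in> M" if "x \<in> M" for x
    using that by (induction n) auto
  have cM: "g \<otimes> x \<otimes> inv g \<in> M" if "g \<in> carrier G" "x \<in> M" for g x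
    using N.inv_op_closed2 that by blast
  show "?T \<lhd> G"
  proof (rule normal_invI)
    show "subgroup ?T G"
    proof
      show "x \<otimes> y \<in> ?T" if "x \<in> ?T" "y \<in> ?T" for x y using that pd by auto
      show "inv x \<in> ?T" if "x \<in> ?T" for x using that pinv by auto
    qed auto
    show "g \<otimes> h \<otimes> inv g \<in> ?T" if "h \<in> ?T" "g \<in> carrier G" for g h
      using that cM by (auto simp: conj_nat_pow)
  qed
  show "?P \<lhd> G"
  proof (rule normal_invI)
    show "subgroup ?P G"
    proof
      show "?P \<subseteq> carrier G" by (rule image_subsetI) (rule N.mem_carrier, rule pM)
      show "\<one> \<in> ?P" by (rule image_eqI[of _ _ \<one>]) auto
      show "inv x \<in> ?P" if x: "x \<in> ?P" for x
      proof -
        obtain y where "y \<in> M" "x = y [^] n" using x by blast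
        then show ?thesis using pinv by (intro image_eqI[of _ _ "inv y"]) auto
      qed
      show "x \<otimes> y \<in> ?P" if x: "x \<in> ?P" and y: "y \<in> ?P" for x y
      proof -
        obtain u v where "u \<in> M" "x = u [^] n" "v \<in> M" "y = v [^] n" using x y by blast
        then show ?thesis using pd by (intro image_eqI[of _ _ "u \<otimes> v"]) auto
      qed
    qed
    show "g \<otimes> h \<otimes> inv g \<in> ?P" if "h \<in> ?P" "g \<in> carrier G" for g h
    proof -
      obtain x where x: "x \<in> M" "h = x [^] n" using \<open>h \<in> ?P\<close> by blast
      then have "g \<otimes> h \<otimes> inv g = (g \<otimes> x \<otimes> inv g) [^] n" using that by (simp add: conj_nat_pow)
      then show ?thesis using cM[OF that(2) x(1)] by blast
    qed
  qed
qed

abbreviation (input) fun_scale :: "complex \<Rightarrow> ('g \<Rightarrow> complex) \<Rightarrow> 'g \<Rightarrow> complex"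
  where "fun_scale \<equiv> \<lambda>c f x. c * f x"

lemma vector_space_fun_scale: "vector_space fun_scale"
  by unfold_locales (auto simp: fun_eq_iff algebra_simps)

locale torsion_free_normal = group G for G (structure) +
  fixes M
  assumes M_normal: "M \<lhd> G"
    and M_comm: "\<And>x y. x \<in> M \<Longrightarrow> y \<in> M \<Longrightarrow> x \<otimes> y = y \<otimes> x"
    and M_torsion_free: "\<And>x n. x \<in> M \<Longrightarrow> n > 0 \<Longrightarrow> x [^] (n::nat) = \<one> \<Longrightarrow> x = \<one>"
    and M_nontrivial: "M \<noteq> {\<one>}"
    and finite_rank: "finite_rank G"
begin

sublocale N: normal M G by (rule M_normal)

lemma M_comm_group: "comm_group (G\<lparr>carrier := M\<rparr>)"
  by (rule normal_comm_groupI[OF N.subgroup_axioms M_comm])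

text \<open>The space \<open>Hom(M, \<complex>)\<close>. Extension by zero makes it a subspace of a function space.\<close>

definition additive_maps :: "('a \<Rightarrow> complex) set"
  where "additive_maps = {f. (\<forall>x\<in>M. \<forall>y\<in>M. f (x \<otimes> y) = f x + f y) \<and> (\<forall>x. x \<notin> M \<longrightarrow> f x = 0)}"

definition translate :: "'a \<Rightarrow> ('a \<Rightarrow> complex) \<Rightarrow> 'a \<Rightarrow> complex"
  where "translate g f = (\<lambda>m. if m \<in> M then f (inv g \<otimes> m \<otimes> g) else 0)"

lemma conj_closed: "g \<in> carrier G \<Longrightarrow> m \<in> M \<Longrightarrow> inv g \<otimes> m \<otimes> g \<in> M"
  by (rule N.inv_op_closed1)

lemma conj_mult:
  assumes "g \<in> carrier G" "x \<in> carrier G" "y \<in> carrier G"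
  shows "inv g \<otimes> (x \<otimes> y) \<otimes> g = (inv g \<otimes> x \<otimes> g) \<otimes> (inv g \<otimes> y \<otimes> g)"
  using hom_mult[OF conj_hom[of "inv g"], of x y] assms by simp

lemma conj_conj:
  assumes "g \<in> carrier G" "h \<in> carrier G" "x \<in> carrier G"
  shows "inv (g \<otimes> h) \<otimes> x \<otimes> (g \<otimes> h) = inv h \<otimes> (inv g \<otimes> x \<otimes> g) \<otimes> h"
  using assms by (simp add: inv_mult_group m_assoc)

lemma additive_maps_one: "f \<in> additive_maps \<Longrightarrow> f \<one> = 0"
proof -
  assume "f \<in> additive_maps"
  then have "f (\<one> \<otimes> \<one>) = f \<one> + f \<one>" unfolding additive_maps_def using N.one_closed by blast
  then show ?thesis by simp
qed

lemma additive_maps_inv: "f \<in> additive_maps \<Longrightarrow> x \<in> M \<Longrightarrow> f (inv x) = - f x"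
proof -
  assume f: "f \<in> additive_maps" and x: "x \<in> M"
  then have "f (inv x \<otimes> x) = f (inv x) + f x" unfolding additive_maps_def using N.m_inv_closed by blast
  then show ?thesis using additive_maps_one[OF f] x by (simp add: eq_neg_iff_add_eq_0)
qed

lemma M_nat_pow: "x \<in> M \<Longrightarrow> x [^] (n::nat) \<in> M"
  by (induction n) auto

lemma additive_maps_pow: "f \<in> additive_maps \<Longrightarrow> x \<in> M \<Longrightarrow> f (x [^] (n::nat)) = of_nat n * f x"
proof (induction n)
  case 0
  then show ?case by (simp add: additive_maps_one)
next
  case (Suc n)
  have "f (x [^] n \<otimes> x) = f (x [^] n) + f x"
    using Suc.prems M_nat_pow unfolding additive_maps_def by blast
  then show ?case using Suc by (simp add: algebra_simps)
qed

lemma M_generators: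
  obtains E where "comm_group.free_on (G\<lparr>carrier := M\<rparr>) E" "finite E" "E \<subseteq> M" "E \<noteq> {}"
    "\<forall>x\<in>M. \<exists>m::nat. m > 0 \<and> x [^] m \<in> generate G E"
proof -
  interpret A: comm_group "G\<lparr>carrier := M\<rparr>" by (rule M_comm_group)
  obtain E where E: "A.free_on E"
    and cof: "\<And>x. x \<in> M \<Longrightarrow> \<exists>m::nat. m > 0 \<and> x [^]\<^bsub>G\<lparr>carrier := M\<rparr>\<^esub> m \<in> generate (G\<lparr>carrier := M\<rparr>) E"
    using A.free_generators_up_to_torsion[OF finite_rank_subgroup[OF group_axioms finite_rank N.subgroup_axioms]]
    by auto
  have EM: "finite E" "E \<subseteq> M" using E unfolding A.free_on_def by auto
  have cof': "\<exists>m::nat. m > 0 \<and> x [^] m \<in> generate G E" if "x \<in> M" for x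
    using cof[OF that] unfolding generate_consistent[OF EM(2) N.subgroup_axioms]
    by (simp add: nat_pow_def)
  moreover have "E \<noteq> {}"
  proof
    assume "E = {}"
    then have "x = \<one>" if "x \<in> M" for x
      using cof'[OF that] M_torsion_free[OF that] by (auto simp: generate_empty)
    then show False using M_nontrivial N.one_closed by blast
  qed
  ultimately show ?thesis by (intro that[OF E EM]) blast+
qed

text \<open>The complex numbers are torsion-free, so the values on \<open>E\<close> determine all others.\<close>

lemma additive_map_eq_zero:
  assumes E: "E \<subseteq> M" "\<And>x. x \<in> M \<Longrightarrow> \<exists>m::nat. m > 0 \<and> x [^] m \<in> generate G E"
    and f: "f \<in> additive_maps" and z: "\<And>e. e \<in> E \<Longrightarrow> f e = 0"
  shows "f = 0"
proof -
  have EG: "E \<subseteq> carrier G" using E(1) by auto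
  have gM: "generate G E \<subseteq> M" by (rule generate_subgroup_incl[OF E(1) N.subgroup_axioms])
  have gen: "f x = 0" if "x \<in> generate G E" for x
    using that
  proof (induction rule: generate.induct)
    case (eng x y)
    then have "x \<in> M" "y \<in> M" using gM by auto
    then show ?case using f eng unfolding additive_maps_def by auto
  qed (use z E(1) f in \<open>auto simp: additive_maps_one additive_maps_inv\<close>)
  have "f x = 0" for x
  proof (cases "x \<in> M")
    case True
    then obtain m :: nat where m: "m > 0" "x [^] m \<in> generate G E" using E(2) by blast
    have "of_nat m * f x = 0" using gen[OF m(2)] additive_maps_pow[OF f True] by simp
    with m(1) show ?thesis by simp
  next
    case False
    then show ?thesis using f by (simp add: additive_maps_def)
  qed
  then show ?thesis by (simp add: fun_eq_iff)
qed

lemma additive_maps_nonzero: "additive_maps \<noteq> {0}"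
proof -
  interpret A: comm_group "G\<lparr>carrier := M\<rparr>" by (rule M_comm_group)
  obtain E where E: "A.free_on E" "finite E" "E \<subseteq> M" "E \<noteq> {}"
    and cof': "\<forall>x\<in>M. \<exists>m::nat. m > 0 \<and> x [^] m \<in> generate G E"
    by (rule M_generators)
  note cof = cof'[rule_format]
  obtain e where e: "e \<in> E" using E(4) by blast
  have cof': "\<exists>m::nat. m > 0 \<and> x [^]\<^bsub>G\<lparr>carrier := M\<rparr>\<^esub> m \<in> generate (G\<lparr>carrier := M\<rparr>) E"
    if "x \<in> carrier (G\<lparr>carrier := M\<rparr>)" for x
    using cof[of x] that unfolding generate_consistent[OF E(3) N.subgroup_axioms]
    by (simp add: nat_pow_def)
  have "\<exists>f :: 'a \<Rightarrow> complex. (\<forall>x\<in>M. \<forall>y\<in>M. f (x \<otimes> y) = f x + f y) \<and> f e = 1"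
    using A.additive_function_exists[OF E(1) cof' e] by simp
  then obtain f :: "'a \<Rightarrow> complex" where f: "\<forall>x\<in>M. \<forall>y\<in>M. f (x \<otimes> y) = f x + f y" "f e = 1"
    by blast
  let ?f = "\<lambda>x. if x \<in> M then f x else 0"
  have "?f \<in> additive_maps" using f(1) by (auto simp: additive_maps_def)
  moreover have "?f e \<noteq> 0" using f(2) e E(3) by auto
  then have "?f \<noteq> 0" using fun_cong[of ?f 0 e] by (simp only: zero_fun_apply) blast
  ultimately show ?thesis by blast
qed

lemma additive_maps_subspace: "module.subspace fun_scale additive_maps"
proof -
  interpret vector_space fun_scale by (rule vector_space_fun_scale)
  show ?thesis by (rule subspaceI) (auto simp: additive_maps_def algebra_simps)
qed

lemma additive_maps_fin_dim: "fin_dim fun_scale additive_maps"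
proof -
  interpret F: vector_space fun_scale by (rule vector_space_fun_scale)
  interpret FF: vector_space_pair fun_scale fun_scale ..
  obtain E where "comm_group.free_on (G\<lparr>carrier := M\<rparr>) E" and E: "finite E" "E \<subseteq> M" "E \<noteq> {}"
    and cof': "\<forall>x\<in>M. \<exists>m::nat. m > 0 \<and> x [^] m \<in> generate G E"
    by (rule M_generators)
  note cof = cof'[rule_format]
  define r where "r f = (\<lambda>x. if x \<in> E then f x else 0)" for f :: "'a \<Rightarrow> complex"
  define \<delta> where "\<delta> e = (\<lambda>x. if x = e then 1 else 0 :: complex)" for e :: 'a
  have r_lin: "Vector_Spaces.linear fun_scale fun_scale r"
    by unfold_locales (auto simp: r_def fun_eq_iff)
  have "r f = (\<Sum>e\<in>E. fun_scale (f e) (\<delta> e))" for f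
    using E(1) by (auto simp: r_def \<delta>_def fun_eq_iff sum_fun_apply if_distrib[of "\<lambda>z. _ * z"] cong: if_cong)
  moreover have "(\<Sum>e\<in>E. fun_scale (f e) (\<delta> e)) \<in> F.span (\<delta> ` E)" for f
    by (intro F.span_sum F.span_scale F.span_base) auto
  ultimately have "r f \<in> F.span (\<delta> ` E)" for f by simp
  then have "fin_dim fun_scale (r ` additive_maps)"
    unfolding fin_dim_def using E(1) by (intro exI[of _ "\<delta> ` E"]) auto
  then show ?thesis
  proof (rule FF.fin_dim_injective_image[OF r_lin additive_maps_subspace, rotated])
    fix f assume f: "f \<in> additive_maps" "r f = 0"
    show "f = 0"
    proof (rule additive_map_eq_zero[OF E(2) cof f(1)])
      show "f e = 0" if "e \<in> E" for e using fun_cong[OF f(2), of e] that by (simp add: r_def)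
    qed
  qed
qed

lemma linear_action_translate: "linear_action G fun_scale translate additive_maps"
proof -
  interpret vector_space fun_scale by (rule vector_space_fun_scale)
  show ?thesis
  proof (unfold_locales, goal_cases)
    case 3
    show ?case by (rule additive_maps_subspace)
  next
    case 4
    show ?case by (rule additive_maps_fin_dim)
  next
    case (5 f)
    then show ?case by (auto simp: translate_def additive_maps_def fun_eq_iff)
  next
    case (6 g h f)
    then show ?case
      using conj_closed by (auto simp: translate_def fun_eq_iff conj_conj)
  next
    case (7 g f)
    then show ?case
      using conj_closed by (auto simp: translate_def additive_maps_def conj_mult)
  qed (auto simp: translate_def fun_eq_iff algebra_simps)
qed

end

text \<open>Any prime beyond the denominators of the coefficients will do.\<close>

lemma bounded_denominator_integral:
  fixes h :: complex
  assumes "h ^ n = (\<Sum>i<n. of_rat (c i) * h ^ i)" "n > 0"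
  obtains N :: nat where "\<And>q. Factorial_Ring.prime q \<Longrightarrow> q > N \<Longrightarrow> integral_at (int q) h"
proof -
  let ?d = "\<lambda>i. snd (quotient_of (c i))"
  have "integral_at (int q) h" if q: "Factorial_Ring.prime q" "q > (\<Sum>i<n. nat (?d i))" for q :: nat
    unfolding integral_at_def
  proof (intro exI[of _ n] conjI assms(2))
    have q': "Factorial_Ring.prime (int q)" using q(1) by simp
    have d: "of_rat (c i) \<in> localized_ints (int q)" if i: "i < n" for i
    proof (rule of_rat_localized_ints)
      have pos: "?d i > 0" by (rule quotient_of_denom_pos')
      have "nat (?d i) \<le> (\<Sum>i<n. nat (?d i))" using i by (intro member_le_sum) auto
      then have "?d i < int q" using q(2) by linarith
      then show "\<not> int q dvd ?d i" using pos zdvd_not_zless by blast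
    qed
    have "(\<Sum>i\<in>I. of_rat (c i) * h ^ i) \<in> qspan (int q) {h ^ i | i. i < n}"
      if "finite I" "I \<subseteq> {..<n}" for I
      using that
    proof (induction I)
      case empty
      show ?case by (simp add: qspan.zero)
    next
      case (insert j I)
      then have "of_rat (c j) * h ^ j + (\<Sum>i\<in>I. of_rat (c i) * h ^ i) \<in> qspan (int q) {h ^ i | i. i < n}"
        by (intro qspan.step d) auto
      then show ?case using insert by simp
    qed
    from this[of "{..<n}"] show "h ^ n \<in> qspan (int q) {h ^ i | i. i < n}" using assms(1) by simp
  qed
  then show ?thesis using that by blast
qed

lemma vector_space_rat_complex: "vector_space (\<lambda>(r::rat) (z::complex). of_rat r * z)"
  by unfold_locales (auto simp: algebra_simps of_rat_add of_rat_mult)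

definition complex_group :: "complex set \<Rightarrow> complex monoid"
  where "complex_group Y = \<lparr>carrier = Y, monoid.mult = (*), one = 1\<rparr>"

lemma complex_group_comm_group:
  assumes "1 \<in> Y" "\<And>x y. x \<in> Y \<Longrightarrow> y \<in> Y \<Longrightarrow> x * y \<in> Y" "\<And>x. x \<in> Y \<Longrightarrow> inverse x \<in> Y" "0 \<notin> Y"
  shows "comm_group (complex_group Y)"
proof (rule comm_groupI)
  fix x assume "x \<in> carrier (complex_group Y)"
  then have "x \<in> Y" by (simp add: complex_group_def)
  then have "inverse x \<in> Y" "x \<noteq> 0" using assms by auto
  then have "inverse x \<in> Y \<and> inverse x * x = 1" by simp
  then show "\<exists>y\<in>carrier (complex_group Y). y \<otimes>\<^bsub>complex_group Y\<^esub> x = \<one>\<^bsub>complex_group Y\<^esub>"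
    by (auto simp: complex_group_def)
qed (use assms in \<open>auto simp: complex_group_def\<close>)

lemma complex_group_pow: "x [^]\<^bsub>complex_group Y\<^esub> (n::nat) = x ^ n"
  by (induction n) (auto simp: complex_group_def nat_pow_def)

context torsion_free_normal
begin

text \<open>An eigenvector \<open>f\<close> in \<open>Hom(M, \<complex>)\<close> turns conjugation by \<open>H\<close> into multiplication by
  numbers \<open>\<chi> h\<close>. Finite rank makes these numbers algebraic and their group finitely generated up to
  torsion, so for large \<open>q\<close> the module \<open>f  M\<close> cannot be divisible by \<open>q\<close>.\<close>

theorem no_divisible_minimal_normal:
  assumes sol: "solvable G" and min: "minimal_normal G M"
    and div: "\<And>x p. x \<in> M \<Longrightarrow> Factorial_Ring.prime p \<Longrightarrow> \<exists>y\<in>M. y [^] (p::nat) = x"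
  shows False
proof -
  interpret A: linear_action G fun_scale translate additive_maps by (rule linear_action_translate)
  obtain H f \<chi> where H: "finite_index G H" and f: "f \<in> additive_maps" "f \<noteq> 0"
    and eig: "\<And>h. h \<in> H \<Longrightarrow> translate h f = fun_scale (\<chi> h) f"
    using A.solvable_virtual_eigenvector[OF sol additive_maps_nonzero] by metis
  have sH: "subgroup H G" using H by (simp add: finite_index_def)
  have HG: "h \<in> carrier G" if "h \<in> H" for h using that by (rule subgroup.mem_carrier[OF sH])
  have \<chi>: "f (inv h \<otimes> m \<otimes> h) = \<chi> h * f m" if "h \<in> H" "m \<in> M" for h m
    using fun_cong[OF eig[OF that(1)], of m] that(2) by (simp add: translate_def)
  have f_mult: "f (x \<otimes> y) = f x + f y" if "x \<in> M" "y \<in> M" for x y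
    using f(1) that by (auto simp: additive_maps_def)
  obtain m0 where m0: "m0 \<in> M" "f m0 \<noteq> 0"
    using f by (auto simp: additive_maps_def fun_eq_iff)
  \<comment> \<open>the values of the character form a group, an image of \<open>H\<close>\<close>
  have \<chi>_mult: "\<chi> (g \<otimes> h) = \<chi> g * \<chi> h" if "g \<in> H" "h \<in> H" for g h
  proof -
    have "\<chi> (g \<otimes> h) * f m0 = \<chi> h * (\<chi> g * f m0)"
      using \<chi>[OF subgroup.m_closed[OF sH that] m0(1)] \<chi>[OF that(2) conj_closed[OF HG m0(1)], OF that(1)]
        \<chi>[OF that(1) m0(1)] that m0 HG by (simp add: conj_conj)
    then show ?thesis using m0(2) by simp
  qed
  have \<chi>_one: "\<chi> \<one> = 1"
    using \<chi>[OF subgroup.one_closed[OF sH] m0(1)] m0 by simp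
  have \<chi>_inv: "\<chi> (inv h) * \<chi> h = 1" if "h \<in> H" for h
    using \<chi>_mult[of "inv h" h] that subgroup.m_inv_closed[OF sH] HG \<chi>_one by simp
  define Y where "Y = \<chi> ` H"
  have Y0: "0 \<notin> Y" using \<chi>_inv by (force simp: Y_def)
  have Y_inv: "inverse x \<in> Y" if x: "x \<in> Y" for x
  proof -
    obtain h where h: "h \<in> H" "x = \<chi> h" using x by (auto simp: Y_def)
    have "inverse x = \<chi> (inv h)" using \<chi>_inv[OF h(1)] h(2) by (metis inverse_unique mult.commute)
    then show ?thesis using subgroup.m_inv_closed[OF sH h(1)] by (simp add: Y_def)
  qed
  have Y_mult: "x * y \<in> Y" if xy: "x \<in> Y" "y \<in> Y" for x y
  proof -
    obtain g h where "g \<in> H" "x = \<chi> g" "h \<in> H" "y = \<chi> h" using xy by (auto simp: Y_def)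
    then show ?thesis
      unfolding Y_def using \<chi>_mult[of g h] subgroup.m_closed[OF sH, of g h] by (intro image_eqI[of _ _ "g \<otimes> h"]) auto
  qed
  have Y_one: "1 \<in> Y" using \<chi>_one subgroup.one_closed[OF sH] by (force simp: Y_def)
  interpret C: comm_group "complex_group Y"
    by (rule complex_group_comm_group[OF Y_one Y_mult Y_inv Y0])
  have C_simps: "carrier (complex_group Y) = Y" "\<one>\<^bsub>complex_group Y\<^esub> = 1"
    "x \<otimes>\<^bsub>complex_group Y\<^esub> y = x * y" for x y
    by (simp_all add: complex_group_def)
  interpret HG: group "G\<lparr>carrier := H\<rparr>" by (rule subgroup_imp_group[OF sH])
  have hom: "group_hom (G\<lparr>carrier := H\<rparr>) (complex_group Y) \<chi>"
    by (unfold_locales, rule homI) (auto simp: C_simps \<chi>_mult, simp add: Y_def)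
  have "finite_rank (complex_group Y)"
    by (rule finite_rank_surj_hom[OF hom _ finite_rank_subgroup[OF group_axioms finite_rank sH]])
       (simp add: complex_group_def Y_def)
  then obtain E where E: "C.free_on E"
    and E_roots: "\<And>x. x \<in> Y \<Longrightarrow> \<exists>m::nat. m > 0 \<and> x ^ m \<in> generate (complex_group Y) E"
    using C.free_generators_up_to_torsion unfolding C_simps complex_group_pow by metis
  have EY: "finite E" "E \<subseteq> Y" using E unfolding C.free_on_def C_simps by auto
  define E' where "E' = E \<union> inverse ` E"
  have E': "finite E'" "E' \<subseteq> Y" using EY Y_inv by (auto simp: E'_def)
  have gen: "generate (complex_group Y) E \<subseteq> S"
    if S: "E' \<subseteq> S" "1 \<in> S" "\<And>a b. a \<in> S \<Longrightarrow> b \<in> S \<Longrightarrow> a * b \<in> S" for S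
  proof
    fix x assume "x \<in> generate (complex_group Y) E"
    then show "x \<in> S"
    proof (induction rule: generate.induct)
      case (inv h)
      then have "h \<in> Y" using EY by blast
      moreover from this have "h \<noteq> 0" using Y0 by blast
      ultimately have "inv\<^bsub>complex_group Y\<^esub> h = inverse h"
        using Y_inv by (intro C.inv_equality) (auto simp: C_simps)
      then show ?case using inv S(1) by (auto simp: E'_def)
    qed (use S in \<open>auto simp: C_simps E'_def\<close>)
  qed
  \<comment> \<open>all values of the character are algebraic numbers\<close>
  have alg: "\<exists>n>0. \<exists>c. x ^ n = (\<Sum>i<n. of_rat (c i) * x ^ i)" if x: "x \<in> Y" for x
  proof -
    obtain h where h: "h \<in> H" "x = \<chi> h" using x by (auto simp: Y_def)
    let ?s = "\<lambda>(r::rat) (z::complex). of_rat r * z"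
    interpret Q: vector_space ?s by (rule vector_space_rat_complex)
    obtain F where "comm_group.free_on (G\<lparr>carrier := M\<rparr>) F" and F: "finite F" "F \<subseteq> M" "F \<noteq> {}"
      and cof: "\<forall>x\<in>M. \<exists>m::nat. m > 0 \<and> x [^] m \<in> generate G F"
      by (rule M_generators)
    have gF: "generate G F \<subseteq> M" by (rule generate_subgroup_incl[OF F(2) N.subgroup_axioms])
    have gen_span: "f y \<in> Q.span (f ` F)" if "y \<in> generate G F" for y
      using that
    proof (induction rule: generate.induct)
      case one
      show ?case using additive_maps_one[OF f(1)] Q.span_zero by simp
    next
      case (incl y)
      then show ?case by (intro Q.span_base) auto
    next
      case (inv y)
      then have "- f y \<in> Q.span (f ` F)" by (intro Q.span_neg Q.span_base) auto
      then show ?case using additive_maps_inv[OF f(1), of y] inv F(2) by auto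
    next
      case (eng y z)
      then have "f y + f z \<in> Q.span (f ` F)" by (intro Q.span_add)
      moreover have "y \<in> M" "z \<in> M" using eng gF by blast+
      ultimately show ?case using f_mult by simp
    qed
    have "f y \<in> Q.span (f ` F)" if "y \<in> M" for y
    proof -
      obtain m :: nat where m: "m > 0" "y [^] m \<in> generate G F" using cof \<open>y \<in> M\<close> by blast
      have "of_rat (1 / of_nat m) * f (y [^] m) \<in> Q.span (f ` F)"
        by (intro Q.span_scale gen_span m)
      then show ?thesis using additive_maps_pow[OF f(1) that, of m] m(1) by (simp add: of_rat_divide)
    qed
    then have fd: "fin_dim ?s (f ` M)" unfolding fin_dim_def using F(1) by (intro exI[of _ "f ` F"]) auto
    have mem: "x ^ i * f m0 \<in> f ` M" for i
    proof (induction i)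
      case (Suc i)
      then obtain m where m: "m \<in> M" "x ^ i * f m0 = f m" by auto
      have "x ^ Suc i * f m0 = f (inv h \<otimes> m \<otimes> h)" using \<chi>[OF h(1) m(1)] m(2) h(2) by simp
      then show ?case using conj_closed[OF HG[OF h(1)] m(1)] by blast
    qed (use m0 in auto)
    obtain n c where nc: "x ^ n * f m0 = (\<Sum>i<n. of_rat (c i) * (x ^ i * f m0))"
      by (rule Q.fin_dim_sequence_dependent[OF fd, of "\<lambda>i. x ^ i * f m0"]) (rule mem)
    have "x ^ n * f m0 = (\<Sum>i<n. of_rat (c i) * x ^ i) * f m0"
      unfolding nc by (simp add: sum_distrib_right mult.assoc)
    then have "x ^ n = (\<Sum>i<n. of_rat (c i) * x ^ i)" using m0(2) by simp
    moreover from this have "n > 0" by (cases n) auto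
    ultimately show ?thesis by blast
  qed
  have "\<exists>N::nat. \<forall>q. Factorial_Ring.prime q \<longrightarrow> q > N \<longrightarrow> integral_at (int q) x" if "x \<in> Y" for x
    using alg[OF that] bounded_denominator_integral by metis
  then have "\<forall>x\<in>E'. \<exists>N::nat. \<forall>q. Factorial_Ring.prime q \<longrightarrow> q > N \<longrightarrow> integral_at (int q) x"
    using E'(2) by blast
  from bchoice[OF this] obtain N :: "complex \<Rightarrow> nat"
    where N: "\<forall>x\<in>E'. \<forall>q. Factorial_Ring.prime q \<longrightarrow> q > N x \<longrightarrow> integral_at (int q) x" ..
  obtain q :: nat where q: "Factorial_Ring.prime q" "q > (\<Sum>x\<in>E'. N x)" using bigger_prime by blast
  have int_q: "integral_at (int q) e" if "e \<in> E'" for e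
  proof -
    have "N e \<le> (\<Sum>x\<in>E'. N x)" using that E'(1) by (intro member_le_sum) auto
    then show ?thesis using N that q by auto
  qed
  \<comment> \<open>the image of \<open>M\<close> is spanned by the translates of finitely many values\<close>
  obtain T where T: "finite T" "T \<subseteq> carrier G" "\<And>g. g \<in> carrier G \<Longrightarrow> \<exists>t\<in>T. inv t \<otimes> g \<in> H"
    using H unfolding finite_index_def by blast
  define L where "L = (\<lambda>t. f (inv t \<otimes> m0 \<otimes> t)) ` T"
  let ?B = "{x * l' | x l'. x \<in> Y \<and> l' \<in> L}"
  have q': "Factorial_Ring.prime (int q)" using q(1) by simp
  have conj_span: "f (inv g \<otimes> m0 \<otimes> g) \<in> qspan (int q) ?B" if g: "g \<in> carrier G" for g
  proof -
    obtain t where t: "t \<in> T" "inv t \<otimes> g \<in> H" using T(3)[OF g] by blast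
    have tG: "t \<in> carrier G" using t T by blast
    let ?h = "inv t \<otimes> g"
    have "g = t \<otimes> ?h" using tG g by (simp add: m_assoc[symmetric])
    then have "inv g \<otimes> m0 \<otimes> g = inv ?h \<otimes> (inv t \<otimes> m0 \<otimes> t) \<otimes> ?h"
      using conj_conj[of t ?h m0] tG g m0(1) by simp
    then have eq: "f (inv g \<otimes> m0 \<otimes> g) = \<chi> ?h * f (inv t \<otimes> m0 \<otimes> t)"
      using \<chi>[OF t(2) conj_closed[OF tG m0(1)]] by simp
    have "\<chi> ?h * f (inv t \<otimes> m0 \<otimes> t) \<in> ?B" using t by (auto simp: Y_def L_def)
    then show ?thesis unfolding eq by (rule qspan_base[OF q'])
  qed
  \<comment> \<open>a normal subgroup of \<open>G\<close> that contains \<open>m0\<close>, hence all of \<open>M\<close>\<close>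
  define M' where "M' = {y \<in> M. \<forall>g\<in>carrier G. f (inv g \<otimes> y \<otimes> g) \<in> qspan (int q) ?B}"
  have "M' \<lhd> G"
  proof (rule normal_invI)
    show "subgroup M' G"
    proof
      show "M' \<subseteq> carrier G" by (auto simp: M'_def)
      show "\<one> \<in> M'" using additive_maps_one[OF f(1)] by (auto simp: M'_def qspan.zero)
      show "x \<otimes> y \<in> M'" if "x \<in> M'" "y \<in> M'" for x y
        using that by (auto simp: M'_def conj_mult f_mult conj_closed qspan_add)
      show "inv x \<in> M'" if x: "x \<in> M'" for x
        unfolding M'_def
      proof (intro CollectI conjI ballI)
        show "inv x \<in> M" using x by (auto simp: M'_def)
        fix g assume g: "g \<in> carrier G"
        have xM: "x \<in> M" and xs: "f (inv g \<otimes> x \<otimes> g) \<in> qspan (int q) ?B"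
          using x g by (auto simp: M'_def)
        have "inv g \<otimes> inv x \<otimes> g = inv (inv g \<otimes> x \<otimes> g)"
          using g xM by (simp add: inv_mult_group m_assoc)
        then have "f (inv g \<otimes> inv x \<otimes> g) = - 1 * f (inv g \<otimes> x \<otimes> g)"
          using additive_maps_inv[OF f(1) conj_closed[OF g xM]] by simp
        then show "f (inv g \<otimes> inv x \<otimes> g) \<in> qspan (int q) ?B"
          using qspan_scale[OF q' of_int_localized_ints[OF q', of "-1"] xs] by simp
      qed
    qed
    show "g \<otimes> x \<otimes> inv g \<in> M'" if x: "x \<in> M'" and g: "g \<in> carrier G" for g x
      unfolding M'_def
    proof (intro CollectI conjI ballI)
      have xM: "x \<in> M" using x by (simp add: M'_def)
      show "g \<otimes> x \<otimes> inv g \<in> M" using conj_closed[of "inv g" x] xM g by simp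
      fix h assume h: "h \<in> carrier G"
      have "inv h \<otimes> (g \<otimes> x \<otimes> inv g) \<otimes> h = inv (inv g \<otimes> h) \<otimes> x \<otimes> (inv g \<otimes> h)"
        using conj_conj[of "inv g" h x] g h xM by simp
      then show "f (inv h \<otimes> (g \<otimes> x \<otimes> inv g) \<otimes> h) \<in> qspan (int q) ?B"
        using x g h by (simp add: M'_def)
    qed
  qed
  moreover have "M' \<subseteq> M" "m0 \<in> M'" using conj_span m0 by (auto simp: M'_def)
  moreover have "m0 \<noteq> \<one>" using m0 additive_maps_one[OF f(1)] by auto
  ultimately have "M' = M" using min unfolding minimal_normal_def by blast
  then have span: "f y \<in> qspan (int q) ?B" if "y \<in> M" for y
  proof -
    have "y \<in> M'" using that \<open>M' = M\<close> by simp
    then have "f (inv \<one> \<otimes> y \<otimes> \<one>) \<in> qspan (int q) ?B" unfolding M'_def by blast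
    then show ?thesis using that by simp
  qed
  have "L \<subseteq> {0}"
  proof (rule finitely_generated_not_divisible[OF q' _ E'(1) int_q])
    show "finite L" using T(1) by (simp add: L_def)
    show "\<exists>m>0. x ^ m \<in> S" if "x \<in> Y" "E' \<subseteq> S" "1 \<in> S" "\<And>a b. a \<in> S \<Longrightarrow> b \<in> S \<Longrightarrow> a * b \<in> S" for x S
      using E_roots[OF that(1)] gen[OF that(2-4)] by blast
    show "l / of_int (int q) \<in> qspan (int q) ?B" if l: "l \<in> L" for l
    proof -
      obtain t where t: "t \<in> T" "l = f (inv t \<otimes> m0 \<otimes> t)" using l by (auto simp: L_def)
      then have "inv t \<otimes> m0 \<otimes> t \<in> M" using conj_closed m0 T(2) by blast
      then obtain y where y: "y \<in> M" "y [^] q = inv t \<otimes> m0 \<otimes> t" using div q(1) by blast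
      then have "l = of_nat q * f y" using t additive_maps_pow[OF f(1) y(1), of q] by simp
      then have "l / of_int (int q) = f y" using q(1) by (auto simp: prime_gt_0_nat)
      then show ?thesis using span[OF y(1)] by simp
    qed
  qed
  then have B0: "b = 0" if "b \<in> ?B" for b using that by auto
  have "z = 0" if "z \<in> qspan (int q) ?B" for z
    using that
  proof induction
    case (step a w z)
    then show ?case using B0[OF step(2)] by simp
  qed simp
  then show False using span[OF m0(1)] m0(2) by blast
qed

end

lemma (in comm_group) finite_exponent_generate:
  assumes E: "finite E" "E \<subseteq> carrier G" and p: "p > 0" "\<And>x. x \<in> carrier G \<Longrightarrow> x [^] (p::nat) = \<one>"
  shows "finite (generate G E) \<and> card (generate G E) \<le> p ^ card E"
proof -
  let ?I = "E \<rightarrow>\<^sub>E {0..<int p}"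
  have "generate G E \<subseteq> monomial E ` ?I"
  proof
    fix x assume "x \<in> generate G E"
    then obtain k where k: "x = monomial E k" by (rule generate_monomial[OF E])
    have red: "e [^] (k e mod int p) = e [^] k e" if "e \<in> E" for e
    proof -
      have e: "e \<in> carrier G" using that E by blast
      have "e [^] k e = e [^] (int p * (k e div int p) + k e mod int p)" by simp
      also have "\<dots> = (e [^] int p) [^] (k e div int p) \<otimes> e [^] (k e mod int p)"
        using e by (simp only: int_pow_mult int_pow_pow)
      also have "e [^] int p = \<one>" using p(2)[OF e] by (simp add: int_pow_int)
      finally show ?thesis using e by (simp add: int_pow_one)
    qed
    have "x = monomial E (restrict (\<lambda>e. k e mod int p) E)"
      unfolding k monomial_def using E red by (intro finprod_cong') auto
    moreover have "restrict (\<lambda>e. k e mod int p) E \<in> ?I" using p(1) by auto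
    ultimately show "x \<in> monomial E ` ?I" by blast
  qed
  moreover have fin: "finite ?I" using E by (intro finite_PiE) auto
  ultimately have "finite (generate G E)" "card (generate G E) \<le> card (monomial E ` ?I)"
    by (auto intro: finite_subset card_mono)
  moreover have "card (monomial E ` ?I) \<le> p ^ card E"
    using card_image_le[OF fin, of "monomial E"] E by (simp add: card_PiE)
  ultimately show ?thesis by (meson order_trans)
qed

lemma (in comm_group) finite_rank_finite_exponent:
  assumes "finite_rank G" and p: "p > 0" "\<And>x. x \<in> carrier G \<Longrightarrow> x [^] (p::nat) = \<one>"
  shows "finite (carrier G)"
proof (rule ccontr)
  assume inf: "infinite (carrier G)"
  obtain r where r': "\<forall>S. finite S \<and> S \<subseteq> carrier G \<longrightarrow>
      (\<exists>T. finite T \<and> card T \<le> r \<and> T \<subseteq> carrier G \<and> generate G T = generate G S)"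
    using assms(1) unfolding finite_rank_def ..
  obtain S where S: "finite S" "card S = Suc (p ^ r)" "S \<subseteq> carrier G"
    using infinite_arbitrarily_large[OF inf] by blast
  then obtain T where T: "finite T" "card T \<le> r" "T \<subseteq> carrier G" "generate G T = generate G S"
    using r' by blast
  note g = finite_exponent_generate[OF T(1,3) p]
  have "S \<subseteq> generate G T" unfolding T(4) by (auto intro: generate.incl)
  then have "card S \<le> p ^ card T" using g card_mono by (metis order_trans)
  also have "\<dots> \<le> p ^ r" using p(1) T(2) by (intro power_increasing) auto
  finally show False using S(2) by simp
qed

text \<open>The \<open>p\<close>-th powers and the solutions of \<open>x [^] p = \<one>\<close> in \<open>M\<close> are normal in \<open>G\<close>, so each
  of these sets is trivial or \<open>M\<close>. If the powers are trivial for some \<open>p\<close>, finite rank bounds the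
  size of \<open>M\<close>; otherwise \<open>M\<close> is divisible and torsion-free.\<close>

theorem (in group) minimal_normal_finite:
  assumes sol: "solvable G" and fr: "finite_rank G" and M: "minimal_normal G M"
  obtains p :: nat where "Factorial_Ring.prime p" "\<And>x. x \<in> M \<Longrightarrow> x [^] p = \<one>" "finite M"
proof -
  have n: "M \<lhd> G" and nt: "M \<noteq> {\<one>}" and min: "\<And>H. H \<lhd> G \<Longrightarrow> H \<subseteq> M \<Longrightarrow> H = {\<one>} \<or> H = M"
    using M unfolding minimal_normal_def by auto
  interpret N: normal M G by fact
  have comm: "x \<otimes> y = y \<otimes> x" if "x \<in> M" "y \<in> M" for x y
    using solvable_minimal_normal_commutes[OF sol M that] .
  interpret A: comm_group "G\<lparr>carrier := M\<rparr>" by (rule normal_comm_groupI[OF N.subgroup_axioms comm])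
  have pM: "x [^] n \<in> M" if "x \<in> M" for x and n :: nat using that by (induction n) auto
  have pP: "(\<lambda>x. x [^] p) ` M = {\<one>} \<or> (\<lambda>x. x [^] p) ` M = M" for p :: nat
    using pM by (intro min powers_normal(2)[OF n comm]) auto
  show ?thesis
  proof (cases "\<exists>p::nat. Factorial_Ring.prime p \<and> (\<lambda>x. x [^] p) ` M = {\<one>}")
    case True
    then obtain p :: nat where p: "Factorial_Ring.prime p" "(\<lambda>x. x [^] p) ` M = {\<one>}" by blast
    have ex: "x [^] p = \<one>" if "x \<in> M" for x using p(2) that by blast
    have "finite (carrier (G\<lparr>carrier := M\<rparr>))"
      by (rule A.finite_rank_finite_exponent[OF finite_rank_subgroup[OF group_axioms fr N.subgroup_axioms]
            prime_gt_0_nat[OF p(1)]]) (use ex in \<open>simp add: nat_pow_def\<close>)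
    then show ?thesis using that[OF p(1) ex] by simp
  next
    case False
    then have surj: "(\<lambda>x. x [^] p) ` M = M" if "Factorial_Ring.prime p" for p :: nat using pP that by blast
    have tf_prime: "x = \<one>" if p: "Factorial_Ring.prime p" and x: "x \<in> M" "x [^] p = \<one>" for x and p :: nat
    proof -
      have "{x \<in> M. x [^] p = \<one>} = {\<one>} \<or> {x \<in> M. x [^] p = \<one>} = M"
        by (intro min powers_normal(1)[OF n comm]) auto
      moreover have "{x \<in> M. x [^] p = \<one>} \<noteq> M"
      proof
        assume "{x \<in> M. x [^] p = \<one>} = M"
        then have "(\<lambda>x. x [^] p) ` M \<subseteq> {\<one>}" by blast
        then show False using surj[OF p] nt N.one_closed by blast
      qed
      ultimately show ?thesis using x by blast
    qed
    have tf: "x = \<one>" if "x \<in> M" "n > 0" "x [^] n = \<one>" for x and n :: nat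
      using that
    proof (induction n arbitrary: x rule: less_induct)
      case (less n)
      show ?case
      proof (cases "n = 1")
        case False
        then obtain p where p: "Factorial_Ring.prime p" "p dvd n" using prime_factor_nat by blast
        then obtain m where m: "n = p * m" by blast
        have "(x [^] m) [^] p = \<one>" using less.prems m by (simp add: nat_pow_pow mult.commute)
        then have "x [^] m = \<one>" by (rule tf_prime[OF p(1) pM[OF less.prems(1)]])
        moreover have m0: "m > 0" using less.prems(2) m by (cases m) auto
        moreover have "m < n" using m0 prime_gt_1_nat[OF p(1)] unfolding m by simp
        ultimately show ?thesis using less.IH less.prems(1) by blast
      qed (use less.prems in simp)
    qed
    interpret torsion_free_normal G M
    proof unfold_locales
      show "x \<otimes> y = y \<otimes> x" if "x \<in> M" "y \<in> M" for x y using that by (rule comm)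
      show "x = \<one>" if "x \<in> M" "n > 0" "x [^] n = \<one>" for x and n :: nat using that by (rule tf)
    qed (rule n nt fr)+
    have False
    proof (rule no_divisible_minimal_normal[OF sol M])
      fix x and p :: nat assume "x \<in> M" "Factorial_Ring.prime p"
      then have "x \<in> (\<lambda>x. x [^] p) ` M" using surj by simp
      then show "\<exists>y\<in>M. y [^] p = x" by blast
    qed
    then show ?thesis ..
  qed
qed

section \<open>Homomorphisms between finite semisimple modules\<close>

context group
begin

lemma normal_set_mult:
  assumes A: "A \<lhd> G" and B: "B \<lhd> G"
  shows "A <#> B \<lhd> G"
proof (rule normal_invI)
  interpret A: normal A G by fact
  interpret B: normal B G by fact
  show "subgroup (A <#> B) G"
  proof
    show "A <#> B \<subseteq> carrier G" by (auto simp: set_mult_def)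
    have "\<one> \<otimes> \<one> \<in> A <#> B" using A.one_closed B.one_closed unfolding set_mult_def by blast
    then show "\<one> \<in> A <#> B" by simp
    show "x \<otimes> y \<in> A <#> B" if x: "x \<in> A <#> B" and y: "y \<in> A <#> B" for x y
    proof -
      obtain a b where 1: "a \<in> A" "b \<in> B" "x = a \<otimes> b" using x by (auto simp: set_mult_def)
      obtain a' b' where 2: "a' \<in> A" "b' \<in> B" "y = a' \<otimes> b'" using y by (auto simp: set_mult_def)
      note * = 1 2
      have "x \<otimes> y = (a \<otimes> (b \<otimes> a' \<otimes> inv b)) \<otimes> (b \<otimes> b')"
      proof -
        have "(a \<otimes> (b \<otimes> a' \<otimes> inv b)) \<otimes> (b \<otimes> b') = a \<otimes> b \<otimes> a' \<otimes> (inv b \<otimes> b) \<otimes> b'"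
          using * by (simp only: m_assoc A.mem_carrier B.mem_carrier m_closed inv_closed)
        then show ?thesis using * by (simp add: m_assoc)
      qed
      moreover have "a \<otimes> (b \<otimes> a' \<otimes> inv b) \<in> A" using * A.inv_op_closed2 by auto
      ultimately show ?thesis using * by (auto simp: set_mult_def)
    qed
    show "inv x \<in> A <#> B" if x: "x \<in> A <#> B" for x
    proof -
      obtain a b where *: "a \<in> A" "b \<in> B" "x = a \<otimes> b" using x by (auto simp: set_mult_def)
      have "inv x = (inv b \<otimes> inv a \<otimes> inv (inv b)) \<otimes> inv b"
        using * by (simp add: inv_mult_group m_assoc)
      moreover have "inv b \<otimes> inv a \<otimes> inv (inv b) \<in> A" using * A.inv_op_closed2[of "inv b" "inv a"] by auto
      moreover have "inv b \<in> B" using * by auto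
      ultimately show ?thesis unfolding set_mult_def by blast
    qed
  qed
  show "g \<otimes> x \<otimes> inv g \<in> A <#> B" if x: "x \<in> A <#> B" and g: "g \<in> carrier G" for g x
  proof -
    obtain a b where *: "a \<in> A" "b \<in> B" "x = a \<otimes> b" using x by (auto simp: set_mult_def)
    have "g \<otimes> x \<otimes> inv g = (g \<otimes> a \<otimes> inv g) \<otimes> (g \<otimes> b \<otimes> inv g)"
      using hom_mult[OF conj_hom[OF g], of a b] * by simp
    moreover have "g \<otimes> a \<otimes> inv g \<in> A" "g \<otimes> b \<otimes> inv g \<in> B"
      using * g A.inv_op_closed2 B.inv_op_closed2 by auto
    ultimately show ?thesis unfolding set_mult_def by blast
  qed
qed

lemma set_mult_superset:
  assumes "subgroup A G" "subgroup B G"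
  shows "A \<subseteq> A <#> B" "B \<subseteq> A <#> B"
proof -
  interpret A: subgroup A G by fact
  interpret B: subgroup B G by fact
  show "A \<subseteq> A <#> B"
  proof
    fix a assume "a \<in> A"
    then have "a = a \<otimes> \<one>" by simp
    then show "a \<in> A <#> B" using \<open>a \<in> A\<close> B.one_closed unfolding set_mult_def by blast
  qed
  show "B \<subseteq> A <#> B"
  proof
    fix b assume "b \<in> B"
    then have "b = \<one> \<otimes> b" by simp
    then show "b \<in> A <#> B" using \<open>b \<in> B\<close> A.one_closed unfolding set_mult_def by blast
  qed
qed

lemma set_mult_least:
  assumes "subgroup N G" "A \<subseteq> N" "B \<subseteq> N"
  shows "A <#> B \<subseteq> N"
  using assms subgroup.m_closed[OF assms(1)] by (auto simp: set_mult_def)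

lemma normal_Int: "A \<lhd> G \<Longrightarrow> B \<lhd> G \<Longrightarrow> A \<inter> B \<lhd> G"
proof (rule normal_invI)
  assume A: "A \<lhd> G" and B: "B \<lhd> G"
  show "subgroup (A \<inter> B) G" using A B by (intro subgroups_Inter_pair normal_imp_subgroup)
  show "g \<otimes> x \<otimes> inv g \<in> A \<inter> B" if "x \<in> A \<inter> B" "g \<in> carrier G" for g x
    using that normal.inv_op_closed2[OF A] normal.inv_op_closed2[OF B] by blast
qed

lemma normal_trivial: "{\<one>} \<lhd> G"
  by (rule one_is_normal)

lemma minimal_normal_below:
  assumes A: "A \<lhd> G" "finite A" "A \<noteq> {\<one>}"
  obtains M where "minimal_normal G M" "M \<subseteq> A"
proof -
  let ?P = "\<lambda>N. N \<lhd> G \<and> N \<subseteq> A \<and> N \<noteq> {\<one>}"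
  have "?P A" using A by simp
  from ex_has_least_nat[of ?P, OF this, of card]
  obtain M where M: "?P M" and min: "\<forall>N. ?P N \<longrightarrow> card M \<le> card N" by (elim exE conjE[where P = "?P _"])
  have "minimal_normal G M"
    unfolding minimal_normal_def
  proof (intro conjI allI impI)
    fix H assume H: "H \<lhd> G \<and> H \<subseteq> M"
    show "H = {\<one>} \<or> H = M"
    proof (rule disjCI)
      assume "H \<noteq> M"
      then have "card H < card M" using H M A(2) by (meson finite_subset psubsetI psubset_card_mono)
      then show "H = {\<one>}" using min H M by fastforce
    qed
  qed (use M in auto)
  then show ?thesis using that M by blast
qed

lemma minimal_normal_Int:
  assumes "minimal_normal G M" "A \<lhd> G" "\<not> M \<subseteq> A"
  shows "M \<inter> A = {\<one>}"
proof -
  have "M \<inter> A \<lhd> G" using assms(1,2) by (intro normal_Int) (auto simp: minimal_normal_def)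
  then show ?thesis using assms unfolding minimal_normal_def by blast
qed

definition normal_closure :: "'a \<Rightarrow> 'a set"
  where "normal_closure x = generate G ((\<lambda>g. g \<otimes> x \<otimes> inv g) ` carrier G)"

lemma normal_closure_normal:
  assumes "x \<in> carrier G"
  shows "normal_closure x \<lhd> G"
  unfolding normal_closure_def
proof (rule normal_generateI)
  fix h g assume h: "h \<in> (\<lambda>g. g \<otimes> x \<otimes> inv g) ` carrier G" and g: "g \<in> carrier G"
  then obtain k where k: "k \<in> carrier G" "h = k \<otimes> x \<otimes> inv k" by blast
  then have "g \<otimes> h \<otimes> inv g = (g \<otimes> k) \<otimes> x \<otimes> inv (g \<otimes> k)"
    using g assms by (simp add: inv_mult_group m_assoc)
  then show "g \<otimes> h \<otimes> inv g \<in> (\<lambda>g. g \<otimes> x \<otimes> inv g) ` carrier G" using g k by blast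
qed (use assms in auto)

lemma normal_closure_self: "x \<in> carrier G \<Longrightarrow> x \<in> normal_closure x"
  unfolding normal_closure_def by (rule generate.incl, rule image_eqI[of _ _ \<one>]) auto

lemma normal_closure_minimal:
  assumes "N \<lhd> G" "x \<in> N"
  shows "normal_closure x \<subseteq> N"
  unfolding normal_closure_def
  by (rule generate_subgroup_incl)
     (use assms normal.inv_op_closed2[OF assms(1)] in \<open>auto intro: normal_imp_subgroup\<close>)

text \<open>Homomorphisms of modules under conjugation. They are undefined off \<open>A\<close>, so that they can be
  counted.\<close>

definition equivariant_homs :: "'a set \<Rightarrow> 'a set \<Rightarrow> ('a \<Rightarrow> 'a) set"
  where "equivariant_homs A B = {\<theta> \<in> A \<rightarrow>\<^sub>E B. (\<forall>x\<in>A. \<forall>y\<in>A. \<theta> (x \<otimes> y) = \<theta> x \<otimes> \<theta> y) \<and>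
      (\<forall>g\<in>carrier G. \<forall>x\<in>A. \<theta> (g \<otimes> x \<otimes> inv g) = g \<otimes> \<theta> x \<otimes> inv g)}"

lemma equivariant_homsD:
  assumes "\<theta> \<in> equivariant_homs A B"
  shows "x \<in> A \<Longrightarrow> \<theta> x \<in> B" "x \<notin> A \<Longrightarrow> \<theta> x = undefined"
    "x \<in> A \<Longrightarrow> y \<in> A \<Longrightarrow> \<theta> (x \<otimes> y) = \<theta> x \<otimes> \<theta> y"
    "g \<in> carrier G \<Longrightarrow> x \<in> A \<Longrightarrow> \<theta> (g \<otimes> x \<otimes> inv g) = g \<otimes> \<theta> x \<otimes> inv g"
  using assms by (auto simp: equivariant_homs_def)

lemma equivariant_homsI:
  assumes "\<And>x. x \<in> A \<Longrightarrow> \<theta> x \<in> B" "\<And>x. x \<notin> A \<Longrightarrow> \<theta> x = undefined"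
    "\<And>x y. x \<in> A \<Longrightarrow> y \<in> A \<Longrightarrow> \<theta> (x \<otimes> y) = \<theta> x \<otimes> \<theta> y"
    "\<And>g x. g \<in> carrier G \<Longrightarrow> x \<in> A \<Longrightarrow> \<theta> (g \<otimes> x \<otimes> inv g) = g \<otimes> \<theta> x \<otimes> inv g"
  shows "\<theta> \<in> equivariant_homs A B"
  using assms by (auto simp: equivariant_homs_def)

lemma equivariant_homs_finite:
  assumes "finite A" "finite B"
  shows "finite (equivariant_homs A B)"
proof -
  have "equivariant_homs A B \<subseteq> A \<rightarrow>\<^sub>E B" by (auto simp: equivariant_homs_def)
  then show ?thesis using finite_PiE[OF assms(1), of "\<lambda>_. B"] assms(2) finite_subset by blast
qed

lemma equivariant_hom_one_inv:
  assumes A: "A \<lhd> G" and B: "B \<lhd> G" and \<theta>: "\<theta> \<in> equivariant_homs A B"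
  shows "\<theta> \<one> = \<one>" and "x \<in> A \<Longrightarrow> \<theta> (inv x) = inv (\<theta> x)"
proof -
  interpret A: normal A G by fact
  interpret B: normal B G by fact
  note D = equivariant_homsD[OF \<theta>]
  have "\<theta> \<one> \<otimes> \<theta> \<one> = \<theta> \<one>" using D(3)[of \<one> \<one>] A.one_closed by simp
  then show one: "\<theta> \<one> = \<one>" using D(1)[OF A.one_closed] by simp
  show "\<theta> (inv x) = inv (\<theta> x)" if x: "x \<in> A"
    using D(3)[of "inv x" x] x one D(1) by (intro inv_equality[symmetric]) auto
qed

lemma equivariant_hom_kernel_image:
  assumes A: "A \<lhd> G" and B: "B \<lhd> G" and \<theta>: "\<theta> \<in> equivariant_homs A B"
  shows "{x \<in> A. \<theta> x = \<one>} \<lhd> G" (is "?K \<lhd> G") and "\<theta> ` A \<lhd> G"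
proof -
  interpret A: normal A G by fact
  interpret B: normal B G by fact
  note D = equivariant_homsD[OF \<theta>] and D' = equivariant_hom_one_inv[OF assms]
  have conj: "g \<otimes> x \<otimes> inv g \<in> A" if "g \<in> carrier G" "x \<in> A" for g x
    using that A.inv_op_closed2 by blast
  show "?K \<lhd> G"
  proof (rule normal_invI)
    show "subgroup ?K G"
    proof
      show "x \<otimes> y \<in> ?K" if "x \<in> ?K" "y \<in> ?K" for x y using that D(3) by auto
      show "inv x \<in> ?K" if "x \<in> ?K" for x using that D' by auto
    qed (use D' in auto)
    show "g \<otimes> x \<otimes> inv g \<in> ?K" if "x \<in> ?K" "g \<in> carrier G" for g x
      using that conj D(4) by auto
  qed
  show "\<theta> ` A \<lhd> G"
  proof (rule normal_invI)
    show "subgroup (\<theta> ` A) G"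
    proof
      show "\<theta> ` A \<subseteq> carrier G" using D(1) by auto
      show "\<one> \<in> \<theta> ` A" using D'(1)[symmetric] A.one_closed by (rule image_eqI)
      show "u \<otimes> v \<in> \<theta> ` A" if uv: "u \<in> \<theta> ` A" "v \<in> \<theta> ` A" for u v
      proof -
        obtain x where "x \<in> A" "u = \<theta> x" using uv(1) by (rule imageE)
        moreover obtain y where "y \<in> A" "v = \<theta> y" using uv(2) by (rule imageE)
        ultimately show ?thesis using D(3)[of x y] by (intro image_eqI[of _ _ "x \<otimes> y"]) auto
      qed
      show "inv u \<in> \<theta> ` A" if u: "u \<in> \<theta> ` A" for u
      proof -
        obtain x where "x \<in> A" "u = \<theta> x" using u by blast
        then show ?thesis using D'(2)[of x] by (intro image_eqI[of _ _ "inv x"]) auto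
      qed
    qed
    show "g \<otimes> u \<otimes> inv g \<in> \<theta> ` A" if u: "u \<in> \<theta> ` A" and g: "g \<in> carrier G" for g u
    proof -
      obtain x where "x \<in> A" "u = \<theta> x" using u by blast
      then show ?thesis using D(4)[of g x] conj[of g x] g by (intro image_eqI[of _ _ "g \<otimes> x \<otimes> inv g"]) auto
    qed
  qed
qed

lemma equivariant_hom_mult:
  assumes A: "A \<lhd> G" and BC: "B \<subseteq> F" "C \<subseteq> F" and F: "subgroup F G"
    and comm: "\<And>x y. x \<in> F \<Longrightarrow> y \<in> F \<Longrightarrow> x \<otimes> y = y \<otimes> x"
    and \<theta>: "\<theta> \<in> equivariant_homs A B" and \<psi>: "\<psi> \<in> equivariant_homs A C"
  shows "restrict (\<lambda>x. \<theta> x \<otimes> \<psi> x) A \<in> equivariant_homs A F"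
proof (rule equivariant_homsI)
  interpret A: normal A G by fact
  interpret F: subgroup F G by fact
  note D = equivariant_homsD[OF \<theta>] and E = equivariant_homsD[OF \<psi>]
  have F1: "\<theta> x \<in> F" "\<psi> x \<in> F" if "x \<in> A" for x using D(1) E(1) BC that by auto
  show "restrict (\<lambda>x. \<theta> x \<otimes> \<psi> x) A x \<in> F" if "x \<in> A" for x using that F1 by auto
  show "restrict (\<lambda>x. \<theta> x \<otimes> \<psi> x) A x = undefined" if "x \<notin> A" for x using that by auto
  show "restrict (\<lambda>x. \<theta> x \<otimes> \<psi> x) A (x \<otimes> y) =
      restrict (\<lambda>x. \<theta> x \<otimes> \<psi> x) A x \<otimes> restrict (\<lambda>x. \<theta> x \<otimes> \<psi> x) A y" if xy: "x \<in> A" "y \<in> A" for x y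
  proof -
    have c: "\<theta> x \<in> carrier G" "\<theta> y \<in> carrier G" "\<psi> x \<in> carrier G" "\<psi> y \<in> carrier G" using F1 xy by auto
    have "\<theta> x \<otimes> \<theta> y \<otimes> (\<psi> x \<otimes> \<psi> y) = \<theta> x \<otimes> (\<theta> y \<otimes> \<psi> x) \<otimes> \<psi> y" using c by (simp add: m_assoc)
    also have "\<theta> y \<otimes> \<psi> x = \<psi> x \<otimes> \<theta> y" using comm F1 xy by blast
    finally show ?thesis using xy D(3)[OF xy] E(3)[OF xy] c by (simp add: m_assoc)
  qed
  show "restrict (\<lambda>x. \<theta> x \<otimes> \<psi> x) A (g \<otimes> x \<otimes> inv g) = g \<otimes> restrict (\<lambda>x. \<theta> x \<otimes> \<psi> x) A x \<otimes> inv g"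
    if g: "g \<in> carrier G" and x: "x \<in> A" for g x
  proof -
    have "g \<otimes> x \<otimes> inv g \<in> A" using A.inv_op_closed2 g x by blast
    then show ?thesis
      using hom_mult[OF conj_hom[OF g], of "\<theta> x" "\<psi> x"] D(4)[OF g x] E(4)[OF g x] F1[OF x] x by simp
  qed
qed

lemma equivariant_hom_inv:
  assumes A: "A \<lhd> G" and B: "B \<lhd> G"
    and comm: "\<And>x y. x \<in> B \<Longrightarrow> y \<in> B \<Longrightarrow> x \<otimes> y = y \<otimes> x"
    and \<theta>: "\<theta> \<in> equivariant_homs A B"
  shows "restrict (\<lambda>x. inv (\<theta> x)) A \<in> equivariant_homs A B"
proof (rule equivariant_homsI)
  interpret A: normal A G by fact
  interpret B: normal B G by fact
  note D = equivariant_homsD[OF \<theta>]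
  show "restrict (\<lambda>x. inv (\<theta> x)) A x \<in> B" if "x \<in> A" for x using that D(1) by auto
  show "restrict (\<lambda>x. inv (\<theta> x)) A (x \<otimes> y) =
      restrict (\<lambda>x. inv (\<theta> x)) A x \<otimes> restrict (\<lambda>x. inv (\<theta> x)) A y" if xy: "x \<in> A" "y \<in> A" for x y
  proof -
    have "\<theta> (x \<otimes> y) = \<theta> y \<otimes> \<theta> x" using D(3)[OF xy] comm D(1) xy by simp
    then show ?thesis using xy D(1) by (simp add: inv_mult_group)
  qed
  show "restrict (\<lambda>x. inv (\<theta> x)) A (g \<otimes> x \<otimes> inv g) = g \<otimes> restrict (\<lambda>x. inv (\<theta> x)) A x \<otimes> inv g"
    if g: "g \<in> carrier G" and x: "x \<in> A" for g x
  proof -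
    have "g \<otimes> x \<otimes> inv g \<in> A" using A.inv_op_closed2 g x by blast
    then show ?thesis using D(1)[OF x] D(4)[OF g x] g x by (simp add: inv_mult_group m_assoc)
  qed
qed auto

end

text \<open>Schur's lemma: a nontrivial homomorphism between simple modules is an isomorphism, and inversion is
  injective.\<close>

lemma (in group) card_homs_minimal_normal:
  assumes S: "minimal_normal G S" "finite S" and M: "minimal_normal G M" "finite M"
  shows "card (equivariant_homs S M) \<le> card (equivariant_homs M S)"
proof (rule card_inj_on_le)
  have nS: "S \<lhd> G" and nM: "M \<lhd> G" using S M by (auto simp: minimal_normal_def)
  interpret S: normal S G by fact
  interpret M: normal M G by fact
  define \<Psi> where "\<Psi> \<theta> = (if \<forall>x\<in>S. \<theta> x = \<one> then restrict (\<lambda>_. \<one>) M else restrict (the_inv_into S \<theta>) M)" for \<theta>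
  have nontriv: "inj_on \<theta> S" "\<theta> ` S = M" if \<theta>: "\<theta> \<in> equivariant_homs S M" and nt: "\<not> (\<forall>x\<in>S. \<theta> x = \<one>)" for \<theta>
  proof -
    note D = equivariant_homsD[OF \<theta>] and D' = equivariant_hom_one_inv[OF nS nM \<theta>]
    note KI = equivariant_hom_kernel_image[OF nS nM \<theta>]
    have "{x \<in> S. \<theta> x = \<one>} \<noteq> S" using nt by blast
    then have ker: "{x \<in> S. \<theta> x = \<one>} = {\<one>}" using KI(1) S(1) unfolding minimal_normal_def by blast
    have "\<theta> ` S \<subseteq> M" using D(1) by blast
    moreover have "\<theta> ` S \<noteq> {\<one>}" using nt by blast
    ultimately show "\<theta> ` S = M" using KI(2) M(1) unfolding minimal_normal_def by blast
    show "inj_on \<theta> S"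
    proof (rule inj_onI)
      fix x y assume xy: "x \<in> S" "y \<in> S" "\<theta> x = \<theta> y"
      then have "\<theta> (x \<otimes> inv y) = \<one>" using D(3)[of x "inv y"] D'(2)[of y] D(1)[of y] by simp
      moreover have "x \<otimes> inv y \<in> S" using xy by simp
      ultimately have "x \<otimes> inv y = \<one>" using ker by blast
      then show "x = y" using xy inv_equality[of x "inv y"] by simp
    qed
  qed
  show "\<Psi> ` equivariant_homs S M \<subseteq> equivariant_homs M S"
  proof (rule image_subsetI)
    fix \<theta> assume \<theta>: "\<theta> \<in> equivariant_homs S M"
    note D = equivariant_homsD[OF \<theta>]
    show "\<Psi> \<theta> \<in> equivariant_homs M S"
    proof (cases "\<forall>x\<in>S. \<theta> x = \<one>")
      case True
      have "restrict (\<lambda>_. \<one>) M \<in> equivariant_homs M S"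
        by (rule equivariant_homsI) (use M.inv_op_closed2 in auto)
      then show ?thesis using True by (simp add: \<Psi>_def)
    next
      case False
      note inj = nontriv(1)[OF \<theta> False] and im = nontriv(2)[OF \<theta> False]
      let ?\<psi> = "the_inv_into S \<theta>"
      have \<psi>: "?\<psi> u \<in> S" "\<theta> (?\<psi> u) = u" if "u \<in> M" for u
        using that the_inv_into_into[OF inj, of u S] f_the_inv_into_f[OF inj, of u] im by auto
      have \<psi>\<theta>: "?\<psi> (\<theta> x) = x" if "x \<in> S" for x using the_inv_into_f_f[OF inj that] .
      have "restrict ?\<psi> M \<in> equivariant_homs M S"
      proof (rule equivariant_homsI)
        show "restrict ?\<psi> M (u \<otimes> v) = restrict ?\<psi> M u \<otimes> restrict ?\<psi> M v" if "u \<in> M" "v \<in> M" for u v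
          using that \<psi> D(3)[of "?\<psi> u" "?\<psi> v"] \<psi>\<theta>[of "?\<psi> u \<otimes> ?\<psi> v"] by simp
        show "restrict ?\<psi> M (g \<otimes> u \<otimes> inv g) = g \<otimes> restrict ?\<psi> M u \<otimes> inv g"
          if "g \<in> carrier G" "u \<in> M" for g u
        proof -
          have "g \<otimes> u \<otimes> inv g \<in> M" "g \<otimes> ?\<psi> u \<otimes> inv g \<in> S"
            using that \<psi>(1) M.inv_op_closed2 S.inv_op_closed2 by auto
          then show ?thesis
            using that \<psi>(2)[OF that(2)] D(4)[OF that(1) \<psi>(1)[OF that(2)]] \<psi>\<theta>[of "g \<otimes> ?\<psi> u \<otimes> inv g"] by simp
        qed
      qed (use \<psi> in auto)
      then show ?thesis unfolding \<Psi>_def if_not_P[OF False] .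
    qed
  qed
  show "inj_on \<Psi> (equivariant_homs S M)"
  proof (rule inj_onI)
    fix \<theta> \<theta>' assume \<theta>: "\<theta> \<in> equivariant_homs S M" "\<theta>' \<in> equivariant_homs S M" "\<Psi> \<theta> = \<Psi> \<theta>'"
    have recover: "\<Psi> \<theta> (\<theta> x) = x" if "\<theta> \<in> equivariant_homs S M" "\<not> (\<forall>x\<in>S. \<theta> x = \<one>)" "x \<in> S" for \<theta> x
      using the_inv_into_f_f[OF nontriv(1)[OF that(1,2)] that(3)] equivariant_homsD(1)[OF that(1,3)]
      unfolding \<Psi>_def if_not_P[OF that(2)] by simp
    have triv: "\<Psi> \<theta> u = \<one>" if "\<forall>x\<in>S. \<theta> x = \<one>" "u \<in> M" for \<theta> u
      using that by (simp add: \<Psi>_def)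
    have nontriv_iff: "\<forall>x\<in>S. \<theta> x = \<one>"
      if \<theta>: "\<theta> \<in> equivariant_homs S M" "\<theta>' \<in> equivariant_homs S M" "\<Psi> \<theta> = \<Psi> \<theta>'" "\<forall>x\<in>S. \<theta>' x = \<one>" for \<theta> \<theta>'
    proof (rule ccontr)
      assume nt: "\<not> (\<forall>x\<in>S. \<theta> x = \<one>)"
      have "x = \<one>" if x: "x \<in> S" for x
        using recover[OF \<theta>(1) nt x] triv[OF \<theta>(4) equivariant_homsD(1)[OF \<theta>(1) x]] \<theta>(3) by simp
      then show False using S(1) S.one_closed unfolding minimal_normal_def by blast
    qed
    have "\<theta> x = \<theta>' x" for x
    proof (cases "x \<in> S")
      case x: True
      show ?thesis
      proof (cases "\<forall>x\<in>S. \<theta> x = \<one>")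
        case True
        then show ?thesis using nontriv_iff[OF \<theta>(2,1) \<theta>(3)[symmetric] True] x by simp
      next
        case False
        then have nt': "\<not> (\<forall>x\<in>S. \<theta>' x = \<one>)" using nontriv_iff[OF \<theta>] by blast
        have "\<theta> x \<in> \<theta>' ` S" using nontriv(2)[OF \<theta>(2) nt'] equivariant_homsD(1)[OF \<theta>(1) x] by simp
        then obtain y where y: "y \<in> S" "\<theta> x = \<theta>' y" by blast
        have "x = y" using recover[OF \<theta>(1) False x] recover[OF \<theta>(2) nt' y(1)] y(2) \<theta>(3) by simp
        then show ?thesis using y by simp
      qed
    next
      case False
      then show ?thesis using equivariant_homsD(2) \<theta>(1,2) by metis
    qed
    then show "\<theta> = \<theta>'" by blast
  qed
  show "finite (equivariant_homs M S)" by (rule equivariant_homs_finite[OF M(2) S(2)])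
qed

text \<open>A finite semisimple module: its submodules are the normal subgroups of \<open>G\<close> inside \<open>F\<close>, and each
  of them has a complement.\<close>

locale finite_semisimple = group G for G (structure) +
  fixes F
  assumes F_normal: "F \<lhd> G" and F_finite: "finite F"
    and F_comm: "\<And>x y. x \<in> F \<Longrightarrow> y \<in> F \<Longrightarrow> x \<otimes> y = y \<otimes> x"
    and F_complement: "\<And>A. A \<lhd> G \<Longrightarrow> A \<subseteq> F \<Longrightarrow> \<exists>N. N \<lhd> G \<and> N \<subseteq> F \<and> A \<inter> N = {\<one>} \<and> A <#> N = F"
begin

sublocale F: normal F G by (rule F_normal)

text \<open>Dedekind's modular law: intersect a complement of \<open>S\<close> in \<open>F\<close> with \<open>A\<close>.\<close>

lemma relative_complement:
  assumes A: "A \<lhd> G" "A \<subseteq> F" and S: "S \<lhd> G" "S \<subseteq> A"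
  obtains N where "N \<lhd> G" "N \<subseteq> A" "S \<inter> N = {\<one>}" "S <#> N = A"
proof -
  obtain N where N: "N \<lhd> G" "N \<subseteq> F" "S \<inter> N = {\<one>}" "S <#> N = F"
    using F_complement[OF S(1)] S A by blast
  interpret A: normal A G by fact
  interpret S: normal S G by fact
  interpret N: normal N G by fact
  have "A \<subseteq> S <#> (N \<inter> A)"
  proof
    fix a assume a: "a \<in> A"
    then have "a \<in> S <#> N" using N(4) A by blast
    then obtain s n where sn: "s \<in> S" "n \<in> N" "a = s \<otimes> n" by (auto simp: set_mult_def)
    then have "n = inv s \<otimes> a" by (simp add: m_assoc[symmetric])
    moreover have "inv s \<in> A" using sn(1) S(2) by auto
    ultimately have "n \<in> A" using a by simp
    then show "a \<in> S <#> (N \<inter> A)" using sn unfolding set_mult_def by blast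
  qed
  moreover have "S <#> (N \<inter> A) \<subseteq> A" by (rule set_mult_least[OF A.subgroup_axioms S(2)]) simp
  moreover have "S \<inter> (N \<inter> A) = {\<one>}" using N(3) S(2) by auto
  ultimately show ?thesis using that[of "N \<inter> A"] normal_Int[OF N(1) A(1)] by auto
qed

text \<open>Homomorphisms out of a direct product, and into one, are pairs of homomorphisms. This reduces the
  inequality to the case of a simple module \<open>A\<close>.\<close>

lemma card_homs_le:
  assumes "A \<lhd> G" "A \<subseteq> F" and M: "minimal_normal G M" "M \<subseteq> F"
  shows "card (equivariant_homs A M) \<le> card (equivariant_homs M A)"
  using assms(1,2)
proof (induction "card A" arbitrary: A rule: less_induct)
  case less
  note A = less.prems
  have nM: "M \<lhd> G" using M by (auto simp: minimal_normal_def)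
  interpret M: normal M G by fact
  interpret A: normal A G by fact
  have fin: "finite A" "finite M" using A M F_finite finite_subset by blast+
  show ?case
  proof (cases "A = {\<one>}")
    case True
    have "restrict (\<lambda>_. \<one>) M \<in> equivariant_homs M A"
      by (rule equivariant_homsI) (use M.inv_op_closed2 in auto)
    then have "1 \<le> card (equivariant_homs M A)"
      using equivariant_homs_finite[OF fin(2,1)] by (metis One_nat_def Suc_leI card_gt_0_iff empty_iff)
    moreover have "equivariant_homs A M \<subseteq> {restrict (\<lambda>_. \<one>) A}"
    proof
      fix \<theta> assume \<theta>: "\<theta> \<in> equivariant_homs A M"
      have "\<theta> = restrict (\<lambda>_. \<one>) A"
        using equivariant_hom_one_inv(1)[OF A(1) nM \<theta>] equivariant_homsD(2)[OF \<theta>] True by (intro ext) auto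
      then show "\<theta> \<in> {restrict (\<lambda>_. \<one>) A}" by simp
    qed
    then have "card (equivariant_homs A M) \<le> 1" using card_mono[of "{restrict (\<lambda>_. \<one>) A}"] by simp
    ultimately show ?thesis by simp
  next
    case False
    obtain S where S: "minimal_normal G S" "S \<subseteq> A" by (rule minimal_normal_below[OF A(1) fin(1) False])
    have nS: "S \<lhd> G" and S1: "S \<noteq> {\<one>}" using S by (auto simp: minimal_normal_def)
    interpret S: normal S G by fact
    obtain N where N: "N \<lhd> G" "N \<subseteq> A" "S \<inter> N = {\<one>}" "S <#> N = A"
      by (rule relative_complement[OF A nS S(2)])
    interpret N: normal N G by fact
    have finSN: "finite S" "finite N" using S(2) N(2) fin(1) finite_subset by blast+
    have "N \<noteq> A" using N(3) S(2) S1 by blast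
    then have "card N < card A" using N(2) fin(1) by (meson psubsetI psubset_card_mono)
    then have IH: "card (equivariant_homs N M) \<le> card (equivariant_homs M N)"
      using less.hyps N(1,2) A(2) by blast
    have "card (equivariant_homs A M) \<le> card (equivariant_homs S M \<times> equivariant_homs N M)"
    proof (rule card_inj_on_le)
      let ?f = "\<lambda>\<theta>. (restrict \<theta> S, restrict \<theta> N)"
      have restr: "restrict \<theta> B \<in> equivariant_homs B M"
        if \<theta>: "\<theta> \<in> equivariant_homs A M" and B: "B \<lhd> G" "B \<subseteq> A" for \<theta> B
      proof (rule equivariant_homsI)
        interpret B: normal B G by fact
        note D = equivariant_homsD[OF \<theta>]
        have BA: "x \<in> A" if "x \<in> B" for x using that B by blast
        show "restrict \<theta> B (x \<otimes> y) = restrict \<theta> B x \<otimes> restrict \<theta> B y" if "x \<in> B" "y \<in> B" for x y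
          using that D(3) BA by simp
        show "restrict \<theta> B (g \<otimes> x \<otimes> inv g) = g \<otimes> restrict \<theta> B x \<otimes> inv g" if "g \<in> carrier G" "x \<in> B" for g x
          using that D(4) BA B.inv_op_closed2 by simp
        show "restrict \<theta> B x \<in> M" if "x \<in> B" for x using that D(1) BA by simp
      qed auto
      show "?f ` equivariant_homs A M \<subseteq> equivariant_homs S M \<times> equivariant_homs N M"
        using restr nS S(2) N(1,2) by auto
      show "inj_on ?f (equivariant_homs A M)"
      proof (rule inj_onI)
        fix \<theta> \<theta>' assume \<theta>: "\<theta> \<in> equivariant_homs A M" "\<theta>' \<in> equivariant_homs A M" "?f \<theta> = ?f \<theta>'"
        have SN: "\<theta> x = \<theta>' x" if "x \<in> S \<or> x \<in> N" for x
          using \<theta>(3) that by (auto dest: fun_cong[of _ _ x])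
        have "\<theta> x = \<theta>' x" for x
        proof (cases "x \<in> A")
          case True
          then obtain s n where sn: "s \<in> S" "n \<in> N" "x = s \<otimes> n" using N(4) by (auto simp: set_mult_def)
          then have "s \<in> A" "n \<in> A" using S(2) N(2) by auto
          then show ?thesis
            using sn SN equivariant_homsD(3)[OF \<theta>(1)] equivariant_homsD(3)[OF \<theta>(2)] by simp
        next
          case False
          then show ?thesis using equivariant_homsD(2)[OF \<theta>(1)] equivariant_homsD(2)[OF \<theta>(2)] by simp
        qed
        then show "\<theta> = \<theta>'" by blast
      qed
      show "finite (equivariant_homs S M \<times> equivariant_homs N M)"
        by (intro finite_cartesian_product equivariant_homs_finite finSN fin)
    qed
    also have "\<dots> \<le> card (equivariant_homs M S \<times> equivariant_homs M N)"
      unfolding card_cartesian_product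
      by (rule mult_le_mono[OF card_homs_minimal_normal[OF S(1) finSN(1) M(1) fin(2)] IH])
    also have "\<dots> \<le> card (equivariant_homs M A)"
    proof (rule card_inj_on_le)
      let ?f = "\<lambda>(\<theta>, \<psi>). restrict (\<lambda>x. \<theta> x \<otimes> \<psi> x) M"
      have commA: "x \<otimes> y = y \<otimes> x" if "x \<in> A" "y \<in> A" for x y using F_comm A(2) that by blast
      show "?f ` (equivariant_homs M S \<times> equivariant_homs M N) \<subseteq> equivariant_homs M A"
        using equivariant_hom_mult[OF nM S(2) N(2) A.subgroup_axioms commA] by auto
      show "inj_on ?f (equivariant_homs M S \<times> equivariant_homs M N)"
      proof (rule inj_onI, clarify)
        fix \<theta> \<psi> \<theta>' \<psi>'
        assume h: "\<theta> \<in> equivariant_homs M S" "\<psi> \<in> equivariant_homs M N"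
          "\<theta>' \<in> equivariant_homs M S" "\<psi>' \<in> equivariant_homs M N"
          and eq: "restrict (\<lambda>x. \<theta> x \<otimes> \<psi> x) M = restrict (\<lambda>x. \<theta>' x \<otimes> \<psi>' x) M"
        have "\<theta> x = \<theta>' x \<and> \<psi> x = \<psi>' x" for x
        proof (cases "x \<in> M")
          case True
          then have m: "\<theta> x \<in> S" "\<theta>' x \<in> S" "\<psi> x \<in> N" "\<psi>' x \<in> N" using h equivariant_homsD(1) by blast+
          have e: "\<theta> x \<otimes> \<psi> x = \<theta>' x \<otimes> \<psi>' x" using fun_cong[OF eq, of x] True by simp
          then have "inv (\<theta>' x) \<otimes> (\<theta> x \<otimes> \<psi> x) \<otimes> inv (\<psi> x) = inv (\<theta>' x) \<otimes> (\<theta>' x \<otimes> \<psi>' x) \<otimes> inv (\<psi> x)" by simp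
          then have e': "inv (\<theta>' x) \<otimes> \<theta> x = \<psi>' x \<otimes> inv (\<psi> x)"
            using m by (simp add: m_assoc) (simp add: m_assoc[symmetric])
          moreover have "inv (\<theta>' x) \<otimes> \<theta> x \<in> S" "\<psi>' x \<otimes> inv (\<psi> x) \<in> N" using m by auto
          ultimately have "inv (\<theta>' x) \<otimes> \<theta> x = \<one>" using N(3) by auto
          then have "\<theta> x = \<theta>' x" using m by (metis S.mem_carrier inv_closed inv_equality inv_inv)
          moreover from this e m have "\<psi> x = \<psi>' x" by simp
          ultimately show ?thesis by blast
        next
          case False
          then show ?thesis using h equivariant_homsD(2) by metis
        qed
        then show "\<theta> = \<theta>' \<and> \<psi> = \<psi>'" by blast
      qed
      show "finite (equivariant_homs M A)" by (rule equivariant_homs_finite[OF fin(2,1)])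
    qed
    finally show ?thesis .
  qed
qed

end

section \<open>Cyclic semisimple modules\<close>

text \<open>The value \<open>1\<close> at the unit excludes the zero function. Off \<open>M\<close> the value is \<open>0\<close>, so that
  characters are elements of a space of dimension \<open>card M\<close>.\<close>

definition (in group) characters :: "'a set \<Rightarrow> ('a \<Rightarrow> complex) set"
  where "characters M = {\<phi>. \<phi> \<one> = 1 \<and> (\<forall>x\<in>M. \<forall>y\<in>M. \<phi> (x \<otimes> y) = \<phi> x * \<phi> y) \<and> (\<forall>x. x \<notin> M \<longrightarrow> \<phi> x = 0)}"

text \<open>Characters are simultaneous eigenvectors of the translations, hence independent.\<close>

lemma (in group) characters_card_le:
  assumes M: "subgroup M G" "finite M"
  shows "finite (characters M) \<and> card (characters M) \<le> card M"
proof -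
  interpret F: vector_space "\<lambda>c f x. c * f x :: complex"
    by unfold_locales (auto simp: fun_eq_iff algebra_simps)
  interpret M: subgroup M G by fact
  define T where "T a \<phi> = (\<lambda>x. if x \<in> M then \<phi> (a \<otimes> x) else 0 :: complex)" for a \<phi>
  define \<delta> where "\<delta> a = (\<lambda>x. if x = a then 1 else 0 :: complex)" for a :: 'a
  have "\<not> F.dependent (characters M)"
  proof (rule F.independent_simultaneous_eigenvectors[where I = M and T = T and \<chi> = "\<lambda>\<phi>. \<phi>"])
    show "0 \<notin> characters M" by (auto simp: characters_def fun_eq_iff)
    show "Vector_Spaces.linear (\<lambda>c f x. c * f x) (\<lambda>c f x. c * f x) (T a)" if "a \<in> M" for a
      by unfold_locales (auto simp: T_def fun_eq_iff algebra_simps)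
    show "T a \<phi> = (\<lambda>x. \<phi> a * \<phi> x)" if "\<phi> \<in> characters M" "a \<in> M" for \<phi> a
      using that by (auto simp: T_def characters_def fun_eq_iff)
    show "\<exists>a\<in>M. \<phi> a \<noteq> \<psi> a" if h: "\<phi> \<in> characters M" "\<psi> \<in> characters M" "\<phi> \<noteq> \<psi>" for \<phi> \<psi>
    proof -
      obtain x where "\<phi> x \<noteq> \<psi> x" using h(3) by blast
      moreover from this have "x \<in> M" using h by (auto simp: characters_def)
      ultimately show ?thesis by blast
    qed
  qed
  moreover have "characters M \<subseteq> F.span (\<delta> ` M)"
  proof
    fix \<phi> assume \<phi>: "\<phi> \<in> characters M"
    have "\<phi> = (\<Sum>a\<in>M. (\<lambda>x. \<phi> a * \<delta> a x))"
      using M(2) \<phi>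
      by (auto simp: characters_def \<delta>_def fun_eq_iff sum_fun_apply if_distrib[of "\<lambda>z. _ * z"] cong: if_cong)
    also have "\<dots> \<in> F.span (\<delta> ` M)"
      by (intro F.span_sum F.span_scale F.span_base) auto
    finally show "\<phi> \<in> F.span (\<delta> ` M)" .
  qed
  ultimately have "finite (characters M)" "card (characters M) \<le> card (\<delta> ` M)"
    using F.independent_span_bound[OF finite_imageI[OF M(2)]] by blast+
  then show ?thesis using card_image_le[OF M(2), of \<delta>] by simp
qed

context finite_semisimple
begin

text \<open>Let \<open>C\<close> be generated by one element \<open>x\<close>, of largest size, and \<open>M\<close> simple with
  \<open>C \<inter> M = {\<one>}\<close>. For \<open>m \<in> M\<close> the module generated by \<open>x \<otimes> m\<close> is not larger than \<open>C\<close>, so it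
  meets \<open>M\<close> trivially and is the graph of a homomorphism from \<open>C\<close> to \<open>M\<close> with \<open>x \<mapsto> m\<close>.
  Hence \<open>M\<close> has at least \<open>card M\<close> homomorphisms to \<open>C\<close>. Composition with \<open>\<chi>\<close> is injective on
  the homomorphisms from \<open>M\<close> to \<open>F\<close>, since \<open>K\<close> contains no submodule. So it already maps the
  homomorphisms to \<open>C\<close> onto the characters of \<open>M\<close>, and the inclusion of \<open>M\<close> in \<open>F\<close> must
  be one of them.\<close>

theorem cyclic_if_core_free_cocyclic:
  assumes core: "\<And>N. N \<lhd> G \<Longrightarrow> N \<subseteq> K \<Longrightarrow> N = {\<one>}"
    and expo: "\<And>M. minimal_normal G M \<Longrightarrow> M \<subseteq> F \<Longrightarrow>
      \<exists>p::nat. Factorial_Ring.prime p \<and> (\<forall>x\<in>M. x [^] p = \<one>)"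
    and char: "\<And>p::nat. Factorial_Ring.prime p \<Longrightarrow> \<exists>\<chi>\<in>characters {y \<in> F. y [^] p = \<one>}.
      \<forall>y\<in>F. y [^] p = \<one> \<longrightarrow> \<chi> y = 1 \<longrightarrow> y \<in> K"
  obtains x where "x \<in> F" "normal_closure x = F"
proof -
  have FG: "x \<in> carrier G" if "x \<in> F" for x using that by simp
  have nc: "normal_closure x \<lhd> G" "x \<in> normal_closure x" "normal_closure x \<subseteq> F" if "x \<in> F" for x
    using normal_closure_normal[OF FG[OF that]] normal_closure_self[OF FG[OF that]]
      normal_closure_minimal[OF F_normal that] by auto
  have "\<forall>y. y \<in> F \<longrightarrow> card (normal_closure y) < Suc (card F)"
    using nc(3) F_finite by (auto simp: less_Suc_eq_le intro: card_mono)
  from ex_has_greatest_nat[of "\<lambda>x. x \<in> F", OF F.one_closed this]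
  obtain x where x: "x \<in> F" and max: "\<forall>y. y \<in> F \<longrightarrow> card (normal_closure y) \<le> card (normal_closure x)"
    by blast
  define C where "C = normal_closure x"
  have C: "C \<lhd> G" "x \<in> C" "C \<subseteq> F" using nc[OF x] by (auto simp: C_def)
  have "C = F"
  proof (rule ccontr)
    assume "C \<noteq> F"
    obtain D where D: "D \<lhd> G" "D \<subseteq> F" "C \<inter> D = {\<one>}" "C <#> D = F"
      using F_complement[OF C(1,3)] by blast
    have "D \<noteq> {\<one>}"
    proof
      assume "D = {\<one>}"
      then have "C <#> D \<subseteq> C"
        using normal_imp_subgroup[OF C(1)] subgroup.one_closed by (intro set_mult_least) auto
      with D(4) C(3) \<open>C \<noteq> F\<close> show False by blast
    qed
    then obtain M where M: "minimal_normal G M" "M \<subseteq> D"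
      using minimal_normal_below[OF D(1)] D(2) F_finite finite_subset by blast
    have nM: "M \<lhd> G" and M1: "M \<noteq> {\<one>}" using M by (auto simp: minimal_normal_def)
    have MF: "M \<subseteq> F" using M D by blast
    have CM: "C \<inter> M = {\<one>}"
    proof
      show "C \<inter> M \<subseteq> {\<one>}" using D(3) M(2) by blast
      show "{\<one>} \<subseteq> C \<inter> M"
        using subgroup.one_closed[OF normal_imp_subgroup[OF C(1)]]
          subgroup.one_closed[OF normal_imp_subgroup[OF nM]] by blast
    qed
    interpret C: normal C G by (rule C(1))
    interpret M: normal M G by fact
    have fin: "finite C" "finite M" using C MF F_finite finite_subset by blast+
    have comm: "a \<otimes> b = b \<otimes> a" if "a \<in> F" "b \<in> F" for a b by (rule F_comm[OF that])
    \<comment> \<open>maximality of \<open>C\<close>: every element of \<open>M\<close> is the image of \<open>x\<close> under a homomorphism\<close>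
    have hom: "\<exists>\<theta>\<in>equivariant_homs C M. \<theta> x = m" if m: "m \<in> M" for m
    proof -
      define \<Gamma> where "\<Gamma> = normal_closure (x \<otimes> m)"
      have xm: "x \<otimes> m \<in> F" using x m MF by blast
      have \<Gamma>: "\<Gamma> \<lhd> G" "x \<otimes> m \<in> \<Gamma>" "\<Gamma> \<subseteq> F" using nc[OF xm] by (auto simp: \<Gamma>_def)
      interpret \<Gamma>: normal \<Gamma> G by (rule \<Gamma>(1))
      have "\<not> M \<subseteq> \<Gamma>"
      proof
        assume sub: "M \<subseteq> \<Gamma>"
        have "x = (x \<otimes> m) \<otimes> inv m" using x m by (simp add: m_assoc)
        moreover have "inv m \<in> \<Gamma>" using sub m by blast
        ultimately have "x \<in> \<Gamma>" using \<Gamma>(2) \<Gamma>.m_closed by metis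
        then have "C \<subseteq> \<Gamma>" unfolding C_def by (rule normal_closure_minimal[OF \<Gamma>(1)])
        moreover have "C \<noteq> \<Gamma>" using CM sub M1 by blast
        ultimately have "card C < card \<Gamma>"
          using \<Gamma>(3) F_finite by (intro psubset_card_mono) (auto intro: finite_subset)
        then show False using max xm by (auto simp: C_def \<Gamma>_def)
      qed
      then have \<Gamma>M: "M \<inter> \<Gamma> = {\<one>}" by (rule minimal_normal_Int[OF M(1) \<Gamma>(1)])
      have n\<Gamma>M: "\<Gamma> <#> M \<lhd> G" by (rule normal_set_mult[OF \<Gamma>(1) nM])
      have "x = (x \<otimes> m) \<otimes> inv m" using x m by (simp add: m_assoc)
      then have "x \<in> \<Gamma> <#> M" using \<Gamma>(2) m M.m_inv_closed unfolding set_mult_def by blast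
      then have sub: "C \<subseteq> \<Gamma> <#> M" unfolding C_def by (rule normal_closure_minimal[OF n\<Gamma>M])
      have ex: "\<exists>m'\<in>M. c \<otimes> m' \<in> \<Gamma>" if c: "c \<in> C" for c
      proof -
        obtain \<gamma> m' where g: "\<gamma> \<in> \<Gamma>" "m' \<in> M" "c = \<gamma> \<otimes> m'" using sub c by (auto simp: set_mult_def)
        then have "c \<otimes> inv m' \<in> \<Gamma>" by (simp add: m_assoc)
        then show ?thesis using g M.m_inv_closed by blast
      qed
      have uniq: "m1 = m2" if "c \<in> C" "m1 \<in> M" "m2 \<in> M" "c \<otimes> m1 \<in> \<Gamma>" "c \<otimes> m2 \<in> \<Gamma>" for c m1 m2
      proof -
        have "inv (c \<otimes> m1) \<otimes> (c \<otimes> m2) \<in> \<Gamma>" using that by simp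
        moreover have "inv (c \<otimes> m1) \<otimes> (c \<otimes> m2) = inv m1 \<otimes> (inv c \<otimes> c) \<otimes> m2"
          using that by (simp only: inv_mult_group m_assoc C.mem_carrier M.mem_carrier m_closed inv_closed)
        ultimately have "inv m1 \<otimes> m2 \<in> M \<inter> \<Gamma>" using that by simp
        then have "inv m1 \<otimes> m2 = \<one>" using \<Gamma>M by blast
        then show ?thesis using that by (metis M.mem_carrier inv_closed inv_equality inv_inv)
      qed
      define \<theta> where "\<theta> = restrict (\<lambda>c. SOME m'. m' \<in> M \<and> c \<otimes> m' \<in> \<Gamma>) C"
      have \<theta>: "\<theta> c \<in> M" "c \<otimes> \<theta> c \<in> \<Gamma>" if c: "c \<in> C" for c
        using someI_ex[of "\<lambda>m'. m' \<in> M \<and> c \<otimes> m' \<in> \<Gamma>"] ex[OF c] c by (auto simp: \<theta>_def)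
      have "\<theta> \<in> equivariant_homs C M"
      proof (rule equivariant_homsI)
        show "\<theta> (c \<otimes> d) = \<theta> c \<otimes> \<theta> d" if cd: "c \<in> C" "d \<in> C" for c d
        proof (rule uniq[of "c \<otimes> d"])
          have "d \<otimes> \<theta> c = \<theta> c \<otimes> d" by (intro comm subsetD[OF C(3)] subsetD[OF MF] cd \<theta>)
          then have "c \<otimes> d \<otimes> (\<theta> c \<otimes> \<theta> d) = c \<otimes> \<theta> c \<otimes> (d \<otimes> \<theta> d)"
            using cd \<theta> by (simp add: m_assoc) (simp add: m_assoc[symmetric])
          then show "c \<otimes> d \<otimes> (\<theta> c \<otimes> \<theta> d) \<in> \<Gamma>" using \<theta> cd by simp
        qed (use cd \<theta> in auto)
        show "\<theta> (g \<otimes> c \<otimes> inv g) = g \<otimes> \<theta> c \<otimes> inv g" if g: "g \<in> carrier G" and c: "c \<in> C" for g c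
        proof (rule uniq[of "g \<otimes> c \<otimes> inv g"])
          have "g \<otimes> c \<otimes> inv g \<otimes> (g \<otimes> \<theta> c \<otimes> inv g) = g \<otimes> (c \<otimes> \<theta> c) \<otimes> inv g"
            using hom_mult[OF conj_hom[OF g], of c "\<theta> c"] c \<theta> by simp
          then show "g \<otimes> c \<otimes> inv g \<otimes> (g \<otimes> \<theta> c \<otimes> inv g) \<in> \<Gamma>"
            using \<Gamma>.inv_op_closed2[OF g \<theta>(2)[OF c]] by simp
        qed (use g c \<theta> C.inv_op_closed2 M.inv_op_closed2 in auto)
      qed (use \<theta> in \<open>auto simp: \<theta>_def\<close>)
      moreover have "\<theta> x = m" using uniq[OF C(2) \<theta>(1)[OF C(2)] m \<theta>(2)[OF C(2)] \<Gamma>(2)] .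
      ultimately show ?thesis by blast
    qed
    have "card M \<le> card (equivariant_homs C M)"
    proof (rule surj_card_le)
      show "finite (equivariant_homs C M)" by (rule equivariant_homs_finite[OF fin])
      show "M \<subseteq> (\<lambda>\<theta>. \<theta> x) ` equivariant_homs C M" using hom by blast
    qed
    also have "\<dots> \<le> card (equivariant_homs M C)" by (rule card_homs_le[OF C(1,3) M(1) MF])
    finally have many: "card M \<le> card (equivariant_homs M C)" .
    obtain p :: nat where p: "Factorial_Ring.prime p" "\<forall>x\<in>M. x [^] p = \<one>" using expo[OF M(1) MF] by blast
    let ?P = "{y \<in> F. y [^] p = \<one>}"
    obtain \<chi> where \<chi>: "\<chi> \<in> characters ?P" "\<forall>y\<in>F. y [^] p = \<one> \<longrightarrow> \<chi> y = 1 \<longrightarrow> y \<in> K"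
      using char[OF p(1)] by blast
    have \<chi>_mult: "\<chi> (y \<otimes> z) = \<chi> y * \<chi> z" if "y \<in> ?P" "z \<in> ?P" for y z
      using \<chi>(1) that unfolding characters_def by blast
    have \<chi>_one: "\<chi> \<one> = 1" using \<chi>(1) unfolding characters_def by blast
    have P_pow: "\<psi> m \<in> ?P" if \<psi>: "\<psi> \<in> equivariant_homs M F" and m: "m \<in> M" for \<psi> m
    proof -
      note E = equivariant_homsD[OF \<psi>]
      have "\<psi> (m [^] n) = \<psi> m [^] n" for n :: nat
      proof (induction n)
        case (Suc n)
        have "m [^] n \<in> M" using m by (induction n) auto
        then show ?case using Suc E(3) m by simp
      qed (simp add: equivariant_hom_one_inv(1)[OF nM F_normal \<psi>])
      then have "\<psi> m [^] p = \<one>" using p(2) m equivariant_hom_one_inv(1)[OF nM F_normal \<psi>] by metis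
      then show ?thesis using E(1)[OF m] by simp
    qed
    have mono: "equivariant_homs M B \<subseteq> equivariant_homs M F" if "B \<subseteq> F" for B
      using that by (auto simp: equivariant_homs_def PiE_def Pi_def)
    \<comment> \<open>homomorphisms agreeing under \<open>\<chi>\<close> differ by a submodule of \<open>K\<close>\<close>
    have agree: "\<psi> = \<psi>'" if h: "\<psi> \<in> equivariant_homs M F" "\<psi>' \<in> equivariant_homs M F"
      "\<And>m. m \<in> M \<Longrightarrow> \<chi> (\<psi> m) = \<chi> (\<psi>' m)" for \<psi> \<psi>'
    proof -
      let ?i = "restrict (\<lambda>m. inv (\<psi>' m)) M"
      let ?d = "restrict (\<lambda>m. \<psi> m \<otimes> ?i m) M"
      have i: "?i \<in> equivariant_homs M F" by (rule equivariant_hom_inv[OF nM F_normal F_comm h(2)])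
      have d: "?d \<in> equivariant_homs M F"
        by (rule equivariant_hom_mult[OF nM order.refl order.refl F.subgroup_axioms F_comm h(1) i])
      have dK: "?d m \<in> K" if m: "m \<in> M" for m
      proof -
        have a: "\<psi> m \<in> ?P" "\<psi>' m \<in> ?P" "?i m \<in> ?P" using P_pow h i m by blast+
        have "\<chi> (\<psi>' m \<otimes> ?i m) = 1" using a(2) m \<chi>_one by simp
        then have "\<chi> (\<psi> m \<otimes> ?i m) = 1" using \<chi>_mult[OF a(1,3)] \<chi>_mult[OF a(2,3)] h(3)[OF m] by simp
        then show ?thesis using \<chi>(2) P_pow[OF d m] m by simp
      qed
      have "?d ` M = {\<one>}"
        by (rule core[OF equivariant_hom_kernel_image(2)[OF nM F_normal d]]) (use dK in blast)
      then have d1: "?d m = \<one>" if "m \<in> M" for m using that by blast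
      have "\<psi> m = \<psi>' m" for m
      proof (cases "m \<in> M")
        case True
        have c: "\<psi> m \<in> carrier G" "\<psi>' m \<in> carrier G" using h equivariant_homsD(1) True FG by blast+
        have "\<psi> m \<otimes> inv (\<psi>' m) = \<one>" using d1[OF True] True by simp
        then show ?thesis using c inv_equality[of "\<psi> m" "inv (\<psi>' m)"] by simp
      next
        case False
        then show ?thesis using h equivariant_homsD(2) by metis
      qed
      then show ?thesis by blast
    qed
    define \<Phi> where "\<Phi> \<psi> = (\<lambda>m. if m \<in> M then \<chi> (\<psi> m) else 0)" for \<psi>
    have \<Phi>_char: "\<Phi> \<psi> \<in> characters M" if \<psi>: "\<psi> \<in> equivariant_homs M F" for \<psi>
      using equivariant_homsD(3)[OF \<psi>] P_pow[OF \<psi>] \<chi>_mult \<chi>_one equivariant_hom_one_inv(1)[OF nM F_normal \<psi>]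
      by (auto simp: characters_def \<Phi>_def)
    have \<Phi>_inj: "\<psi> = \<psi>'" if "\<psi> \<in> equivariant_homs M F" "\<psi>' \<in> equivariant_homs M F" "\<Phi> \<psi> = \<Phi> \<psi>'" for \<psi> \<psi>'
    proof (rule agree[OF that(1,2)])
      show "\<chi> (\<psi> m) = \<chi> (\<psi>' m)" if "m \<in> M" for m
        using fun_cong[OF \<open>\<Phi> \<psi> = \<Phi> \<psi>'\<close>, of m] that by (simp add: \<Phi>_def)
    qed
    have "card (\<Phi> ` equivariant_homs M C) = card (equivariant_homs M C)"
      by (rule card_image, rule inj_onI) (use \<Phi>_inj mono[OF C(3)] in blast)
    then have "card (characters M) \<le> card (\<Phi> ` equivariant_homs M C)"
      using many characters_card_le[OF M.subgroup_axioms fin(2)] by simp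
    moreover have "\<Phi> ` equivariant_homs M C \<subseteq> characters M" using \<Phi>_char mono[OF C(3)] by blast
    ultimately have surj: "\<Phi> ` equivariant_homs M C = characters M"
      using characters_card_le[OF M.subgroup_axioms fin(2)] by (intro card_seteq) auto
    have id: "restrict (\<lambda>m. m) M \<in> equivariant_homs M F"
      by (rule equivariant_homsI) (use MF M.inv_op_closed2 in auto)
    then obtain \<psi> where \<psi>: "\<psi> \<in> equivariant_homs M C" "\<Phi> \<psi> = \<Phi> (restrict (\<lambda>m. m) M)"
      using \<Phi>_char surj by (metis imageE)
    then have "\<psi> = restrict (\<lambda>m. m) M" using \<Phi>_inj[OF _ id] mono[OF C(3)] by blast
    then have "M \<subseteq> C" using equivariant_homsD(1)[OF \<psi>(1)] by auto
    then show False using CM M1 M.one_closed by blast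
  qed
  then show ?thesis using that[OF x] by (simp add: C_def)
qed

end

section \<open>Fixed vectors in a faithful simple module\<close>

definition group_ring_monomial ::
    "('r, 's) ring_scheme \<Rightarrow> 'r \<Rightarrow> 'g \<Rightarrow> 'g \<Rightarrow> 'r"
  where "group_ring_monomial R c g = (\<lambda>x. if x = g then c else \<zero>\<^bsub>R\<^esub>)"

lemma group_ring_single_monomial: "group_ring_single R G g = group_ring_monomial R \<one>\<^bsub>R\<^esub> g"
  by (simp add: group_ring_single_def group_ring_monomial_def)

lemma group_ring_monomial_closed:
  assumes "ring R" "g \<in> carrier G" "c \<in> carrier R"
  shows "group_ring_monomial R c g \<in> carrier (group_ring R G)"
proof -
  interpret ring R by fact
  show ?thesis
    by (rule group_ring_carrierI[where S = "{g}"])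
       (use assms in \<open>auto simp: group_ring_monomial_def split: if_splits\<close>)
qed

lemma group_ring_monomial_mult:
  assumes R: "ring R" and G: "group G" and g: "g \<in> carrier G" "h \<in> carrier G"
    and c: "c \<in> carrier R" "d \<in> carrier R"
  shows "group_ring_monomial R c g \<otimes>\<^bsub>group_ring R G\<^esub> group_ring_monomial R d h =
    group_ring_monomial R (c \<otimes>\<^bsub>R\<^esub> d) (g \<otimes>\<^bsub>G\<^esub> h)"
proof
  fix x
  interpret R: ring R by fact
  interpret G: group G by fact
  have supp: "supp R G (group_ring_monomial R c g) \<subseteq> {g}"
    by (auto simp: supp_def group_ring_monomial_def split: if_splits)
  have "inv\<^bsub>G\<^esub> g \<otimes>\<^bsub>G\<^esub> x = h \<longleftrightarrow> x = g \<otimes>\<^bsub>G\<^esub> h" if "x \<in> carrier G"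
    using that g G.inv_solve_left'[of h g x] by (metis G.inv_solve_left)
  then show "(group_ring_monomial R c g \<otimes>\<^bsub>group_ring R G\<^esub> group_ring_monomial R d h) x =
    group_ring_monomial R (c \<otimes>\<^bsub>R\<^esub> d) (g \<otimes>\<^bsub>G\<^esub> h) x"
    using g c
    by (subst group_ring_mult_eq[OF R G group_ring_monomial_closed[OF R g(1) c(1)]
          group_ring_monomial_closed[OF R g(2) c(2)] _ supp])
       (auto simp: group_ring_monomial_def)
qed

locale faithful_rep = group G + K: field K
  for G :: "('g, 'h) monoid_scheme" (structure) and K :: "('k, 's) ring_scheme"
    and V :: "('g \<Rightarrow> 'k, 'v, 'm) module_scheme" +
  assumes rep: "faithful_irreducible_rep K G V"
begin

lemma V_simple: "simple_module (group_ring K G) V"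
  using rep by (simp add: faithful_irreducible_rep_def)

sublocale VM: left_module "group_ring K G" V
  using V_simple by (simp add: simple_module_def)

definition scaled_act :: "'k \<Rightarrow> 'g \<Rightarrow> 'v \<Rightarrow> 'v"
  where "scaled_act c g v = group_ring_monomial K c g \<odot>\<^bsub>V\<^esub> v"

abbreviation act :: "'g \<Rightarrow> 'v \<Rightarrow> 'v"
  where "act \<equiv> scaled_act \<one>\<^bsub>K\<^esub>"

lemma monomial_closed:
  "c \<in> carrier K \<Longrightarrow> g \<in> carrier G \<Longrightarrow> group_ring_monomial K c g \<in> carrier (group_ring K G)"
  by (rule group_ring_monomial_closed[OF K.ring_axioms])

lemma scaled_act_closed [simp]:
  "c \<in> carrier K \<Longrightarrow> g \<in> carrier G \<Longrightarrow> v \<in> carrier V \<Longrightarrow> scaled_act c g v \<in> carrier V"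
  unfolding scaled_act_def by (intro VM.smult_closed monomial_closed)

lemma scaled_act_add:
  "c \<in> carrier K \<Longrightarrow> g \<in> carrier G \<Longrightarrow> v \<in> carrier V \<Longrightarrow> w \<in> carrier V \<Longrightarrow>
    scaled_act c g (v \<oplus>\<^bsub>V\<^esub> w) = scaled_act c g v \<oplus>\<^bsub>V\<^esub> scaled_act c g w"
  unfolding scaled_act_def by (intro VM.smult_r_distr monomial_closed)

lemma scaled_act_mult:
  assumes "c \<in> carrier K" "d \<in> carrier K" "g \<in> carrier G" "h \<in> carrier G" "v \<in> carrier V"
  shows "scaled_act c g (scaled_act d h v) = scaled_act (c \<otimes>\<^bsub>K\<^esub> d) (g \<otimes> h) v"
  unfolding scaled_act_def
  using VM.smult_assoc1[OF monomial_closed[OF assms(1,3)] monomial_closed[OF assms(2,4)] assms(5)]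
    group_ring_monomial_mult[OF K.ring_axioms group_axioms assms(3,4,1,2)] by simp

lemma act_mult: "g \<in> carrier G \<Longrightarrow> h \<in> carrier G \<Longrightarrow> v \<in> carrier V \<Longrightarrow> act (g \<otimes> h) v = act g (act h v)"
  by (simp add: scaled_act_mult)

lemma act_one [simp]: "v \<in> carrier V \<Longrightarrow> act \<one> v = v"
  using VM.smult_one[of v]
  by (simp add: scaled_act_def group_ring_simps group_ring_single_monomial)

lemma scaled_act_zero [simp]:
  assumes "c \<in> carrier K" "g \<in> carrier G"
  shows "scaled_act c g \<zero>\<^bsub>V\<^esub> = \<zero>\<^bsub>V\<^esub>"
proof -
  have "scaled_act c g \<zero>\<^bsub>V\<^esub> \<oplus>\<^bsub>V\<^esub> scaled_act c g \<zero>\<^bsub>V\<^esub> = scaled_act c g \<zero>\<^bsub>V\<^esub>"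
    using scaled_act_add[OF assms, of "\<zero>\<^bsub>V\<^esub>" "\<zero>\<^bsub>V\<^esub>"] by simp
  then show ?thesis using assms VM.M.add.l_cancel_one[of "scaled_act c g \<zero>\<^bsub>V\<^esub>" "scaled_act c g \<zero>\<^bsub>V\<^esub>"] by simp
qed

lemma smult_zero_left:
  assumes "v \<in> carrier V"
  shows "\<zero>\<^bsub>group_ring K G\<^esub> \<odot>\<^bsub>V\<^esub> v = \<zero>\<^bsub>V\<^esub>"
proof -
  let ?z = "\<zero>\<^bsub>group_ring K G\<^esub> \<odot>\<^bsub>V\<^esub> v"
  have c: "?z \<in> carrier V" using assms by simp
  have "?z \<oplus>\<^bsub>V\<^esub> ?z = ?z"
    using VM.smult_l_distr[OF VM.R.zero_closed VM.R.zero_closed assms] by simp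
  then show ?thesis using c VM.M.add.l_cancel_one[of ?z ?z] by simp
qed

lemma act_inv [simp]:
  "g \<in> carrier G \<Longrightarrow> v \<in> carrier V \<Longrightarrow> act (inv g) (act g v) = v"
  "g \<in> carrier G \<Longrightarrow> v \<in> carrier V \<Longrightarrow> act g (act (inv g) v) = v"
  using act_mult[of "inv g" g v] act_mult[of g "inv g" v] by simp_all

lemma trivial_action_faithful:
  assumes g: "g \<in> carrier G" and triv: "\<And>v. v \<in> carrier V \<Longrightarrow> act g v = v"
  shows "g = \<one>"
proof -
  have "afforded_rep K G V g = \<one>\<^bsub>BijGroup (carrier V)\<^esub>"
    using triv
    by (auto simp: afforded_rep_def BijGroup_def scaled_act_def group_ring_single_monomial
        intro!: restrict_ext)
  then have "g \<in> kernel G (BijGroup (carrier V)) (afforded_rep K G V)"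
    using g by (simp add: kernel_def)
  then show ?thesis using rep by (simp add: faithful_irreducible_rep_def)
qed

definition fixed_vectors :: "'g set \<Rightarrow> 'v set"
  where "fixed_vectors N = {v \<in> carrier V. \<forall>n\<in>N. act n v = v}"

text \<open>Scalars commute with the group, and \<open>n g = g (g\<^sup>-\<^sup>1 n g)\<close> with \<open>g\<^sup>-\<^sup>1 n g \<in> N\<close>; so
  monomials preserve the fixed vectors, and all elements of the group ring are sums of monomials.\<close>

lemma fixed_vectors_submodule:
  assumes N: "N \<lhd> G"
  shows "submodule (fixed_vectors N) (group_ring K G) V"
proof -
  interpret N: normal N G by fact
  let ?W = "fixed_vectors N"
  have add: "v \<oplus>\<^bsub>V\<^esub> w \<in> ?W" if "v \<in> ?W" "w \<in> ?W" for v w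
    using that by (auto simp: fixed_vectors_def scaled_act_add)
  have zero: "\<zero>\<^bsub>V\<^esub> \<in> ?W" by (auto simp: fixed_vectors_def)
  have mono: "scaled_act c g v \<in> ?W" if c: "c \<in> carrier K" and g: "g \<in> carrier G" and v: "v \<in> ?W" for c g v
  proof -
    have vV: "v \<in> carrier V" using v by (simp add: fixed_vectors_def)
    have "act n (scaled_act c g v) = scaled_act c g v" if n: "n \<in> N" for n
    proof -
      let ?n = "inv g \<otimes> n \<otimes> g"
      have nN: "?n \<in> N" using N.inv_op_closed1[OF g n] .
      have nG: "n \<in> carrier G" using n by simp
      have "act n (scaled_act c g v) = scaled_act c (n \<otimes> g) v"
        using c g nG vV by (simp add: scaled_act_mult)
      also have "n \<otimes> g = g \<otimes> ?n" using g nG by (simp add: m_assoc[symmetric])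
      also have "scaled_act c (g \<otimes> ?n) v = scaled_act c g (act ?n v)"
        using c g nG vV by (simp add: scaled_act_mult)
      also have "act ?n v = v" using v nN by (simp add: fixed_vectors_def)
      finally show ?thesis .
    qed
    then show ?thesis using c g vV by (simp add: fixed_vectors_def)
  qed
  have smult: "\<forall>a\<in>carrier (group_ring K G). supp K G a \<subseteq> S \<longrightarrow> a \<odot>\<^bsub>V\<^esub> v \<in> ?W"
    if "finite S" "S \<subseteq> carrier G" "v \<in> ?W" for S v
    using that
  proof (induction S)
    case empty
    show ?case
    proof (intro ballI impI)
      fix a assume a: "a \<in> carrier (group_ring K G)" "supp K G a \<subseteq> {}"
      have "a = \<zero>\<^bsub>group_ring K G\<^esub>"
      proof
        fix x show "a x = \<zero>\<^bsub>group_ring K G\<^esub> x"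
          using a group_ring_carrierD(2)[OF a(1), of x]
          by (cases "x \<in> carrier G") (auto simp: supp_def group_ring_simps)
      qed
      then show "a \<odot>\<^bsub>V\<^esub> v \<in> ?W" using smult_zero_left[of v] zero empty by (simp add: fixed_vectors_def)
    qed
  next
    case (insert s S)
    have vV: "v \<in> carrier V" using insert.prems by (simp add: fixed_vectors_def)
    show ?case
    proof (intro ballI impI)
      fix a assume a: "a \<in> carrier (group_ring K G)" "supp K G a \<subseteq> insert s S"
      have sG: "s \<in> carrier G" using insert.prems by blast
      have as: "a s \<in> carrier K" by (rule group_ring_carrierD(1)[OF a(1) sG])
      define b where "b = a(s := \<zero>\<^bsub>K\<^esub>)"
      have b: "b \<in> carrier (group_ring K G)"
        by (rule group_ring_carrierI[where S = "supp K G a"])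
           (use group_ring_carrierD[OF a(1)] in \<open>auto simp: b_def supp_def split: if_splits\<close>)
      have sb: "supp K G b \<subseteq> S" using a(2) by (auto simp: b_def supp_def)
      have "a = group_ring_monomial K (a s) s \<oplus>\<^bsub>group_ring K G\<^esub> b"
      proof
        fix x
        have "a x \<in> carrier K" using group_ring_carrierD(1,2)[OF a(1), of x] by (cases "x \<in> carrier G") auto
        then show "a x = (group_ring_monomial K (a s) s \<oplus>\<^bsub>group_ring K G\<^esub> b) x"
          using as by (auto simp: group_ring_simps group_ring_monomial_def b_def)
      qed
      then have "a \<odot>\<^bsub>V\<^esub> v = scaled_act (a s) s v \<oplus>\<^bsub>V\<^esub> b \<odot>\<^bsub>V\<^esub> v"
        using VM.smult_l_distr[OF monomial_closed[OF as sG] b vV] by (simp add: scaled_act_def)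
      moreover have "b \<odot>\<^bsub>V\<^esub> v \<in> ?W" using insert b sb by blast
      ultimately show "a \<odot>\<^bsub>V\<^esub> v \<in> ?W" using add[OF mono[OF as sG insert.prems(2)]] by simp
    qed
  qed
  have smult': "a \<odot>\<^bsub>V\<^esub> v \<in> ?W" if a: "a \<in> carrier (group_ring K G)" and v: "v \<in> ?W" for a v
    using smult[OF group_ring_carrierD(3)[OF a] _ v] a by (auto simp: supp_def)
  show ?thesis
  proof (intro submodule.intro submodule_axioms.intro smult')
    show "subgroup ?W (add_monoid V)"
    proof
      show "?W \<subseteq> carrier (add_monoid V)" by (auto simp: fixed_vectors_def)
      show "v \<otimes>\<^bsub>add_monoid V\<^esub> w \<in> ?W" if "v \<in> ?W" "w \<in> ?W" for v w using add[OF that] by simp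
      show "\<one>\<^bsub>add_monoid V\<^esub> \<in> ?W" using zero by simp
      show "inv\<^bsub>add_monoid V\<^esub> v \<in> ?W" if v: "v \<in> ?W" for v
      proof -
        have vV: "v \<in> carrier V" using v by (simp add: fixed_vectors_def)
        have "act n (\<ominus>\<^bsub>V\<^esub> v) = \<ominus>\<^bsub>V\<^esub> v" if n: "n \<in> N" for n
        proof -
          have "act n (\<ominus>\<^bsub>V\<^esub> v) \<oplus>\<^bsub>V\<^esub> act n v = \<zero>\<^bsub>V\<^esub>"
            using scaled_act_add[of "\<one>\<^bsub>K\<^esub>" n "\<ominus>\<^bsub>V\<^esub> v" v] n vV by (simp add: VM.M.l_neg)
          then show ?thesis using v n vV VM.M.minus_equality[of "act n (\<ominus>\<^bsub>V\<^esub> v)" v]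
            by (simp add: fixed_vectors_def)
        qed
        then show ?thesis using vV by (simp add: fixed_vectors_def a_inv_def[symmetric])
      qed
    qed
  qed
qed

lemma normal_fixing_vector_trivial:
  assumes N: "N \<lhd> G" and v: "v \<in> fixed_vectors N" "v \<noteq> \<zero>\<^bsub>V\<^esub>"
  shows "N = {\<one>}"
proof -
  interpret N: normal N G by fact
  have "fixed_vectors N = carrier V"
    using fixed_vectors_submodule[OF N] V_simple v unfolding simple_module_def by blast
  then have "n = \<one>" if "n \<in> N" for n
    using trivial_action_faithful[of n] that by (auto simp: fixed_vectors_def)
  then show ?thesis using N.one_closed by blast
qed

lemma act_finsum:
  assumes "finite S" "f \<in> S \<rightarrow> carrier V" "g \<in> carrier G"
  shows "act g (\<Oplus>\<^bsub>V\<^esub>i\<in>S. f i) = (\<Oplus>\<^bsub>V\<^esub>i\<in>S. act g (f i))"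
  using assms(1,2)
proof (induction S)
  case empty
  then show ?case using assms(3) by simp
next
  case (insert s S)
  then show ?case using assms(3) by (simp add: scaled_act_add VM.M.finsum_closed Pi_def)
qed

lemma scaled_act_add_left:
  assumes "c \<in> carrier K" "d \<in> carrier K" "g \<in> carrier G" "v \<in> carrier V"
  shows "scaled_act (c \<oplus>\<^bsub>K\<^esub> d) g v = scaled_act c g v \<oplus>\<^bsub>V\<^esub> scaled_act d g v"
proof -
  have "group_ring_monomial K (c \<oplus>\<^bsub>K\<^esub> d) g =
      group_ring_monomial K c g \<oplus>\<^bsub>group_ring K G\<^esub> group_ring_monomial K d g"
    using assms(1,2) by (auto simp: group_ring_simps group_ring_monomial_def fun_eq_iff)
  then show ?thesis
    unfolding scaled_act_def
    using VM.smult_l_distr[OF monomial_closed[OF assms(1,3)] monomial_closed[OF assms(2,3)] assms(4)] by simp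
qed

lemma scaled_act_zero_left:
  assumes "g \<in> carrier G" "v \<in> carrier V"
  shows "scaled_act \<zero>\<^bsub>K\<^esub> g v = \<zero>\<^bsub>V\<^esub>"
proof -
  have "group_ring_monomial K \<zero>\<^bsub>K\<^esub> g = \<zero>\<^bsub>group_ring K G\<^esub>"
    by (auto simp: group_ring_simps group_ring_monomial_def)
  then show ?thesis using smult_zero_left[OF assms(2)] by (simp add: scaled_act_def)
qed

lemma multiple_eq_scaled_act:
  fixes n :: nat
  assumes "v \<in> carrier V"
  shows "[n] \<cdot>\<^bsub>V\<^esub> v = scaled_act ([n] \<cdot>\<^bsub>K\<^esub> \<one>\<^bsub>K\<^esub>) \<one> v"
proof (induction n)
  case 0
  show ?case using assms by (simp add: scaled_act_zero_left)
next
  case (Suc n)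
  then show ?case using assms by (simp add: scaled_act_add_left)
qed

lemma multiple_one_eq_zero_iff:
  assumes p: "Factorial_Ring.prime (p::nat)"
  shows "[p] \<cdot>\<^bsub>K\<^esub> \<one>\<^bsub>K\<^esub> = \<zero>\<^bsub>K\<^esub> \<longleftrightarrow> ring_char K = p"
proof -
  have eq: "[n] \<cdot>\<^bsub>K\<^esub> \<one>\<^bsub>K\<^esub> = \<zero>\<^bsub>K\<^esub> \<longleftrightarrow> ring_char K dvd n" for n :: nat
    using K.add.pow_eq_id[of "\<one>\<^bsub>K\<^esub>" n] by (simp add: ring_char_def)
  have "ring_char K \<noteq> 1" using eq[of 1] by auto
  then show ?thesis unfolding eq using p by (auto simp: prime_nat_iff)
qed

lemma ring_char_multiple:
  assumes "Factorial_Ring.prime p" "ring_char K = p" "v \<in> carrier V"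
  shows "[p] \<cdot>\<^bsub>V\<^esub> v = \<zero>\<^bsub>V\<^esub>"
  using assms multiple_one_eq_zero_iff[OF assms(1)] by (simp add: multiple_eq_scaled_act scaled_act_zero_left)

lemma not_ring_char_multiple:
  assumes p: "Factorial_Ring.prime p" "ring_char K \<noteq> p" and v: "v \<in> carrier V" "[p] \<cdot>\<^bsub>V\<^esub> v = \<zero>\<^bsub>V\<^esub>"
  shows "v = \<zero>\<^bsub>V\<^esub>"
proof -
  let ?c = "[p] \<cdot>\<^bsub>K\<^esub> \<one>\<^bsub>K\<^esub>"
  have c: "?c \<in> carrier K" "?c \<noteq> \<zero>\<^bsub>K\<^esub>" using multiple_one_eq_zero_iff[OF p(1)] p(2) by auto
  then have u: "?c \<in> Units K" by (simp add: K.field_Units)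
  have "scaled_act (inv\<^bsub>K\<^esub> ?c) \<one> (scaled_act ?c \<one> v) = v"
    using u v(1) by (simp add: scaled_act_mult)
  moreover have "scaled_act ?c \<one> v = \<zero>\<^bsub>V\<^esub>" using multiple_eq_scaled_act[OF v(1), of p] v(2) by simp
  ultimately show ?thesis using u by simp
qed

end

text \<open>The subgroup \<open>L\<close> plays the role of the kernel of an irreducible constituent in Clifford's theorem.
  Unlike constituents, it exists over every field without any finiteness of \<open>V\<close>.\<close>

locale maximal_fixing = faithful_rep G K V
  for G :: "('g, 'h) monoid_scheme" (structure) and K :: "('k, 's) ring_scheme"
    and V :: "('g \<Rightarrow> 'k, 'v, 'm) module_scheme" +
  fixes F L :: "'g set"
  assumes F_subgroup: "subgroup F G" and F_comm: "\<And>x y. x \<in> F \<Longrightarrow> y \<in> F \<Longrightarrow> x \<otimes> y = y \<otimes> x"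
    and L_subgroup: "subgroup L G" and LF: "L \<subseteq> F"
    and L_fixes: "fixed_vectors L \<noteq> {\<zero>\<^bsub>V\<^esub>}"
    and L_max: "\<And>L'. subgroup L' G \<Longrightarrow> L \<subseteq> L' \<Longrightarrow> L' \<subseteq> F \<Longrightarrow> fixed_vectors L' \<noteq> {\<zero>\<^bsub>V\<^esub>} \<Longrightarrow> L' = L"

context faithful_rep
begin

lemma fixed_vectors_zero [simp]: "N \<subseteq> carrier G \<Longrightarrow> \<zero>\<^bsub>V\<^esub> \<in> fixed_vectors N"
  by (auto simp: fixed_vectors_def)

lemma maximal_fixing_exists:
  assumes F: "subgroup F G" "finite F" "\<And>x y. x \<in> F \<Longrightarrow> y \<in> F \<Longrightarrow> x \<otimes> y = y \<otimes> x"
  obtains L where "maximal_fixing G K V F L"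
proof -
  let ?P = "\<lambda>L. subgroup L G \<and> L \<subseteq> F \<and> fixed_vectors L \<noteq> {\<zero>\<^bsub>V\<^esub>}"
  have "fixed_vectors {\<one>} = carrier V" by (auto simp: fixed_vectors_def)
  then have "?P {\<one>}"
    using V_simple subgroup.one_closed[OF F(1)] triv_subgroup by (auto simp: simple_module_def)
  moreover have "\<forall>L. ?P L \<longrightarrow> card L < Suc (card F)"
    using F(2) by (auto simp: less_Suc_eq_le intro: card_mono)
  ultimately have "\<exists>L. ?P L \<and> (\<forall>L'. ?P L' \<longrightarrow> card L' \<le> card L)"
    by (rule ex_has_greatest_nat)
  then obtain L where L: "?P L" and max: "\<forall>L'. ?P L' \<longrightarrow> card L' \<le> card L" by (elim exE conjE[where P = "?P _"])
  have "maximal_fixing G K V F L"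
  proof (intro maximal_fixing.intro maximal_fixing_axioms.intro faithful_rep_axioms)
    show "L' = L" if "subgroup L' G" "L \<subseteq> L'" "L' \<subseteq> F" "fixed_vectors L' \<noteq> {\<zero>\<^bsub>V\<^esub>}" for L'
    proof -
      have "card L' \<le> card L" using max that by blast
      then show ?thesis using that F(2) card_seteq[of L' L] finite_subset by blast
    qed
  qed (use L F in auto)
  then show ?thesis by (rule that)
qed

end

context maximal_fixing
begin

lemma mem_if_fixes:
  assumes z: "z \<in> F" and w: "w \<in> fixed_vectors L" "w \<noteq> \<zero>\<^bsub>V\<^esub>" "act z w = w"
  shows "z \<in> L"
proof -
  define S where "S = {g \<in> F. act g w = w}"
  have wV: "w \<in> carrier V" using w(1) by (simp add: fixed_vectors_def)
  have FG: "g \<in> carrier G" if "g \<in> F" for g using that by (rule subgroup.mem_carrier[OF F_subgroup])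
  have "subgroup S G"
  proof
    show "S \<subseteq> carrier G" using FG by (auto simp: S_def)
    show "\<one> \<in> S" using wV subgroup.one_closed[OF F_subgroup] by (simp add: S_def)
    show "x \<otimes> y \<in> S" if "x \<in> S" "y \<in> S" for x y
      using that wV FG subgroup.m_closed[OF F_subgroup] act_mult[of x y w] by (simp add: S_def)
    show "inv x \<in> S" if "x \<in> S" for x
      using that wV FG subgroup.m_inv_closed[OF F_subgroup] act_inv(1)[of x w] by (simp add: S_def)
  qed
  moreover have "L \<subseteq> S" using LF w(1) by (auto simp: S_def fixed_vectors_def)
  moreover have "w \<in> fixed_vectors S" using wV by (auto simp: S_def fixed_vectors_def)
  ultimately have "S = L" using w(2) by (intro L_max) (auto simp: S_def)
  then show ?thesis using z w(3) by (auto simp: S_def)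
qed

lemma L_core_free: "N \<lhd> G \<Longrightarrow> N \<subseteq> L \<Longrightarrow> N = {\<one>}"
proof -
  assume N: "N \<lhd> G" "N \<subseteq> L"
  have "\<zero>\<^bsub>V\<^esub> \<in> fixed_vectors L" using subgroup.subset[OF L_subgroup] by simp
  then obtain v where v: "v \<in> fixed_vectors L" "v \<noteq> \<zero>\<^bsub>V\<^esub>" using L_fixes by blast
  then have "v \<in> fixed_vectors N" using N(2) by (auto simp: fixed_vectors_def)
  then show ?thesis using normal_fixing_vector_trivial[OF N(1)] v(2) by blast
qed

lemma act_fixed_vectors:
  assumes "g \<in> F" "v \<in> fixed_vectors L"
  shows "act g v \<in> fixed_vectors L"
proof -
  have FG: "g \<in> carrier G" if "g \<in> F" for g using that by (rule subgroup.mem_carrier[OF F_subgroup])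
  have "act n (act g v) = act g v" if n: "n \<in> L" for n
  proof -
    have "v \<in> carrier V" "act n v = v" using assms(2) n by (auto simp: fixed_vectors_def)
    moreover have "n \<otimes> g = g \<otimes> n" using F_comm n LF assms(1) by blast
    ultimately show ?thesis
      using act_mult[of n g v] act_mult[of g n v] FG assms(1) n LF by (auto simp: subset_iff)
  qed
  then show ?thesis using assms FG by (simp add: fixed_vectors_def)
qed

lemma finsum_fixed_vectors:
  assumes "finite I" "\<And>i. i \<in> I \<Longrightarrow> f i \<in> fixed_vectors L"
  shows "(\<Oplus>\<^bsub>V\<^esub>i\<in>I. f i) \<in> fixed_vectors L"
proof -
  have V: "f \<in> I \<rightarrow> carrier V" using assms(2) by (auto simp: fixed_vectors_def)
  have "act n (\<Oplus>\<^bsub>V\<^esub>i\<in>I. f i) = (\<Oplus>\<^bsub>V\<^esub>i\<in>I. f i)" if n: "n \<in> L" for n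
  proof -
    have "act n (\<Oplus>\<^bsub>V\<^esub>i\<in>I. f i) = (\<Oplus>\<^bsub>V\<^esub>i\<in>I. act n (f i))"
      by (rule act_finsum[OF assms(1) V subgroup.mem_carrier[OF L_subgroup n]])
    also have "\<dots> = (\<Oplus>\<^bsub>V\<^esub>i\<in>I. f i)"
      using assms(2) n V by (intro VM.M.finsum_cong') (auto simp: fixed_vectors_def)
    finally show ?thesis .
  qed
  then show ?thesis using V by (simp add: fixed_vectors_def)
qed

text \<open>The sum is fixed by \<open>z\<close> and by \<open>L\<close>, so it vanishes by maximality of \<open>L\<close>.\<close>

lemma trace_zero:
  assumes z: "z \<in> F" "z \<notin> L" "z [^] p = \<one>" and p: "p > (0::nat)" and v: "v \<in> fixed_vectors L"
  shows "(\<Oplus>\<^bsub>V\<^esub>i\<in>{..<p}. act (z [^] i) v) = \<zero>\<^bsub>V\<^esub>" (is "?t = _")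
proof (rule ccontr)
  assume nz: "?t \<noteq> \<zero>\<^bsub>V\<^esub>"
  have zG: "z \<in> carrier G" using z(1) by (rule subgroup.mem_carrier[OF F_subgroup])
  have vV: "v \<in> carrier V" using v by (simp add: fixed_vectors_def)
  have zp: "z [^] i \<in> F" for i :: nat
    using z(1) subgroup.one_closed[OF F_subgroup] subgroup.m_closed[OF F_subgroup] by (induction i) auto
  let ?f = "\<lambda>i::nat. act (z [^] i) v"
  have fV: "?f i \<in> carrier V" for i using vV zG by simp
  have tL: "?t \<in> fixed_vectors L" by (intro finsum_fixed_vectors act_fixed_vectors zp v) simp
  have "act z ?t = (\<Oplus>\<^bsub>V\<^esub>i\<in>{..<p}. act z (?f i))" using fV zG by (intro act_finsum) auto
  also have "\<dots> = (\<Oplus>\<^bsub>V\<^esub>i\<in>{..<p}. ?f (Suc i))"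
  proof (intro VM.M.finsum_cong' refl)
    fix i
    have "z [^] Suc i = z \<otimes> z [^] i" using zG by (rule nat_pow_Suc2)
    then show "act z (?f i) = ?f (Suc i)" using act_mult[of z "z [^] i" v] zG vV by simp
  qed (use zG vV in auto)
  also have "\<dots> = (\<Oplus>\<^bsub>V\<^esub>i\<in>Suc ` {..<p}. ?f i)"
    using fV by (intro VM.M.finsum_reindex[symmetric]) auto
  also have "Suc ` {..<p} = insert p {1..<p}" 
    using p by (auto simp: lessThan_atLeast0 atLeastLessThanSuc)
  also have "(\<Oplus>\<^bsub>V\<^esub>i\<in>insert p {1..<p}. ?f i) = ?f p \<oplus>\<^bsub>V\<^esub> (\<Oplus>\<^bsub>V\<^esub>i\<in>{1..<p}. ?f i)"
    using fV by (intro VM.M.finsum_insert) auto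
  also have "\<dots> = ?f 0 \<oplus>\<^bsub>V\<^esub> (\<Oplus>\<^bsub>V\<^esub>i\<in>{1..<p}. ?f i)" using z(3) by simp
  also have "\<dots> = (\<Oplus>\<^bsub>V\<^esub>i\<in>insert 0 {1..<p}. ?f i)"
    using fV vV by (intro VM.M.finsum_insert[symmetric]) auto
  also have "insert 0 {1..<p} = {..<p}" using p by auto
  finally have "z \<in> L" by (intro mem_if_fixes[OF z(1) tL nz])
  with z(2) show False by blast
qed

lemma prime_power_mem:
  assumes p: "Factorial_Ring.prime (p::nat)" and a: "a \<in> F" "a [^] p = \<one>" "a [^] i \<in> L" and i: "0 < i" "i < p"
  shows "a \<in> L"
proof -
  have aG: "a \<in> carrier G" using a(1) by (rule subgroup.mem_carrier[OF F_subgroup])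
  \<comment> \<open>by Bezout \<open>a\<close> is a power of \<open>a [^] i\<close>\<close>
  have "coprime i p" using p i by (metis coprime_commute nat_dvd_not_less prime_imp_coprime)
  then obtain u v where uv: "u * int i + v * int p = 1" using bezout_int[of "int i" "int p"] by auto
  have "a = a [^] (int i * u + int p * v)" using uv aG by (simp add: mult.commute)
  also have "\<dots> = (a [^] int i) [^] u \<otimes> (a [^] int p) [^] v"
    using aG by (simp only: int_pow_mult int_pow_pow)
  also have "\<dots> = (a [^] i) [^] u" using aG a(2) by (simp add: int_pow_int int_pow_one)
  finally have "a = (a [^] i) [^] u" .
  then show ?thesis using subgroup_int_pow_closed[OF L_subgroup a(3), of u] by simp
qed

text \<open>If no \<open>y \<otimes> a [^] j\<close> is in \<open>L\<close>, then the traces of all of them vanish on an \<open>L\<close>-fixed vector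
  \<open>v\<close>. Their sum, ordered by the powers of \<open>y\<close>, is \<open>p\<close> times \<open>v\<close> from the zeroth power,
  plus images of traces of nontrivial powers of \<open>a\<close>, which vanish as well.\<close>

lemma discrete_logarithm_exists:
  assumes p: "Factorial_Ring.prime (p::nat)" and pV: "\<And>v. v \<in> carrier V \<Longrightarrow> [p] \<cdot>\<^bsub>V\<^esub> v = \<zero>\<^bsub>V\<^esub> \<Longrightarrow> v = \<zero>\<^bsub>V\<^esub>"
    and a: "a \<in> F" "a [^] p = \<one>" "a \<notin> L" and y: "y \<in> F" "y [^] p = \<one>"
  shows "\<exists>j<p. y \<otimes> a [^] j \<in> L"
proof (rule ccontr)
  assume no: "\<not> ?thesis"
  have FG: "g \<in> carrier G" if "g \<in> F" for g using that by (rule subgroup.mem_carrier[OF F_subgroup])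
  note G = FG[OF a(1)] FG[OF y(1)]
  have ya: "y \<otimes> a = a \<otimes> y" by (rule F_comm[OF y(1) a(1)])
  have pow: "x [^] i \<in> F" if "x \<in> F" for x and i :: nat
    using that subgroup.one_closed[OF F_subgroup] subgroup.m_closed[OF F_subgroup] by (induction i) auto
  have p0: "p > 0" using p by (rule prime_gt_0_nat)
  have "\<zero>\<^bsub>V\<^esub> \<in> fixed_vectors L" using subgroup.subset[OF L_subgroup] by simp
  then obtain v where v: "v \<in> fixed_vectors L" "v \<noteq> \<zero>\<^bsub>V\<^esub>" using L_fixes by blast
  have vV: "v \<in> carrier V" using v by (simp add: fixed_vectors_def)
  have ypow: "(y \<otimes> a [^] j) [^] i = y [^] i \<otimes> (a [^] i) [^] j" for i j :: nat
  proof -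
    have "(y \<otimes> a [^] j) [^] i = y [^] i \<otimes> (a [^] j) [^] i"
      using pow_mult_distrib[of y "a [^] j" i] F_comm[OF y(1) pow[OF a(1)]] G by simp
    then show ?thesis using G by (simp add: nat_pow_pow mult.commute)
  qed
  let ?g = "\<lambda>i j. act (y [^] i \<otimes> (a [^] i) [^] j) v"
  have gV: "?g i j \<in> carrier V" for i j :: nat using G vV by simp
  have inner: "(\<Oplus>\<^bsub>V\<^esub>i\<in>{..<p}. ?g i j) = \<zero>\<^bsub>V\<^esub>" if j: "j < p" for j
  proof -
    have "(y \<otimes> a [^] j) [^] p = \<one>" unfolding ypow using y(2) a(2) G by (simp add: nat_pow_one)
    then have "(\<Oplus>\<^bsub>V\<^esub>i\<in>{..<p}. act ((y \<otimes> a [^] j) [^] i) v) = \<zero>\<^bsub>V\<^esub>"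
      using no j pow[OF a(1)] y(1) subgroup.m_closed[OF F_subgroup] p0 v(1) by (intro trace_zero) auto
    then show ?thesis by (simp add: ypow)
  qed
  have "\<zero>\<^bsub>V\<^esub> = (\<Oplus>\<^bsub>V\<^esub>j\<in>{..<p}. \<Oplus>\<^bsub>V\<^esub>i\<in>{..<p}. ?g i j)"
  proof -
    have "(\<Oplus>\<^bsub>V\<^esub>j\<in>{..<p}. \<Oplus>\<^bsub>V\<^esub>i\<in>{..<p}. ?g i j) = (\<Oplus>\<^bsub>V\<^esub>j\<in>{..<p}. \<zero>\<^bsub>V\<^esub>)"
      using inner by (intro VM.M.finsum_cong') auto
    then show ?thesis by (simp add: VM.M.finsum_zero)
  qed
  also have "\<dots> = (\<Oplus>\<^bsub>V\<^esub>i\<in>{..<p}. \<Oplus>\<^bsub>V\<^esub>j\<in>{..<p}. ?g i j)"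
    using gV by (intro VM.M.add.finprod_swap) auto
  also have "\<dots> = (\<Oplus>\<^bsub>V\<^esub>i\<in>{..<p}. if 0 = i then [p] \<cdot>\<^bsub>V\<^esub> v else \<zero>\<^bsub>V\<^esub>)"
  proof (intro VM.M.finsum_cong' refl)
    fix i assume i: "i \<in> {..<p}"
    show "(\<Oplus>\<^bsub>V\<^esub>j\<in>{..<p}. ?g i j) = (if 0 = i then [p] \<cdot>\<^bsub>V\<^esub> v else \<zero>\<^bsub>V\<^esub>)"
    proof (cases "i = 0")
      case True
      have "(\<Oplus>\<^bsub>V\<^esub>j\<in>{..<p}. ?g i j) = (\<Oplus>\<^bsub>V\<^esub>j\<in>{..<p}. v)"
        using True vV by (intro VM.M.finsum_cong') (auto simp: nat_pow_one)
      also have "\<dots> = [p] \<cdot>\<^bsub>V\<^esub> v" using VM.M.add.finprod_const[OF vV, of "{..<p}"] by simp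
      finally show ?thesis using True by simp
    next
      case False
      have ai: "a [^] i \<notin> L" using prime_power_mem[OF p a(1,2), of i] i False a(3) by auto
      have aip: "(a [^] i) [^] p = \<one>"
        using a(2) G nat_pow_pow[of a p i] by (simp add: nat_pow_pow mult.commute nat_pow_one)
      have "(\<Oplus>\<^bsub>V\<^esub>j\<in>{..<p}. ?g i j) = (\<Oplus>\<^bsub>V\<^esub>j\<in>{..<p}. act (y [^] i) (act ((a [^] i) [^] j) v))"
        using G vV by (intro VM.M.finsum_cong') (auto simp: scaled_act_mult)
      also have "\<dots> = act (y [^] i) (\<Oplus>\<^bsub>V\<^esub>j\<in>{..<p}. act ((a [^] i) [^] j) v)"
        using G vV by (intro act_finsum[symmetric]) auto
      also have "(\<Oplus>\<^bsub>V\<^esub>j\<in>{..<p}. act ((a [^] i) [^] j) v) = \<zero>\<^bsub>V\<^esub>"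
        by (rule trace_zero[OF pow[OF a(1)] ai aip p0 v(1)])
      finally show ?thesis using G False by simp
    qed
  qed (use vV in auto)
  also have "\<dots> = [p] \<cdot>\<^bsub>V\<^esub> v"
    using vV p0 by (intro VM.M.finsum_singleton) auto
  finally show False using pV[OF vV] v(2) by simp
qed

text \<open>Modulo \<open>L\<close> the elements of exponent \<open>p\<close> are powers of one of them, so a primitive \<open>p\<close>-th root
  of unity raised to the discrete logarithm is a character with kernel in \<open>L\<close>.\<close>

lemma character_detecting_L:
  assumes p: "Factorial_Ring.prime (p::nat)" and pK: "ring_char K \<noteq> p"
  shows "\<exists>\<chi>\<in>characters {y \<in> F. y [^] p = \<one>}. \<forall>y\<in>F. y [^] p = \<one> \<longrightarrow> \<chi> y = 1 \<longrightarrow> y \<in> L"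
proof -
  let ?P = "{y \<in> F. y [^] p = \<one>}"
  have FG: "g \<in> carrier G" if "g \<in> F" for g using that by (rule subgroup.mem_carrier[OF F_subgroup])
  have Pm: "x \<otimes> y \<in> ?P" if "x \<in> ?P" "y \<in> ?P" for x y
    using that pow_mult_distrib[OF F_comm, of x y p] FG subgroup.m_closed[OF F_subgroup] by (simp add: subset_iff)
  have P1: "\<one> \<in> ?P" using subgroup.one_closed[OF F_subgroup] by (simp add: nat_pow_one)
  show ?thesis
  proof (cases "?P \<subseteq> L")
    case True
    have "(\<lambda>y. if y \<in> ?P then 1 else 0) \<in> characters ?P" using Pm P1 by (auto simp: characters_def)
    then show ?thesis using True by blast
  next
    case False
    then obtain a where a: "a \<in> F" "a [^] p = \<one>" "a \<notin> L" by blast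
    have aG: "a \<in> carrier G" by (rule FG[OF a(1)])
    have aF: "a [^] i \<in> F" for i :: nat
      using a(1) subgroup.one_closed[OF F_subgroup] subgroup.m_closed[OF F_subgroup] by (induction i) auto
    have amod: "a [^] i = a [^] (i mod p)" for i :: nat
    proof -
      have "a [^] i = a [^] (p * (i div p) + i mod p)" by simp
      also have "\<dots> = (a [^] p) [^] (i div p) \<otimes> a [^] (i mod p)"
        using aG by (simp only: nat_pow_mult[symmetric] nat_pow_pow nat_pow_closed)
      finally show ?thesis using aG a(2) by (simp add: nat_pow_one)
    qed
    have p0: "p > 0" using p by (rule prime_gt_0_nat)
    \<comment> \<open>the discrete logarithm modulo \<open>L\<close> to the base \<open>inv a\<close>\<close>
    define j where "j y = (SOME j. j < p \<and> y \<otimes> a [^] j \<in> L)" for y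
    have j: "j y < p \<and> y \<otimes> a [^] j y \<in> L" if "y \<in> ?P" for y
      unfolding j_def
      by (rule someI_ex, rule discrete_logarithm_exists[OF p not_ring_char_multiple[OF p pK] a]) (use that in auto)
    have uniq: "i = k" if "i < p" "k < p" "y \<otimes> a [^] i \<in> L" "y \<otimes> a [^] k \<in> L" "y \<in> ?P" for i k y
    proof -
      have *: False if h: "i < k" "k < p" "y \<otimes> a [^] i \<in> L" "y \<otimes> a [^] k \<in> L" "y \<in> ?P" for i k
      proof -
        have yG: "y \<in> carrier G" using h(5) FG by blast
        have "a [^] k = a [^] i \<otimes> a [^] (k - i)" using h(1) aG by (simp add: nat_pow_mult)
        then have "inv (y \<otimes> a [^] i) \<otimes> (y \<otimes> a [^] k) = a [^] (k - i)"
          using yG aG by (simp add: inv_mult_group m_assoc) (simp add: m_assoc[symmetric])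
        moreover have "inv (y \<otimes> a [^] i) \<otimes> (y \<otimes> a [^] k) \<in> L"
          using h(3,4) subgroup.m_closed[OF L_subgroup] subgroup.m_inv_closed[OF L_subgroup] by blast
        ultimately have "a \<in> L" using h(1,2) by (intro prime_power_mem[OF p a(1,2), of "k - i"]) auto
        with a(3) show False by blast
      qed
      show ?thesis using *[of i k] *[of k i] that by (metis linorder_neqE_nat)
    qed
    define \<omega> where "\<omega> = cis (2 * pi / real p)"
    have \<omega>: "\<omega> ^ i = cis (2 * pi * real i / real p)" for i by (simp add: \<omega>_def DeMoivre ac_simps)
    have \<omega>p: "\<omega> ^ p = 1" using p0 by (simp add: \<omega>)
    have \<omega>mod: "\<omega> ^ (i mod p) = \<omega> ^ i" for i
    proof -
      have "\<omega> ^ i = \<omega> ^ (p * (i div p) + i mod p)" by simp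
      also have "\<dots> = \<omega> ^ (i mod p)" unfolding power_add power_mult \<omega>p by simp
      finally show ?thesis ..
    qed
    have \<omega>1: "i = 0" if "i < p" "\<omega> ^ i = 1" for i
    proof -
      have "inj_on (\<lambda>k. cis (2 * pi * real k / real p)) {..<p}"
        using bij_betw_roots_unity[OF p0] by (rule bij_betw_imp_inj_on)
      from inj_onD[OF this, of i 0] show ?thesis using that p0 by (simp add: \<omega>)
    qed
    define \<chi> where "\<chi> y = (if y \<in> ?P then \<omega> ^ j y else 0)" for y
    have "\<chi> \<in> characters ?P"
      unfolding characters_def
    proof (intro CollectI conjI ballI allI impI)
      have "j \<one> = 0"
        using uniq[OF conjunct1[OF j[OF P1]] p0 conjunct2[OF j[OF P1]] _ P1] subgroup.one_closed[OF L_subgroup]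
        by simp
      then show "\<chi> \<one> = 1" using P1 by (simp add: \<chi>_def)
      show "\<chi> y = 0" if "y \<notin> ?P" for y using that unfolding \<chi>_def by (rule if_not_P)
      fix x y assume xy: "x \<in> ?P" "y \<in> ?P"
      have G: "x \<in> carrier G" "y \<in> carrier G" using xy FG by auto
      have "x \<otimes> y \<otimes> a [^] ((j x + j y) mod p) = x \<otimes> y \<otimes> (a [^] j x \<otimes> a [^] j y)"
        using aG by (simp add: nat_pow_mult amod[symmetric])
      also have "\<dots> = x \<otimes> (y \<otimes> a [^] j x) \<otimes> a [^] j y" using G aG by (simp add: m_assoc)
      also have "y \<otimes> a [^] j x = a [^] j x \<otimes> y" using xy(2) aF by (intro F_comm) auto
      also have "x \<otimes> (a [^] j x \<otimes> y) \<otimes> a [^] j y = (x \<otimes> a [^] j x) \<otimes> (y \<otimes> a [^] j y)"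
        using G aG by (simp add: m_assoc)
      finally have "x \<otimes> y \<otimes> a [^] ((j x + j y) mod p) \<in> L"
        using j[OF xy(1)] j[OF xy(2)] subgroup.m_closed[OF L_subgroup] by simp
      then have "j (x \<otimes> y) = (j x + j y) mod p"
        using uniq[of "j (x \<otimes> y)" "(j x + j y) mod p" "x \<otimes> y"] j[OF Pm[OF xy]] Pm[OF xy] p0 by simp
      then show "\<chi> (x \<otimes> y) = \<chi> x * \<chi> y"
        using xy Pm[OF xy] by (simp add: \<chi>_def \<omega>mod power_add)
    qed
    moreover have "y \<in> L" if y: "y \<in> F" "y [^] p = \<one>" "\<chi> y = 1" for y
    proof -
      have yP: "y \<in> ?P" using y by simp
      then have "\<omega> ^ j y = 1" using y(3) by (simp add: \<chi>_def)
      then have "j y = 0" using \<omega>1[OF conjunct1[OF j[OF yP]]] by blast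
      then show ?thesis using conjunct2[OF j[OF yP]] FG[OF y(1)] by simp
    qed
    ultimately show ?thesis by blast
  qed
qed

end

lemma prime_dvd_binomial_minus_one:
  assumes p: "Factorial_Ring.prime (p::nat)"
  shows "\<exists>Q :: int poly. [:-1, 1:] ^ p = monom 1 p - 1 + smult (int p) Q"
proof -
  have "of_nat p dvd [:-1, 1:] ^ p - (monom 1 p - 1 :: int poly)"
  proof -
    let ?t = "\<lambda>k. of_nat (p choose k) * [:0, 1:] ^ k * (-1) ^ (p - k) :: int poly"
    have eq: "[:-1, 1:] = [:0, 1:] + (-1 :: int poly)" by (simp add: one_pCons)
    have "[:-1, 1:] ^ p = (\<Sum>k\<le>p. ?t k)" unfolding eq by (rule binomial_ring)
    also have "\<dots> = ?t p + (\<Sum>k<p. ?t k)" by (simp add: lessThan_Suc_atMost[symmetric] add.commute)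
    also have "(\<Sum>k<p. ?t k) = ?t 0 + (\<Sum>k\<in>{1..<p}. ?t k)"
      using prime_gt_0_nat[OF p] by (simp add: sum.atLeast_Suc_lessThan atLeast0LessThan[symmetric])
    finally have eq': "[:-1, 1:] ^ p - (monom 1 p - 1 :: int poly) = ((-1) ^ p + 1) + (\<Sum>k\<in>{1..<p}. ?t k)"
      by (simp add: monom_altdef)
    have "of_nat p dvd ((-1) ^ p + 1 :: int poly)"
    proof (cases "p = 2")
      case False
      then have "odd p" using p prime_odd_nat prime_ge_2_nat by (metis order_le_imp_less_or_eq)
      then show ?thesis by simp
    qed simp
    moreover have "of_nat p dvd (\<Sum>k\<in>{1..<p}. ?t k)"
    proof (rule dvd_sum)
      fix k assume k: "k \<in> {1..<p}"
      then have "p dvd (p choose k)" using p by (intro dvd_choose_prime) auto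
      then obtain c where "p choose k = p * c" ..
      then have "(of_nat (p choose k) :: int poly) = of_nat p * of_nat c" by simp
      then have "(of_nat p :: int poly) dvd of_nat (p choose k)" by (rule dvdI)
      then show "of_nat p dvd ?t k" by simp
    qed
    ultimately show ?thesis unfolding eq' by (rule dvd_add)
  qed
  then obtain Q :: "int poly" where "[:-1, 1:] ^ p - (monom 1 p - 1) = of_nat p * Q" ..
  then have "[:-1, 1:] ^ p = monom 1 p - 1 + smult (int p) Q"
    by (simp add: algebra_simps of_nat_poly)
  then show ?thesis ..
qed

context maximal_fixing
begin

text \<open>In characteristic \<open>p\<close> the operator \<open>m - 1\<close> is nilpotent, because its \<open>p\<close>-th power is
  \<open>m [^] p - 1\<close>. The last nonzero vector in the sequence of its powers applied to \<open>v\<close> is fixed by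
  \<open>m\<close>.\<close>

lemma mem_if_char:
  assumes p: "Factorial_Ring.prime (p::nat)" and pK: "ring_char K = p" and m: "m \<in> F" "m [^] p = \<one>"
  shows "m \<in> L"
proof -
  have mG: "m \<in> carrier G" using m(1) by (rule subgroup.mem_carrier[OF F_subgroup])
  have "\<zero>\<^bsub>V\<^esub> \<in> fixed_vectors L" using subgroup.subset[OF L_subgroup] by simp
  then obtain v where v: "v \<in> fixed_vectors L" "v \<noteq> \<zero>\<^bsub>V\<^esub>" using L_fixes by blast
  have vV: "v \<in> carrier V" using v by (simp add: fixed_vectors_def)
  have LG: "g \<in> carrier G" if "g \<in> L" for g using that by (rule subgroup.mem_carrier[OF L_subgroup])
  \<comment> \<open>evaluation of an integer polynomial at \<open>m\<close>, applied to \<open>v\<close>\<close>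
  define \<Phi> where "\<Phi> P = fold_coeffs (\<lambda>c w. [c] \<cdot>\<^bsub>V\<^esub> v \<oplus>\<^bsub>V\<^esub> act m w) P \<zero>\<^bsub>V\<^esub>" for P :: "int poly"
  have \<Phi>0: "\<Phi> 0 = \<zero>\<^bsub>V\<^esub>" by (simp add: \<Phi>_def)
  have \<Phi>_pCons: "\<Phi> (pCons c P) = [c] \<cdot>\<^bsub>V\<^esub> v \<oplus>\<^bsub>V\<^esub> act m (\<Phi> P)" for c P
  proof (cases "c = 0 \<and> P = 0")
    case True
    then show ?thesis using mG by (simp add: \<Phi>0 add_pow_def)
  next
    case False
    then show ?thesis by (auto simp: \<Phi>_def fold_coeffs_pCons_coeff_not_0_eq fold_coeffs_pCons_not_0_0_eq)
  qed
  have \<Phi>V: "\<Phi> P \<in> carrier V" for P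
    by (induction P) (use vV mG in \<open>auto simp: \<Phi>0 \<Phi>_pCons\<close>)
  have \<Phi>_add: "\<Phi> (P + Q) = \<Phi> P \<oplus>\<^bsub>V\<^esub> \<Phi> Q" for P Q
  proof (induction P Q rule: poly_induct2)
    case (pCons c P d Q)
    then show ?case
      using vV mG \<Phi>V[of P] \<Phi>V[of Q]
      by (simp add: \<Phi>_pCons scaled_act_add VM.M.add.int_pow_mult VM.M.add.m_ac)
  qed (simp add: \<Phi>0)
  have \<Phi>_smult: "\<Phi> (smult k P) = [k] \<cdot>\<^bsub>V\<^esub> \<Phi> P" for k P
  proof (induction k rule: int_induct[where k = 0])
    case base
    show ?case by (simp add: \<Phi>0 add_pow_def)
  next
    case (step1 k)
    have "\<Phi> (smult (k + 1) P) = \<Phi> (smult k P) \<oplus>\<^bsub>V\<^esub> \<Phi> P" by (simp add: smult_add_left \<Phi>_add)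
    then show ?case using step1 \<Phi>V[of P] by (simp add: VM.M.add.int_pow_mult)
  next
    case (step2 k)
    have "\<Phi> (smult (k - 1) P) \<oplus>\<^bsub>V\<^esub> \<Phi> P = \<Phi> (smult k P)"
      unfolding \<Phi>_add[symmetric] by (simp add: smult_diff_left)
    also have "\<dots> = [(k - 1)] \<cdot>\<^bsub>V\<^esub> \<Phi> P \<oplus>\<^bsub>V\<^esub> \<Phi> P"
      using step2 \<Phi>V[of P] VM.M.add.int_pow_mult[of "\<Phi> P" "k - 1" 1] by simp
    finally show ?case using \<Phi>V by (simp add: VM.M.add.r_cancel)
  qed
  have \<Phi>_monom: "\<Phi> (monom 1 n) = act (m [^] n) v" for n
  proof (induction n)
    case 0
    show ?case using vV mG by (simp add: \<Phi>_pCons \<Phi>0 monom_0)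
  next
    case (Suc n)
    have "m [^] Suc n = m \<otimes> m [^] n" using mG by (rule nat_pow_Suc2)
    then show ?case using Suc vV mG by (simp add: \<Phi>_pCons monom_Suc act_mult add_pow_def)
  qed
  have \<Phi>_1: "\<Phi> 1 = v" using \<Phi>_monom[of 0] vV by (simp add: monom_0 one_pCons)
  have \<Phi>_step: "\<Phi> ([:-1, 1:] * P) \<oplus>\<^bsub>V\<^esub> \<Phi> P = act m (\<Phi> P)" for P
  proof -
    have "[:-1, 1:] * P + P = pCons 0 P" by (simp add: mult_pCons_left)
    then have "\<Phi> ([:-1, 1:] * P) \<oplus>\<^bsub>V\<^esub> \<Phi> P = \<Phi> (pCons 0 P)" by (simp add: \<Phi>_add[symmetric])
    then show ?thesis using \<Phi>V mG by (simp add: \<Phi>_pCons add_pow_def)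
  qed
  obtain Q :: "int poly" where Q: "[:-1, 1:] ^ p = monom 1 p - 1 + smult (int p) Q"
    using prime_dvd_binomial_minus_one[OF p] by blast
  have "\<Phi> ([:-1, 1:] ^ p) \<oplus>\<^bsub>V\<^esub> \<Phi> 1 = \<Phi> (monom 1 p + smult (int p) Q)"
    unfolding \<Phi>_add[symmetric] Q by simp
  also have "\<dots> = v \<oplus>\<^bsub>V\<^esub> [p] \<cdot>\<^bsub>V\<^esub> \<Phi> Q"
    using m(2) vV by (simp add: \<Phi>_add \<Phi>_monom \<Phi>_smult add_pow_def int_pow_int)
  also have "\<dots> = v" using ring_char_multiple[OF p pK \<Phi>V] vV by simp
  finally have nil: "\<Phi> ([:-1, 1:] ^ p) = \<zero>\<^bsub>V\<^esub>" using \<Phi>_1 vV \<Phi>V by simp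
  \<comment> \<open>\<open>\<Phi> ([:-1, 1:] ^ k)\<close> is the \<open>k\<close>-th power of \<open>m - 1\<close> applied to \<open>v\<close>\<close>
  define k where "k = (LEAST k. \<Phi> ([:-1, 1:] ^ k) = \<zero>\<^bsub>V\<^esub>)"
  have k: "\<Phi> ([:-1, 1:] ^ k) = \<zero>\<^bsub>V\<^esub>" unfolding k_def by (rule LeastI, rule nil)
  have "k \<noteq> 0" using k \<Phi>_1 v(2) by (cases k) auto
  then obtain l where l: "k = Suc l" by (cases k) auto
  define w where "w = \<Phi> ([:-1, 1:] ^ l)"
  have w0: "w \<noteq> \<zero>\<^bsub>V\<^esub>" unfolding w_def by (rule not_less_Least) (use l in \<open>simp add: k_def[symmetric]\<close>)
  have "act m w = w" using \<Phi>_step[of "[:-1, 1:] ^ l"] k l \<Phi>V by (simp add: w_def)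
  moreover have "\<Phi> P \<in> fixed_vectors L" for P
  proof (induction P)
    case 0
    show ?case using subgroup.subset[OF L_subgroup] by (simp add: \<Phi>0)
  next
    case (pCons c P)
    have "act n (\<Phi> (pCons c P)) = \<Phi> (pCons c P)" if n: "n \<in> L" for n
    proof -
      have nG: "n \<in> carrier G" by (rule LG[OF n])
      interpret a: group_hom "add_monoid V" "add_monoid V" "act n"
        by unfold_locales (auto simp: hom_def scaled_act_add nG)
      have "act n ([c] \<cdot>\<^bsub>V\<^esub> v) = [c] \<cdot>\<^bsub>V\<^esub> v"
        using a.hom_int_pow[of v c] vV v(1) n by (simp add: add_pow_def fixed_vectors_def)
      moreover have "act n (act m (\<Phi> P)) = act m (\<Phi> P)"
        using act_fixed_vectors[OF m(1) pCons(2)] n by (simp add: fixed_vectors_def)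
      ultimately show ?thesis using nG vV mG \<Phi>V[of P] by (simp add: \<Phi>_pCons scaled_act_add)
    qed
    then show ?case using \<Phi>V by (simp add: fixed_vectors_def)
  qed
  ultimately show ?thesis using w0 by (intro mem_if_fixes[OF m(1), of w]) (auto simp: w_def)
qed

end

text \<open>Otherwise all of \<open>M\<close> fixes a nonzero vector, and then, by simplicity, every vector.\<close>

theorem (in faithful_rep) ring_char_not_exponent:
  assumes M: "M \<lhd> G" "finite M" "M \<noteq> {\<one>}" and comm: "\<And>x y. x \<in> M \<Longrightarrow> y \<in> M \<Longrightarrow> x \<otimes> y = y \<otimes> x"
    and p: "Factorial_Ring.prime (p::nat)" "\<And>x. x \<in> M \<Longrightarrow> x [^] p = \<one>"
  shows "ring_char K \<noteq> p"
proof
  assume pK: "ring_char K = p"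
  obtain L where "maximal_fixing G K V M L"
    by (rule maximal_fixing_exists[OF normal_imp_subgroup[OF M(1)] M(2) comm])
  then interpret maximal_fixing G K V M L .
  have "M \<subseteq> L" using mem_if_char[OF p(1) pK] p(2) by blast
  then show False using L_core_free[OF M(1)] M(3) by blast
qed

section \<open>The socle as a module\<close>

context group
begin

lemma generate_commute:
  assumes S: "S \<subseteq> carrier G" "\<And>x y. x \<in> S \<Longrightarrow> y \<in> S \<Longrightarrow> x \<otimes> y = y \<otimes> x"
    and xy: "x \<in> generate G S" "y \<in> generate G S"
  shows "x \<otimes> y = y \<otimes> x"
proof -
  have step: "z \<otimes> u = u \<otimes> z" if u: "u \<in> carrier G" "\<And>s. s \<in> S \<Longrightarrow> s \<otimes> u = u \<otimes> s" and z: "z \<in> generate G S" for u z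
    using z
  proof (induction rule: generate.induct)
    case one
    then show ?case using u by simp
  next
    case (incl h)
    then show ?case using u by blast
  next
    case (inv h)
    have h: "h \<in> carrier G" using inv S by blast
    have "inv h \<otimes> (h \<otimes> u) \<otimes> inv h = inv h \<otimes> (u \<otimes> h) \<otimes> inv h" using u(2)[OF inv] by simp
    moreover have "inv h \<otimes> (h \<otimes> u) \<otimes> inv h = u \<otimes> inv h" using h u(1) by (simp add: m_assoc[symmetric])
    moreover have "inv h \<otimes> (u \<otimes> h) \<otimes> inv h = inv h \<otimes> u" using h u(1) by (simp add: m_assoc)
    ultimately show ?case by simp
  next
    case (eng g h)
    have c: "g \<in> carrier G" "h \<in> carrier G" using eng generate_in_carrier[OF S(1)] by auto
    have "g \<otimes> h \<otimes> u = g \<otimes> (u \<otimes> h)" using c u eng by (simp add: m_assoc)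
    also have "\<dots> = (u \<otimes> g) \<otimes> h" using c u eng by (simp add: m_assoc[symmetric])
    finally show ?case using c u by (simp add: m_assoc)
  qed
  have "y \<otimes> s = s \<otimes> y" if s: "s \<in> S" for s
    using step[of s y] S s xy(2) by blast
  then show ?thesis using step[of y x] generate_in_carrier[OF S(1) xy(2)] xy(1) by metis
qed

text \<open>Commutators of elements of different minimal normal subgroups lie in their intersection.\<close>

lemma minimal_normals_commute:
  assumes sol: "solvable G" and M: "minimal_normal G M" and N: "minimal_normal G N" and xy: "x \<in> M" "y \<in> N"
  shows "x \<otimes> y = y \<otimes> x"
proof (cases "M = N")
  case True
  then show ?thesis using solvable_minimal_normal_commutes[OF sol M] xy by blast
next
  case False
  have nM: "M \<lhd> G" and nN: "N \<lhd> G" using M N by (auto simp: minimal_normal_def)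
  interpret M: normal M G by fact
  interpret N: normal N G by fact
  have "\<not> M \<subseteq> N" using False M N unfolding minimal_normal_def by blast
  then have MN: "M \<inter> N = {\<one>}" by (rule minimal_normal_Int[OF M nN])
  have c: "x \<in> carrier G" "y \<in> carrier G" using xy by auto
  have "x \<otimes> (y \<otimes> inv x \<otimes> inv y) \<in> M" using M.inv_op_closed2[OF c(2), of "inv x"] xy by simp
  moreover have "(x \<otimes> y \<otimes> inv x) \<otimes> inv y \<in> N" using N.inv_op_closed2[OF c(1), of y] xy by simp
  ultimately have "x \<otimes> y \<otimes> inv x \<otimes> inv y = \<one>" using MN c by (auto simp: m_assoc)
  then have "x \<otimes> y \<otimes> inv x \<otimes> inv y \<otimes> y \<otimes> x = y \<otimes> x" using c by simp
  then show ?thesis using c by (simp add: m_assoc)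
qed

lemma socle_generators: "\<Union>{N. minimal_normal G N} \<subseteq> carrier G"
  by (auto simp: minimal_normal_def dest: normal_imp_subgroup subgroup.mem_carrier)

lemma socle_commutes:
  assumes "solvable G" "x \<in> socle G" "y \<in> socle G"
  shows "x \<otimes> y = y \<otimes> x"
  using assms(2,3) unfolding socle_def
  by (rule generate_commute[OF socle_generators, rotated]) (use minimal_normals_commute[OF assms(1)] in blast)

lemma socle_normal: "socle G \<lhd> G"
  unfolding socle_def
proof (rule normal_generateI[OF socle_generators])
  fix h g assume "h \<in> \<Union>{N. minimal_normal G N}" and g: "g \<in> carrier G"
  then obtain N where N: "minimal_normal G N" "h \<in> N" by blast
  then have "N \<lhd> G" by (simp add: minimal_normal_def)
  then have "g \<otimes> h \<otimes> inv g \<in> N" using g N(2) by (rule normal.inv_op_closed2)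
  then show "g \<otimes> h \<otimes> inv g \<in> \<Union>{N. minimal_normal G N}" using N by blast
qed

lemma minimal_normal_socle: "minimal_normal G M \<Longrightarrow> M \<subseteq> socle G"
  unfolding socle_def by (auto intro: generate.incl)

text \<open>The module \<open>F\<close> is the sum of the simple modules in \<open>\<M>\<close>. It is described as the least normal
  subgroup that contains them, which makes sums of two such modules easy.\<close>

definition spanned_by_minimal :: "'a set set \<Rightarrow> 'a set \<Rightarrow> bool"
  where "spanned_by_minimal \<M> F \<longleftrightarrow> F \<lhd> G \<and> finite F \<and> (\<forall>M\<in>\<M>. minimal_normal G M \<and> M \<subseteq> F) \<and>
    (\<forall>B. B \<lhd> G \<longrightarrow> (\<forall>M\<in>\<M>. M \<subseteq> B) \<longrightarrow> F \<subseteq> B)"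

lemma spanned_by_minimal_mult:
  assumes "spanned_by_minimal \<M> E" "spanned_by_minimal \<N> F"
  shows "spanned_by_minimal (\<M> \<union> \<N>) (E <#> F)"
proof -
  have EF: "E \<lhd> G" "F \<lhd> G" "finite E" "finite F" using assms by (auto simp: spanned_by_minimal_def)
  note sub = set_mult_superset[OF normal_imp_subgroup[OF EF(1)] normal_imp_subgroup[OF EF(2)]]
  have "E <#> F = (\<lambda>(x, y). x \<otimes> y) ` (E \<times> F)" by (auto simp: set_mult_def)
  then have "finite (E <#> F)" using EF by simp
  moreover have "E <#> F \<subseteq> B" if "B \<lhd> G" "\<forall>M\<in>\<M> \<union> \<N>. M \<subseteq> B" for B
    using assms that by (intro set_mult_least normal_imp_subgroup) (auto simp: spanned_by_minimal_def)
  moreover have "minimal_normal G M \<and> M \<subseteq> E <#> F" if "M \<in> \<M> \<union> \<N>" for M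
  proof -
    have "minimal_normal G M \<and> (M \<subseteq> E \<or> M \<subseteq> F)"
      using assms that unfolding spanned_by_minimal_def by blast
    then show ?thesis using sub by blast
  qed
  ultimately show ?thesis
    using normal_set_mult[OF EF(1,2)] unfolding spanned_by_minimal_def by auto
qed

lemma spanned_by_minimal_socle:
  assumes fin: "\<And>M. minimal_normal G M \<Longrightarrow> finite M" and S: "finite S" "S \<subseteq> socle G"
  obtains \<M> F where "spanned_by_minimal \<M> F" "S \<subseteq> F" "F \<subseteq> socle G"
proof -
  have triv: "spanned_by_minimal {} {\<one>}"
    unfolding spanned_by_minimal_def using normal_trivial subgroup.one_closed[OF normal_imp_subgroup] by auto
  have single: "spanned_by_minimal {M} M" if "minimal_normal G M" for M
    using that fin[OF that] by (auto simp: spanned_by_minimal_def minimal_normal_def)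
  have elem: "\<exists>\<M> F. spanned_by_minimal \<M> F \<and> x \<in> F" if "x \<in> socle G" for x
    using that unfolding socle_def
  proof (induction rule: generate.induct)
    case one
    show ?case using triv by blast
  next
    case (incl h)
    then show ?case using single by blast
  next
    case (inv h)
    then obtain M where M: "minimal_normal G M" "h \<in> M" by blast
    then have "M \<lhd> G" by (simp add: minimal_normal_def)
    then have "inv h \<in> M" using M(2) by (rule subgroup.m_inv_closed[OF normal_imp_subgroup])
    with single[OF M(1)] show ?case by (intro exI conjI)
  next
    case (eng g h)
    then obtain \<M> E \<N> F where *: "spanned_by_minimal \<M> E" "g \<in> E" "spanned_by_minimal \<N> F" "h \<in> F"
      by blast
    then have "g \<otimes> h \<in> E <#> F" unfolding set_mult_def by blast
    then show ?case using spanned_by_minimal_mult[OF *(1,3)] by blast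
  qed
  have "\<exists>\<M> F. spanned_by_minimal \<M> F \<and> S \<subseteq> F"
    using S
  proof (induction S)
    case empty
    show ?case using triv by blast
  next
    case (insert x S)
    obtain \<M> E where E: "spanned_by_minimal \<M> E" "x \<in> E" using elem insert.prems by blast
    obtain \<N> F where F: "spanned_by_minimal \<N> F" "S \<subseteq> F" using insert by blast
    have EF: "E \<lhd> G" "F \<lhd> G" using E(1) F(1) by (simp_all add: spanned_by_minimal_def)
    have "E \<subseteq> E <#> F" "F \<subseteq> E <#> F"
      by (rule set_mult_superset[OF normal_imp_subgroup[OF EF(1)] normal_imp_subgroup[OF EF(2)]])+
    then have "insert x S \<subseteq> E <#> F" using E F by blast
    then show ?case using spanned_by_minimal_mult[OF E(1) F(1)] by blast
  qed
  then obtain \<M> F where F: "spanned_by_minimal \<M> F" "S \<subseteq> F" by blast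
  moreover have "F \<subseteq> socle G"
    using F(1) socle_normal minimal_normal_socle unfolding spanned_by_minimal_def by blast
  ultimately show ?thesis using that by blast
qed

text \<open>A normal subgroup \<open>N\<close> of largest size with \<open>A \<inter> N = {\<one>}\<close> is a complement: a simple module outside
  \<open>A <#> N\<close> could be added to \<open>N\<close>.\<close>

lemma finite_semisimple_if_spanned:
  assumes F: "spanned_by_minimal \<M> F" and comm: "\<And>x y. x \<in> F \<Longrightarrow> y \<in> F \<Longrightarrow> x \<otimes> y = y \<otimes> x"
  shows "finite_semisimple G F"
proof (intro finite_semisimple.intro finite_semisimple_axioms.intro group_axioms)
  have nF: "F \<lhd> G" and fin: "finite F" using F by (auto simp: spanned_by_minimal_def)
  show "F \<lhd> G" "finite F" by fact+
  show "x \<otimes> y = y \<otimes> x" if "x \<in> F" "y \<in> F" for x y using that by (rule comm)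
  fix A assume A: "A \<lhd> G" "A \<subseteq> F"
  interpret A: normal A G by (rule A(1))
  let ?P = "\<lambda>N. N \<lhd> G \<and> N \<subseteq> F \<and> A \<inter> N = {\<one>}"
  have "?P {\<one>}"
    using normal_trivial A.one_closed A(2) by auto
  moreover have "\<forall>N. ?P N \<longrightarrow> card N < Suc (card F)"
    using fin by (auto simp: less_Suc_eq_le intro: card_mono)
  ultimately have "\<exists>N. ?P N \<and> (\<forall>N'. ?P N' \<longrightarrow> card N' \<le> card N)" by (rule ex_has_greatest_nat)
  then obtain N where N: "?P N" and max: "\<forall>N'. ?P N' \<longrightarrow> card N' \<le> card N" by (elim exE conjE[where P = "?P _"])
  interpret N: normal N G using N by blast
  have nAN: "A <#> N \<lhd> G" using A N by (intro normal_set_mult) auto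
  note sub = set_mult_superset[OF A.subgroup_axioms N.subgroup_axioms]
  have "M \<subseteq> A <#> N" if M: "M \<in> \<M>" for M
  proof (rule ccontr)
    assume no: "\<not> M \<subseteq> A <#> N"
    have mM: "minimal_normal G M" "M \<subseteq> F" using F M by (auto simp: spanned_by_minimal_def)
    have nM: "M \<lhd> G" using mM by (simp add: minimal_normal_def)
    interpret M: normal M G by (rule nM)
    have MI: "M \<inter> (A <#> N) = {\<one>}" by (rule minimal_normal_Int[OF mM(1) nAN no])
    have "A \<inter> (N <#> M) \<subseteq> {\<one>}"
    proof
      fix a assume a: "a \<in> A \<inter> (N <#> M)"
      then obtain n m where nm: "n \<in> N" "m \<in> M" "a = n \<otimes> m" by (auto simp: set_mult_def)
      then have "m = inv n \<otimes> a" by (simp add: m_assoc[symmetric])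
      moreover have "inv n \<in> F" "a \<in> F" using nm N a A(2) N.m_inv_closed by auto
      ultimately have "m = a \<otimes> inv n" using comm by simp
      then have "m \<in> A <#> N" using a nm unfolding set_mult_def by blast
      then have "m = \<one>" using MI nm by blast
      then have "a = n" using nm by simp
      then show "a \<in> {\<one>}" using a nm N by blast
    qed
    moreover have "\<one> \<in> A \<inter> (N <#> M)"
      using set_mult_superset[OF N.subgroup_axioms M.subgroup_axioms] N.one_closed by auto
    moreover have "N <#> M \<subseteq> F"
      using N mM by (intro set_mult_least normal_imp_subgroup[OF nF]) auto
    moreover have "N <#> M \<lhd> G" by (rule normal_set_mult[OF N.normal_axioms nM])
    ultimately have "card (N <#> M) \<le> card N" using max by blast
    moreover have "N \<subset> N <#> M"
      using set_mult_superset[OF N.subgroup_axioms M.subgroup_axioms] sub no by blast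
    then have "card N < card (N <#> M)"
      using \<open>N <#> M \<subseteq> F\<close> fin by (intro psubset_card_mono) (auto intro: finite_subset)
    ultimately show False by simp
  qed
  then have "F \<subseteq> A <#> N" using F nAN by (auto simp: spanned_by_minimal_def)
  moreover have "A <#> N \<subseteq> F" using A N by (intro set_mult_least normal_imp_subgroup[OF nF]) auto
  ultimately show "\<exists>N. N \<lhd> G \<and> N \<subseteq> F \<and> A \<inter> N = {\<one>} \<and> A <#> N = F" using N by blast
qed

end

lemma (in finite_semisimple) finite_semisimple_sub:
  assumes A: "A \<lhd> G" "A \<subseteq> F"
  shows "finite_semisimple G A"
proof (intro finite_semisimple.intro finite_semisimple_axioms.intro group_axioms)
  show "A \<lhd> G" by (rule A(1))
  show "finite A" using A(2) F_finite by (rule finite_subset)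
  show "x \<otimes> y = y \<otimes> x" if "x \<in> A" "y \<in> A" for x y using F_comm A(2) that by blast
  show "\<exists>N. N \<lhd> G \<and> N \<subseteq> A \<and> S \<inter> N = {\<one>} \<and> S <#> N = A" if "S \<lhd> G" "S \<subseteq> A" for S
    using relative_complement[OF A that] by metis
qed

lemma conj_module_submodule_iff:
  fixes G (structure)
  assumes G: "group G" and A: "A \<lhd> G" "comm_group (G\<lparr>carrier := A\<rparr>)"
  shows "submodule N (group_ring \<Z> G) (conj_module G A) \<longleftrightarrow> N \<lhd> G \<and> N \<subseteq> A"
proof -
  interpret group G by fact
  interpret A: normal A G by fact
  interpret H: comm_group "G\<lparr>carrier := A\<rparr>" by fact
  let ?M = "conj_module G A"
  interpret L: left_module "group_ring \<Z> G" ?M by (rule conj_module_left_module[OF A])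
  have M: "carrier ?M = A" "x \<oplus>\<^bsub>?M\<^esub> y = x \<otimes> y" "\<zero>\<^bsub>?M\<^esub> = \<one>" for x y by (simp_all add: conj_module_def)
  have minv: "inv\<^bsub>add_monoid ?M\<^esub> x = inv x" if "x \<in> A" for x
  proof -
    have "a_inv ?M x = inv x" using that by (intro L.M.minus_equality) (auto simp: M)
    then show ?thesis by (simp add: a_inv_def)
  qed
  have Zr: "ring \<Z>" by (rule cring.axioms(1)[OF int_is_cring])
  show ?thesis
  proof
    assume "submodule N (group_ring \<Z> G) ?M"
    then interpret N: submodule N "group_ring \<Z> G" ?M .
    have NA: "N \<subseteq> A" using N.subset by (simp add: M)
    have "N \<lhd> G"
    proof (rule normal_invI)
      show "subgroup N G"
      proof
        show "N \<subseteq> carrier G" using NA A.subset by (rule order_trans)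
        show "x \<otimes> y \<in> N" if "x \<in> N" "y \<in> N" for x y using N.m_closed[OF that] by (simp add: M)
        show "\<one> \<in> N" using N.one_closed by (simp add: M)
        show "inv x \<in> N" if x: "x \<in> N" for x
        proof -
          have "x \<in> A" using NA x by blast
          then show ?thesis using minv N.m_inv_closed[OF x] by metis
        qed
      qed
      fix x g assume x: "x \<in> N" and g: "g \<in> carrier G"
      have xA: "x \<in> A" using x NA by blast
      let ?s = "group_ring_single \<Z> G g"
      have s: "supp \<Z> G ?s = {g}" using g by (auto simp: supp_def group_ring_single_def)
      have "?s \<in> carrier (group_ring \<Z> G)"
        unfolding group_ring_single_monomial by (rule group_ring_monomial_closed[OF Zr g]) simp
      then have "?s \<odot>\<^bsub>?M\<^esub> x \<in> N" using x by (rule N.smult_closed)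
      moreover have "?s \<odot>\<^bsub>?M\<^esub> x = finprod (G\<lparr>carrier := A\<rparr>) (\<lambda>h. (h \<otimes> x \<otimes> inv h) [^] ?s h) {g}"
        by (simp add: conj_module_def s)
      moreover have "\<dots> = g \<otimes> x \<otimes> inv g"
        using A.inv_op_closed2[OF g xA] g xA
        by (simp add: group_ring_single_def int_pow_1)
      ultimately show "g \<otimes> x \<otimes> inv g \<in> N" by simp
    qed
    with NA show "N \<lhd> G \<and> N \<subseteq> A" by blast
  next
    assume N': "N \<lhd> G \<and> N \<subseteq> A"
    then interpret N: normal N G by blast
    have NA: "x \<in> A" if "x \<in> N" for x using N' that by blast
    show "submodule N (group_ring \<Z> G) ?M"
    proof (intro submodule.intro submodule_axioms.intro)
      show "subgroup N (add_monoid ?M)"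
        by unfold_locales (use NA minv in \<open>auto simp: M\<close>)
      fix a x assume a: "a \<in> carrier (group_ring \<Z> G)" and x: "x \<in> N"
      let ?f = "\<lambda>g. (g \<otimes> x \<otimes> inv g) [^] a g"
      have f: "?f g \<in> N" if "g \<in> carrier G" for g
        using N.inv_op_closed2[OF that x] by (rule subgroup_int_pow_closed[OF N.subgroup_axioms])
      have "finprod (G\<lparr>carrier := A\<rparr>) ?f S \<in> N" if "finite S" "S \<subseteq> carrier G" for S
        using that
      proof (induction S)
        case (insert s S)
        then show ?case
          using f NA by (subst H.finprod_insert) (auto simp: subset_iff)
      qed simp
      from this[OF group_ring_carrierD(3)[OF a]] show "a \<odot>\<^bsub>?M\<^esub> x \<in> N"
        by (auto simp: conj_module_def supp_def)
    qed
  qed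
qed

lemma (in group) normal_Inter:
  assumes "\<A> \<noteq> {}" "\<And>N. N \<in> \<A> \<Longrightarrow> N \<lhd> G"
  shows "\<Inter>\<A> \<lhd> G"
proof (rule normal_invI)
  show "subgroup (\<Inter>\<A>) G" by (rule subgroups_Inter) (use assms normal_imp_subgroup in auto)
  show "g \<otimes> x \<otimes> inv g \<in> \<Inter>\<A>" if "x \<in> \<Inter>\<A>" "g \<in> carrier G" for g x
    using that normal.inv_op_closed2[OF assms(2)] by blast
qed

text \<open>A finite subset of the socle generates a submodule \<open>F\<close> of a finite semisimple module, to which the
  criterion for cyclic modules applies with \<open>L\<close> in the place of \<open>K\<close>. For \<open>p = ring_char K\<close> there are
  no elements of order \<open>p\<close> in \<open>F\<close>, and the trivial character suffices.\<close>

theorem theorem5p1: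
  fixes G :: "('g, 'h) monoid_scheme"
    and K :: "('k, 's) ring_scheme"
    and V :: "('g \<Rightarrow> 'k, 'v, 'm) module_scheme"
  assumes "group G" and "solvable G" and "finite_rank G"
    and "field K"
    and "faithful_irreducible_rep K G V"
  shows "locally_cyclic_module (group_ring \<Z> G) (conj_module G (socle G)) \<and>
    ring_char K \<notin> torsion_primes (G\<lparr>carrier := socle G\<rparr>)"
proof
  interpret faithful_rep G K V
    using assms by (intro faithful_rep.intro faithful_rep_axioms.intro)
  note sol = assms(2)
  have min_finite: "finite M" if "minimal_normal G M" for M
    using minimal_normal_finite[OF assms(2,3) that] by metis
  have min_exp: "\<exists>p::nat. Factorial_Ring.prime p \<and> (\<forall>x\<in>M. x [^]\<^bsub>G\<^esub> p = \<one>\<^bsub>G\<^esub>)" if "minimal_normal G M" for M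
    using minimal_normal_finite[OF assms(2,3) that] by metis
  note comm = socle_commutes[OF sol]
  have sub: "subgroup (socle G) G" by (rule normal_imp_subgroup[OF socle_normal])
  have cg: "comm_group (G\<lparr>carrier := socle G\<rparr>)" by (rule normal_comm_groupI[OF sub comm])
  interpret S: normal "socle G" G by (rule socle_normal)
  have semisimple: "finite_semisimple G F" if F: "spanned_by_minimal \<M> F" "F \<subseteq> socle G" for \<M> F
    by (rule finite_semisimple_if_spanned[OF F(1)]) (use comm F(2) in blast)
  have no_char: "x = \<one>\<^bsub>G\<^esub>" if F: "spanned_by_minimal \<M> F" "F \<subseteq> socle G"
    and p: "Factorial_Ring.prime p" "ring_char K = p" and x: "x \<in> F" "x [^]\<^bsub>G\<^esub> p = \<one>\<^bsub>G\<^esub>"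
    for \<M> F x and p :: nat
  proof -
    have nF: "F \<lhd> G" "finite F" using F(1) by (auto simp: spanned_by_minimal_def)
    have commF: "y \<otimes>\<^bsub>G\<^esub> z = z \<otimes>\<^bsub>G\<^esub> y" if "y \<in> F" "z \<in> F" for y z using comm F(2) that by blast
    have "{y \<in> F. y [^]\<^bsub>G\<^esub> p = \<one>\<^bsub>G\<^esub>} = {\<one>\<^bsub>G\<^esub>}"
    proof (rule ccontr)
      let ?P = "{y \<in> F. y [^]\<^bsub>G\<^esub> p = \<one>\<^bsub>G\<^esub>}"
      assume "?P \<noteq> {\<one>\<^bsub>G\<^esub>}"
      have "?P \<lhd> G" by (rule powers_normal(1)[OF nF(1) commF])
      then have "ring_char K \<noteq> p"
      proof (rule ring_char_not_exponent[OF _ _ \<open>?P \<noteq> {\<one>\<^bsub>G\<^esub>}\<close> _ p(1)])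
        show "finite ?P" using nF(2) by simp
        show "y \<otimes>\<^bsub>G\<^esub> z = z \<otimes>\<^bsub>G\<^esub> y" if "y \<in> ?P" "z \<in> ?P" for y z
          using that by (intro commF) simp_all
        show "y [^]\<^bsub>G\<^esub> p = \<one>\<^bsub>G\<^esub>" if "y \<in> ?P" for y using that by simp
      qed
      then show False using p(2) by contradiction
    qed
    with x show ?thesis by blast
  qed
  show "ring_char K \<notin> torsion_primes (G\<lparr>carrier := socle G\<rparr>)"
  proof
    assume "ring_char K \<in> torsion_primes (G\<lparr>carrier := socle G\<rparr>)"
    then have p: "Factorial_Ring.prime (ring_char K)"
      and "\<exists>x\<in>socle G. group.ord (G\<lparr>carrier := socle G\<rparr>) x = ring_char K"
      by (simp_all add: torsion_primes_def)
    then obtain x where x: "x \<in> socle G"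
      and ord: "group.ord (G\<lparr>carrier := socle G\<rparr>) x = ring_char K" by blast
    interpret C: comm_group "G\<lparr>carrier := socle G\<rparr>" by (rule cg)
    have "x [^]\<^bsub>G\<lparr>carrier := socle G\<rparr>\<^esub> ring_char K = \<one>\<^bsub>G\<^esub>"
      using C.pow_ord_eq_1[of x] x ord by simp
    then have xp: "x [^]\<^bsub>G\<^esub> ring_char K = \<one>\<^bsub>G\<^esub>" by (simp add: nat_pow_def)
    obtain \<M> F where F: "spanned_by_minimal \<M> F" "{x} \<subseteq> F" "F \<subseteq> socle G"
      using spanned_by_minimal_socle[OF min_finite, of "{x}"] x by auto
    have "x = \<one>\<^bsub>G\<^esub>" using no_char[OF F(1,3) p refl _ xp] F(2) by blast
    then have "ring_char K = 1" using C.ord_eq_1[of x] x ord by simp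
    with p show False by simp
  qed
  have iff: "submodule N (group_ring \<Z> G) (conj_module G (socle G)) \<longleftrightarrow> N \<lhd> G \<and> N \<subseteq> socle G" for N
    by (rule conj_module_submodule_iff[OF assms(1) socle_normal cg])
  have gen: "submodule_generated (group_ring \<Z> G) (conj_module G (socle G)) B =
      \<Inter>{N. (N \<lhd> G \<and> N \<subseteq> socle G) \<and> B \<subseteq> N}" for B
    unfolding submodule_generated_def iff ..
  have gen_least: "\<Inter>{N. (N \<lhd> G \<and> N \<subseteq> socle G) \<and> B \<subseteq> N} \<lhd> G" if "B \<subseteq> socle G" for B
    by (rule normal_Inter) (use that socle_normal in auto)
  show "locally_cyclic_module (group_ring \<Z> G) (conj_module G (socle G))"
    unfolding locally_cyclic_module_def
  proof (intro conjI allI impI)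
    show "left_module (group_ring \<Z> G) (conj_module G (socle G))"
      by (rule conj_module_left_module[OF socle_normal cg])
    fix B assume "finite B \<and> B \<subseteq> carrier (conj_module G (socle G))"
    then have B: "finite B" "B \<subseteq> socle G" by (auto simp: conj_module_def)
    obtain \<M> E where E: "spanned_by_minimal \<M> E" "B \<subseteq> E" "E \<subseteq> socle G"
      using spanned_by_minimal_socle[OF min_finite B] .
    have nE: "E \<lhd> G" using E(1) by (simp add: spanned_by_minimal_def)
    define F where "F = \<Inter>{N. (N \<lhd> G \<and> N \<subseteq> socle G) \<and> B \<subseteq> N}"
    have nF: "F \<lhd> G" and FE: "F \<subseteq> E" and BF: "B \<subseteq> F"
      using gen_least[OF B(2)] nE E by (auto simp: F_def)
    interpret E: finite_semisimple G E by (rule semisimple[OF E(1,3)])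
    interpret F: finite_semisimple G F by (rule E.finite_semisimple_sub[OF nF FE])
    obtain L where "maximal_fixing G K V F L"
      by (rule maximal_fixing_exists[OF normal_imp_subgroup[OF nF] F.F_finite F.F_comm])
    then interpret L: maximal_fixing G K V F L .
    have chars: "\<exists>\<chi>\<in>characters {y \<in> F. y [^]\<^bsub>G\<^esub> p = \<one>\<^bsub>G\<^esub>}. \<forall>y\<in>F. y [^]\<^bsub>G\<^esub> p = \<one>\<^bsub>G\<^esub> \<longrightarrow> \<chi> y = 1 \<longrightarrow> y \<in> L"
      if p: "Factorial_Ring.prime p" for p :: nat
    proof (cases "ring_char K = p")
      case True
      have triv: "y = \<one>\<^bsub>G\<^esub>" if "y \<in> F" "y [^]\<^bsub>G\<^esub> p = \<one>\<^bsub>G\<^esub>" for y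
        using no_char[OF E(1,3) p True] that FE by blast
      have P: "{y \<in> F. y [^]\<^bsub>G\<^esub> p = \<one>\<^bsub>G\<^esub>} = {\<one>\<^bsub>G\<^esub>}"
      proof
        show "{y \<in> F. y [^]\<^bsub>G\<^esub> p = \<one>\<^bsub>G\<^esub>} \<subseteq> {\<one>\<^bsub>G\<^esub>}" using triv by blast
        show "{\<one>\<^bsub>G\<^esub>} \<subseteq> {y \<in> F. y [^]\<^bsub>G\<^esub> p = \<one>\<^bsub>G\<^esub>}" using F.F.one_closed by simp
      qed
      have "(\<lambda>y. if y = \<one>\<^bsub>G\<^esub> then 1 else 0) \<in> characters {y \<in> F. y [^]\<^bsub>G\<^esub> p = \<one>\<^bsub>G\<^esub>}"
        unfolding P by (simp add: characters_def)
      moreover have "y \<in> L" if "y \<in> F" "y [^]\<^bsub>G\<^esub> p = \<one>\<^bsub>G\<^esub>" for y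
        using triv[OF that] subgroup.one_closed[OF L.L_subgroup] by simp
      ultimately show ?thesis by blast
    next
      case False
      then show ?thesis by (rule L.character_detecting_L[OF p])
    qed
    obtain x where x: "x \<in> F" "normal_closure x = F"
      using F.cyclic_if_core_free_cocyclic[OF L.L_core_free min_exp chars] by blast
    have "submodule_generated (group_ring \<Z> G) (conj_module G (socle G)) {x} = F"
      unfolding gen
    proof
      have "F \<subseteq> socle G" using FE E(3) by blast
      then show "\<Inter>{N. (N \<lhd> G \<and> N \<subseteq> socle G) \<and> {x} \<subseteq> N} \<subseteq> F" using nF x(1) by blast
      show "F \<subseteq> \<Inter>{N. (N \<lhd> G \<and> N \<subseteq> socle G) \<and> {x} \<subseteq> N}"
        unfolding x(2)[symmetric] using normal_closure_minimal by blast
    qed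
    then have "submodule_generated (group_ring \<Z> G) (conj_module G (socle G)) {x} =
        submodule_generated (group_ring \<Z> G) (conj_module G (socle G)) B"
      unfolding gen[of B] F_def .
    moreover have "x \<in> carrier (conj_module G (socle G))"
      using x(1) FE E(3) by (auto simp: conj_module_def)
    ultimately show "\<exists>x\<in>carrier (conj_module G (socle G)).
        submodule_generated (group_ring \<Z> G) (conj_module G (socle G)) {x} =
        submodule_generated (group_ring \<Z> G) (conj_module G (socle G)) B" by blast
  qed
qed

end
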